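(* Let $N\ge2$ and let $\mathbb{G}=O_N^+$ (respectively $\mathbb{G}=O_N^*$). There exists no compact quantum subgroup $\mathbb{K}$ of $\mathbb{G}$ such that the free sphere $S_+^{N-1}$ (respectively the half-liberated sphere $S_*^{N-1}$) is isomorphic to the quotient of $\mathbb{G}$ by $\mathbb{K}$ as a coidalgebra; i.e., writing $\mathscr{O}(S)$ for $\mathscr{O}(S_+^{N-1})$ (respectively $\mathscr{O}(S_*^{N-1})$), there are no compact quantum subgroup $\mathbb{K}$ of $\mathbb{G}$ and unital $*$-isomorphism $\varphi:\mathscr{O}(S)\to\mathscr{O}_{\mathbb{G}}(\mathbb{K}\backslash\mathbb{G})$ with $\Delta\circ\varphi=(\varphi\otimes\mathrm{id})\circ\alpha$.
   Context: $O_N^+$ is the free orthogonal quantum group: $\mathscr{O}(O_N^+)$ is the universal unital $*$-algebra generated by self-adjoint $u_{ij}$ ($1\le i,j\le N$) with $u=(u_{ij})$ satisfying $uu^t=u^tu=1$, with $\Delta(u_{ij})=\sum_k u_{ik}\otimes u_{kj}$. The half-liberated orthogonal quantum group $O_N^*$ is obtained by adding the relations $abc=cba$ for all $a,b,c\in\{u_{ij}\}$. $\mathscr{O}(S_\times^{N-1})$, $\times\in\{+,*\}$, is the unital $*$-subalgebra of $\mathscr{O}(O_N^\times)$ generated by $x_i=u_{1i}$, $i=1,\ldots,N$, with right coaction $\alpha=\Delta|_{\mathscr{O}(S_\times^{N-1})}:\mathscr{O}(S_\times^{N-1})\to\mathscr{O}(S_\times^{N-1})\otimes\mathscr{O}(O_N^\times)$.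 A compact quantum subgroup $\mathbb{K}$ of $\mathbb{G}$ is a compact quantum group together with a surjective unital $*$-homomorphism $\theta:\mathscr{O}(\mathbb{G})\to\mathscr{O}(\mathbb{K})$ intertwining the coproducts, $(\theta\otimes\theta)\circ\Delta=\Delta_{\mathbb{K}}\circ\theta$ (equivalently, such a morphism between the universal C$^*$-algebras). The associated quotient is given by $\mathscr{O}_{\mathbb{G}}(\mathbb{K}\backslash\mathbb{G})=\{x\in\mathscr{O}(\mathbb{G}):(\theta\otimes\mathrm{id})\Delta(x)=1\otimes x\}$, which satisfies $\Delta(\mathscr{O}_{\mathbb{G}}(\mathbb{K}\backslash\mathbb{G}))\subset\mathscr{O}_{\mathbb{G}}(\mathbb{K}\backslash\mathbb{G})\otimes\mathscr{O}(\mathbb{G})$. *)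

theory Defs
  imports Complex_Main "HOL-Algebra.Module" "HOL-Algebra.QuotRing"
begin

section \<open>Complex unital *-algebras with explicit carriers\<close>

text \<open>The locale \<open>algebra\<close> of \<^theory>\<open>HOL-Algebra.Module\<close> is restricted to commutative
  algebras, so noncommutative *-algebras are introduced here on top of \<open>ring\<close>.\<close>

record 'a star_alg = "(complex, 'a) module" +
  star :: "'a \<Rightarrow> 'a"

locale star_algebra = ring A for A :: "('a, 'z) star_alg_scheme" (structure) +
  assumes smult_closed: "x \<in> carrier A \<Longrightarrow> c \<odot> x \<in> carrier A"
    and smult_l_distr: "x \<in> carrier A \<Longrightarrow> (c + d) \<odot> x = c \<odot> x \<oplus> d \<odot> x"
    and smult_r_distr: "x \<in> carrier A \<Longrightarrow> y \<in> carrier A \<Longrightarrow> c \<odot> (x \<oplus> y) = c \<odot> x \<oplus> c \<odot> y"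
    and smult_assoc: "x \<in> carrier A \<Longrightarrow> (c * d) \<odot> x = c \<odot> (d \<odot> x)"
    and smult_one: "x \<in> carrier A \<Longrightarrow> 1 \<odot> x = x"
    and smult_mult_l: "x \<in> carrier A \<Longrightarrow> y \<in> carrier A \<Longrightarrow> (c \<odot> x) \<otimes> y = c \<odot> (x \<otimes> y)"
    and smult_mult_r: "x \<in> carrier A \<Longrightarrow> y \<in> carrier A \<Longrightarrow> x \<otimes> (c \<odot> y) = c \<odot> (x \<otimes> y)"
    and star_closed: "x \<in> carrier A \<Longrightarrow> star A x \<in> carrier A"
    and star_star: "x \<in> carrier A \<Longrightarrow> star A (star A x) = x"
    and star_add: "x \<in> carrier A \<Longrightarrow> y \<in> carrier A \<Longrightarrow> star A (x \<oplus> y) = star A x \<oplus> star A y"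
    and star_smult: "x \<in> carrier A \<Longrightarrow> star A (c \<odot> x) = cnj c \<odot> star A x"
    and star_mult: "x \<in> carrier A \<Longrightarrow> y \<in> carrier A \<Longrightarrow> star A (x \<otimes> y) = star A y \<otimes> star A x"

definition star_hom ::
  "('a, 'y) star_alg_scheme \<Rightarrow> ('b, 'z) star_alg_scheme \<Rightarrow> ('a \<Rightarrow> 'b) set" where
  "star_hom A B = {f \<in> ring_hom A B.
     (\<forall>c. \<forall>x\<in>carrier A. f (c \<odot>\<^bsub>A\<^esub> x) = c \<odot>\<^bsub>B\<^esub> f x) \<and>
     (\<forall>x\<in>carrier A. f (star A x) = star B (f x))}"

definition linear_map ::
  "('a, 'y) star_alg_scheme \<Rightarrow> ('b, 'z) star_alg_scheme \<Rightarrow> ('a \<Rightarrow> 'b) set" where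
  "linear_map A B = {f \<in> carrier A \<rightarrow> carrier B.
     (\<forall>x\<in>carrier A. \<forall>y\<in>carrier A. f (x \<oplus>\<^bsub>A\<^esub> y) = f x \<oplus>\<^bsub>B\<^esub> f y) \<and>
     (\<forall>c. \<forall>x\<in>carrier A. f (c \<odot>\<^bsub>A\<^esub> x) = c \<odot>\<^bsub>B\<^esub> f x)}"

definition complex_alg :: "complex star_alg" where
  "complex_alg = \<lparr>carrier = UNIV, mult = (*), one = 1, zero = 0, add = (+),
     smult = (*), star = cnj\<rparr>"

definition star_subalgebra :: "('a, 'z) star_alg_scheme \<Rightarrow> 'a set \<Rightarrow> bool" where
  "star_subalgebra A S \<longleftrightarrow> S \<subseteq> carrier A \<and> \<one>\<^bsub>A\<^esub> \<in> S \<and>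
     (\<forall>x\<in>S. \<forall>y\<in>S. x \<oplus>\<^bsub>A\<^esub> y \<in> S \<and> x \<otimes>\<^bsub>A\<^esub> y \<in> S) \<and>
     (\<forall>c. \<forall>x\<in>S. c \<odot>\<^bsub>A\<^esub> x \<in> S) \<and> (\<forall>x\<in>S. star A x \<in> S)"

definition star_generated :: "('a, 'z) star_alg_scheme \<Rightarrow> 'a set \<Rightarrow> 'a set" where
  "star_generated A X = \<Inter>{S. star_subalgebra A S \<and> X \<subseteq> S}"

definition lin_span :: "('a, 'z) star_alg_scheme \<Rightarrow> 'a set \<Rightarrow> 'a set" where
  "lin_span A X = {\<Oplus>\<^bsub>A\<^esub>x\<in>F. c x \<odot>\<^bsub>A\<^esub> x | F c. finite F \<and> F \<subseteq> X}"


section \<open>*-algebras given by generators and relations\<close>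

text \<open>The *-algebra of a monoid \<open>M\<close> with an involutive anti-automorphism \<open>\<sigma>\<close>: finitely
  supported functions on \<open>M\<close> with convolution, the basis vector at \<open>m\<close> having the
  basis vector at \<open>\<sigma> m\<close> as its adjoint.\<close>

definition monoid_alg :: "('m, 'z) monoid_scheme \<Rightarrow> ('m \<Rightarrow> 'm) \<Rightarrow> ('m \<Rightarrow> complex) star_alg" where
  "monoid_alg M \<sigma> =
    \<lparr>carrier = {f. finite {m. f m \<noteq> 0} \<and> {m. f m \<noteq> 0} \<subseteq> carrier M},
     mult = (\<lambda>f g m. \<Sum>p\<in>{p. f p \<noteq> 0}. \<Sum>q\<in>{q. g q \<noteq> 0}.
                if p \<otimes>\<^bsub>M\<^esub> q = m then f p * g q else 0),
     one = (\<lambda>m. if m = \<one>\<^bsub>M\<^esub> then 1 else 0),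
     zero = (\<lambda>m. 0),
     add = (\<lambda>f g m. f m + g m),
     smult = (\<lambda>c f m. c * f m),
     star = (\<lambda>f m. if m \<in> carrier M then cnj (f (\<sigma> m)) else 0)\<rparr>"

definition basis_vec :: "'m \<Rightarrow> 'm \<Rightarrow> complex" where
  "basis_vec m = (\<lambda>m'. if m' = m then 1 else 0)"

definition free_monoid :: "'x set \<Rightarrow> 'x list monoid" where
  "free_monoid X = \<lparr>carrier = lists X, mult = (@), one = []\<rparr>"

text \<open>The free unital *-algebra on self-adjoint generators \<open>X\<close>; the adjoint reverses words.\<close>

abbreviation free_alg :: "'x set \<Rightarrow> ('x list \<Rightarrow> complex) star_alg" where
  "free_alg X \<equiv> monoid_alg (free_monoid X) rev"

text \<open>Quotient by a two-sided *-ideal, extending \<^const>\<open>FactRing\<close>.\<close>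

definition star_quot :: "('a, 'z) star_alg_scheme \<Rightarrow> 'a set \<Rightarrow> 'a set star_alg" where
  "star_quot A I =
    \<lparr>carrier = carrier (A Quot I), mult = mult (A Quot I), one = one (A Quot I),
     zero = zero (A Quot I), add = add (A Quot I),
     smult = (\<lambda>c X. \<Union>x\<in>X. I +>\<^bsub>A\<^esub> (c \<odot>\<^bsub>A\<^esub> x)),
     star = (\<lambda>X. \<Union>x\<in>X. I +>\<^bsub>A\<^esub> star A x)\<rparr>"

text \<open>In a unital algebra every two-sided ring ideal is a linear subspace.\<close>

definition star_ideal :: "('a, 'z) star_alg_scheme \<Rightarrow> 'a set \<Rightarrow> 'a set" where
  "star_ideal A R = Idl\<^bsub>A\<^esub> (R \<union> star A ` R)"

text \<open>Linear extension to a quotient of a monoid algebra of a map \<open>h\<close> on the monoid: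
  the class of a function \<open>f\<close> is sent to the sum of the \<open>f m\<close>-multiples of \<open>h m\<close>. It is only
  applied to maps \<open>h\<close> whose linear extension vanishes on the ideal divided out, where the
  choice of the representative \<open>f\<close> is immaterial.\<close>

definition lin_ext ::
  "('b, 'z) star_alg_scheme \<Rightarrow> ('m \<Rightarrow> 'b) \<Rightarrow> ('m \<Rightarrow> complex) set \<Rightarrow> 'b" where
  "lin_ext B h X =
    (let f = (SOME f. f \<in> X) in \<Oplus>\<^bsub>B\<^esub>m\<in>{m. f m \<noteq> 0}. f m \<odot>\<^bsub>B\<^esub> h m)"


section \<open>Algebraic tensor products\<close>

text \<open>The free vector space on \<open>A \<times> B\<close> is the algebra of the product of the multiplicative
  monoids, with \<open>(a, b)(a', b') = (aa', bb')\<close> and \<open>(a, b)\<^sup>* = (a\<^sup>*, b\<^sup>*)\<close>. The linear span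
  of the bilinearity relations is already a two-sided *-ideal of it, so dividing out the
  *-ideal they generate yields the algebraic tensor product.\<close>

type_synonym ('a, 'b) tensor = "('a \<times> 'b \<Rightarrow> complex) set"

definition pair_alg ::
  "('a, 'y) star_alg_scheme \<Rightarrow> ('b, 'z) star_alg_scheme \<Rightarrow> ('a \<times> 'b \<Rightarrow> complex) star_alg" where
  "pair_alg A B = monoid_alg (A \<times>\<times> B) (\<lambda>(a, b). (star A a, star B b))"

definition bilin_rels ::
  "('a, 'y) star_alg_scheme \<Rightarrow> ('b, 'z) star_alg_scheme \<Rightarrow> ('a \<times> 'b \<Rightarrow> complex) set" where
  "bilin_rels A B = (let T = pair_alg A B; e = (\<lambda>a b. basis_vec (a, b)) in
     {e (a \<oplus>\<^bsub>A\<^esub> a') b \<ominus>\<^bsub>T\<^esub> (e a b \<oplus>\<^bsub>T\<^esub> e a' b) | a a' b.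
        a \<in> carrier A \<and> a' \<in> carrier A \<and> b \<in> carrier B} \<union>
     {e a (b \<oplus>\<^bsub>B\<^esub> b') \<ominus>\<^bsub>T\<^esub> (e a b \<oplus>\<^bsub>T\<^esub> e a b') | a b b'.
        a \<in> carrier A \<and> b \<in> carrier B \<and> b' \<in> carrier B} \<union>
     {e (c \<odot>\<^bsub>A\<^esub> a) b \<ominus>\<^bsub>T\<^esub> (c \<odot>\<^bsub>T\<^esub> e a b) | c a b. a \<in> carrier A \<and> b \<in> carrier B} \<union>
     {e a (c \<odot>\<^bsub>B\<^esub> b) \<ominus>\<^bsub>T\<^esub> (c \<odot>\<^bsub>T\<^esub> e a b) | c a b. a \<in> carrier A \<and> b \<in> carrier B})"

definition tensor_ideal ::
  "('a, 'y) star_alg_scheme \<Rightarrow> ('b, 'z) star_alg_scheme \<Rightarrow> ('a \<times> 'b \<Rightarrow> complex) set" where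
  "tensor_ideal A B = star_ideal (pair_alg A B) (bilin_rels A B)"

definition tensor_alg ::
  "('a, 'y) star_alg_scheme \<Rightarrow> ('b, 'z) star_alg_scheme \<Rightarrow> ('a, 'b) tensor star_alg" where
  "tensor_alg A B = star_quot (pair_alg A B) (tensor_ideal A B)"

definition tens ::
  "('a, 'y) star_alg_scheme \<Rightarrow> ('b, 'z) star_alg_scheme \<Rightarrow> 'a \<Rightarrow> 'b \<Rightarrow> ('a, 'b) tensor" where
  "tens A B a b = tensor_ideal A B +>\<^bsub>pair_alg A B\<^esub> basis_vec (a, b)"

text \<open>The linear map on a tensor product with values in \<open>V\<close> induced by a bilinear map.\<close>

definition tensor_lift ::
  "('v, 'z) star_alg_scheme \<Rightarrow> ('a \<Rightarrow> 'b \<Rightarrow> 'v) \<Rightarrow> ('a, 'b) tensor \<Rightarrow> 'v" where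
  "tensor_lift V \<beta> = lin_ext V (\<lambda>(a, b). \<beta> a b)"

text \<open>The map \<open>f \<otimes> g\<close> with values in the tensor product of \<open>C\<close> and \<open>D\<close>.\<close>

definition tensor_map ::
  "('c, 'y) star_alg_scheme \<Rightarrow> ('d, 'z) star_alg_scheme \<Rightarrow> ('a \<Rightarrow> 'c) \<Rightarrow> ('b \<Rightarrow> 'd) \<Rightarrow>
   ('a, 'b) tensor \<Rightarrow> ('c, 'd) tensor" where
  "tensor_map C D f g = tensor_lift (tensor_alg C D) (\<lambda>a b. tens C D (f a) (g b))"

text \<open>The canonical map from \<open>(A \<otimes> B) \<otimes> C\<close> to \<open>A \<otimes> (B \<otimes> C)\<close>.\<close>

definition tensor_assoc ::
  "('a, 'x) star_alg_scheme \<Rightarrow> ('b, 'y) star_alg_scheme \<Rightarrow> ('c, 'z) star_alg_scheme \<Rightarrow>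
   (('a, 'b) tensor, 'c) tensor \<Rightarrow> ('a, ('b, 'c) tensor) tensor" where
  "tensor_assoc A B C =
    (let V = tensor_alg A (tensor_alg B C) in
      tensor_lift V (\<lambda>t c. tensor_lift V (\<lambda>a b. tens A (tensor_alg B C) a (tens B C b c)) t))"


section \<open>Compact quantum groups\<close>

text \<open>A compact quantum group is represented by its algebra of representative functions, a
  CQG algebra: a Hopf *-algebra spanned by the coefficients of its finite-dimensional
  unitary corepresentations. These are exactly the Hopf *-algebras associated with
  Woronowicz's C*-algebraic compact quantum groups.\<close>

definition unitary_corep ::
  "'a star_alg \<Rightarrow> ('a \<Rightarrow> ('a, 'a) tensor) \<Rightarrow> nat \<Rightarrow> (nat \<Rightarrow> nat \<Rightarrow> 'a) \<Rightarrow> bool" where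
  "unitary_corep A \<Delta> n v \<longleftrightarrow>
     (\<forall>i<n. \<forall>j<n. v i j \<in> carrier A \<and>
        \<Delta> (v i j) = (\<Oplus>\<^bsub>tensor_alg A A\<^esub>k\<in>{..<n}. tens A A (v i k) (v k j)) \<and>
        (\<Oplus>\<^bsub>A\<^esub>k\<in>{..<n}. v i k \<otimes>\<^bsub>A\<^esub> star A (v j k)) = (if i = j then \<one>\<^bsub>A\<^esub> else \<zero>\<^bsub>A\<^esub>) \<and>
        (\<Oplus>\<^bsub>A\<^esub>k\<in>{..<n}. star A (v k i) \<otimes>\<^bsub>A\<^esub> v k j) = (if i = j then \<one>\<^bsub>A\<^esub> else \<zero>\<^bsub>A\<^esub>))"

definition hopf_star_algebra :: "'a star_alg \<Rightarrow> ('a \<Rightarrow> ('a, 'a) tensor) \<Rightarrow> bool" where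
  "hopf_star_algebra A \<Delta> \<longleftrightarrow>
     star_algebra A \<and> \<Delta> \<in> star_hom A (tensor_alg A A) \<and>
     (\<forall>x\<in>carrier A.
        tensor_assoc A A A (tensor_map (tensor_alg A A) A \<Delta> id (\<Delta> x)) =
        tensor_map A (tensor_alg A A) id \<Delta> (\<Delta> x)) \<and>
     (\<exists>\<epsilon>\<in>star_hom A complex_alg.
        (\<forall>x\<in>carrier A.
           tensor_lift A (\<lambda>a b. \<epsilon> a \<odot>\<^bsub>A\<^esub> b) (\<Delta> x) = x \<and>
           tensor_lift A (\<lambda>a b. \<epsilon> b \<odot>\<^bsub>A\<^esub> a) (\<Delta> x) = x) \<and>
        (\<exists>\<kappa>\<in>linear_map A A. \<forall>x\<in>carrier A.
           tensor_lift A (\<lambda>a b. \<kappa> a \<otimes>\<^bsub>A\<^esub> b) (\<Delta> x) = \<epsilon> x \<odot>\<^bsub>A\<^esub> \<one>\<^bsub>A\<^esub> \<and>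
           tensor_lift A (\<lambda>a b. a \<otimes>\<^bsub>A\<^esub> \<kappa> b) (\<Delta> x) = \<epsilon> x \<odot>\<^bsub>A\<^esub> \<one>\<^bsub>A\<^esub>))"

definition compact_quantum_group :: "'a star_alg \<Rightarrow> ('a \<Rightarrow> ('a, 'a) tensor) \<Rightarrow> bool" where
  "compact_quantum_group A \<Delta> \<longleftrightarrow> hopf_star_algebra A \<Delta> \<and>
     carrier A = lin_span A {v i j | n v i j. unitary_corep A \<Delta> n v \<and> i < n \<and> j < n}"

definition compact_quantum_subgroup ::
  "'a star_alg \<Rightarrow> ('a \<Rightarrow> ('a, 'a) tensor) \<Rightarrow>
   'k star_alg \<Rightarrow> ('k \<Rightarrow> ('k, 'k) tensor) \<Rightarrow> ('a \<Rightarrow> 'k) \<Rightarrow> bool" where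
  "compact_quantum_subgroup G \<Delta> K \<Delta>K \<theta> \<longleftrightarrow>
     compact_quantum_group K \<Delta>K \<and> \<theta> \<in> star_hom G K \<and> \<theta> ` carrier G = carrier K \<and>
     (\<forall>x\<in>carrier G. tensor_map K K \<theta> \<theta> (\<Delta> x) = \<Delta>K (\<theta> x))"

definition quotient_coideal ::
  "'a star_alg \<Rightarrow> ('a \<Rightarrow> ('a, 'a) tensor) \<Rightarrow> 'k star_alg \<Rightarrow> ('a \<Rightarrow> 'k) \<Rightarrow> 'a set" where
  "quotient_coideal G \<Delta> K \<theta> =
     {x \<in> carrier G. tensor_map K G \<theta> id (\<Delta> x) = tens K G \<one>\<^bsub>K\<^esub> x}"


section \<open>The quantum groups and their spheres\<close>

datatype orthogonal_kind = Free | Half_Liberated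

type_synonym orth_elem = "((nat \<times> nat) list \<Rightarrow> complex) set"

definition orth_free_alg :: "nat \<Rightarrow> ((nat \<times> nat) list \<Rightarrow> complex) star_alg" where
  "orth_free_alg N = free_alg ({1..N} \<times> {1..N})"

definition orthogonality_rels :: "nat \<Rightarrow> ((nat \<times> nat) list \<Rightarrow> complex) set" where
  "orthogonality_rels N = (let F = orth_free_alg N; g = (\<lambda>i j. basis_vec [(i, j)]) in
     {(\<Oplus>\<^bsub>F\<^esub>k\<in>{1..N}. g i k \<otimes>\<^bsub>F\<^esub> g j k) \<ominus>\<^bsub>F\<^esub> (if i = j then \<one>\<^bsub>F\<^esub> else \<zero>\<^bsub>F\<^esub>) | i j.
        i \<in> {1..N} \<and> j \<in> {1..N}} \<union>
     {(\<Oplus>\<^bsub>F\<^esub>k\<in>{1..N}. g k i \<otimes>\<^bsub>F\<^esub> g k j) \<ominus>\<^bsub>F\<^esub> (if i = j then \<one>\<^bsub>F\<^esub> else \<zero>\<^bsub>F\<^esub>) | i j.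
        i \<in> {1..N} \<and> j \<in> {1..N}})"

definition half_commutation_rels :: "nat \<Rightarrow> ((nat \<times> nat) list \<Rightarrow> complex) set" where
  "half_commutation_rels N = (let F = orth_free_alg N; g = (\<lambda>p. basis_vec [p]) in
     {(g a \<otimes>\<^bsub>F\<^esub> g b \<otimes>\<^bsub>F\<^esub> g c) \<ominus>\<^bsub>F\<^esub> (g c \<otimes>\<^bsub>F\<^esub> g b \<otimes>\<^bsub>F\<^esub> g a) | a b c.
        {a, b, c} \<subseteq> {1..N} \<times> {1..N}})"

fun orth_rels :: "orthogonal_kind \<Rightarrow> nat \<Rightarrow> ((nat \<times> nat) list \<Rightarrow> complex) set" where
  "orth_rels Free N = orthogonality_rels N"
| "orth_rels Half_Liberated N = orthogonality_rels N \<union> half_commutation_rels N"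

definition orth_ideal :: "orthogonal_kind \<Rightarrow> nat \<Rightarrow> ((nat \<times> nat) list \<Rightarrow> complex) set" where
  "orth_ideal t N = star_ideal (orth_free_alg N) (orth_rels t N)"

definition orth_alg :: "orthogonal_kind \<Rightarrow> nat \<Rightarrow> orth_elem star_alg" where
  "orth_alg t N = star_quot (orth_free_alg N) (orth_ideal t N)"

definition orth_gen :: "orthogonal_kind \<Rightarrow> nat \<Rightarrow> nat \<Rightarrow> nat \<Rightarrow> orth_elem" where
  "orth_gen t N i j = orth_ideal t N +>\<^bsub>orth_free_alg N\<^esub> basis_vec [(i, j)]"

text \<open>The unique unital *-homomorphism with \<open>\<Delta>(u\<^sub>i\<^sub>j) = \<Sum>\<^sub>k u\<^sub>i\<^sub>k \<otimes> u\<^sub>k\<^sub>j\<close>, written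
  out on words in the generators.\<close>

definition orth_comult :: "orthogonal_kind \<Rightarrow> nat \<Rightarrow> orth_elem \<Rightarrow> (orth_elem, orth_elem) tensor" where
  "orth_comult t N =
    (let G = orth_alg t N; u = orth_gen t N; T = tensor_alg G G;
         d = (\<lambda>(i, j). \<Oplus>\<^bsub>T\<^esub>k\<in>{1..N}. tens G G (u i k) (u k j))
     in lin_ext T (\<lambda>w. foldr (\<lambda>p x. d p \<otimes>\<^bsub>T\<^esub> x) w \<one>\<^bsub>T\<^esub>))"

definition sphere_set :: "orthogonal_kind \<Rightarrow> nat \<Rightarrow> orth_elem set" where
  "sphere_set t N = star_generated (orth_alg t N) {orth_gen t N 1 i | i. i \<in> {1..N}}"

definition sphere_alg :: "orthogonal_kind \<Rightarrow> nat \<Rightarrow> orth_elem star_alg" where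
  "sphere_alg t N = (orth_alg t N)\<lparr>carrier := sphere_set t N\<rparr>"

text \<open>The restriction of the comultiplication to the sphere, corestricted along the canonical
  injection of \<open>\<O>(S) \<otimes> \<O>(G)\<close> into \<open>\<O>(G) \<otimes> \<O>(G)\<close>.\<close>

definition sphere_coaction ::
  "orthogonal_kind \<Rightarrow> nat \<Rightarrow> orth_elem \<Rightarrow> (orth_elem, orth_elem) tensor" where
  "sphere_coaction t N x =
    (let G = orth_alg t N in
      inv_into (carrier (tensor_alg (sphere_alg t N) G)) (tensor_map G G id id) (orth_comult t N x))"

text \<open>A unital *-isomorphism \<open>\<phi>\<close> from \<open>\<O>(S)\<close> onto the *-subalgebra \<open>Q\<close> of \<open>\<O>(G)\<close> that
  intertwines the coaction on the sphere with the comultiplication. The identity of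
  \<open>\<Delta> \<circ> \<phi>\<close> and \<open>(\<phi> \<otimes> id) \<circ> \<alpha>\<close> is stated in \<open>\<O>(G) \<otimes> \<O>(G)\<close>, which contains
  \<open>Q \<otimes> \<O>(G)\<close>.\<close>

definition sphere_coidalgebra_iso ::
  "orthogonal_kind \<Rightarrow> nat \<Rightarrow> orth_elem set \<Rightarrow> (orth_elem \<Rightarrow> orth_elem) \<Rightarrow> bool" where
  "sphere_coidalgebra_iso t N Q \<phi> \<longleftrightarrow>
     (let G = orth_alg t N; S = sphere_alg t N in
       \<phi> \<in> star_hom S (G\<lparr>carrier := Q\<rparr>) \<and> bij_betw \<phi> (carrier S) Q \<and>
       (\<forall>x\<in>carrier S. orth_comult t N (\<phi> x) = tensor_map G G \<phi> id (sphere_coaction t N x)))"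

end

theory Submission
  imports Defs
begin

text \<open>Suppose that \<open>\<phi>\<close> identifies the sphere with the quotient \<open>Q\<close> of \<open>G\<close> by \<open>K\<close>, and put
  \<open>x\<^sub>i = u\<^sub>1\<^sub>i\<close> and \<open>y\<^sub>i = \<phi>(x\<^sub>i)\<close>.

  The character \<open>\<epsilon> \<circ> \<phi>\<close> of the sphere takes values \<open>c\<^sub>i\<close> on the \<open>x\<^sub>i\<close> that form a real unit vector.
  Choosing a real orthogonal matrix with first row \<open>c\<close>, it extends to a character \<open>\<chi>\<close> of \<open>\<O>(G)\<close>, and
  evaluating the first leg of \<open>\<Delta>(y\<^sub>i) = (\<phi> \<otimes> id) \<alpha>(x\<^sub>i)\<close> with \<open>\<epsilon>\<close> yields
  \<open>y\<^sub>i = (\<chi> \<otimes> id) \<Delta>(x\<^sub>i) = \<Sum>\<^sub>k c\<^sub>k u\<^sub>k\<^sub>i\<close> (\<open>reflection_character\<close>, \<open>coidalgebra_iso_gen\<close>).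

  On the other hand \<open>Q\<close> is large: the columns of \<open>\<theta>(u)\<close> are orthonormal, so with \<open>y\<close> it also
  contains \<open>\<Sum>\<^sub>k u\<^sub>k\<^sub>i y u\<^sub>k\<^sub>i\<close> (\<open>quotient_coideal_sandwich\<close>). For \<open>y = y\<^sub>a\<close> call this element \<open>E\<close>; being in
  \<open>Q = \<phi>(\<O>(S))\<close>, it would have to lie in the *-algebra generated by the \<open>y\<^sub>j\<close>.

  It does not. For a complex number \<open>z\<close> of modulus 1, the unitary matrix \<open>v = z 1 + (1 - z) c c\<^sup>t\<close>
  fixes \<open>c\<close>, and sending \<open>u\<^sub>i\<^sub>j\<close> to the antidiagonal two-by-two matrix with entries \<open>v\<^sub>i\<^sub>j\<close> and its
  conjugate defines a *-representation of \<open>\<O>(G)\<close>, in the half-liberated case too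
  (\<open>twisted_rotation_rep\<close>). It sends \<open>y\<^sub>j\<close> to the antidiagonal matrix with entries \<open>c\<^sub>j\<close>, which does
  not depend on \<open>z\<close>, but the upper entry of the image of \<open>E\<close> is
  \<open>c\<^sub>a \<Sum>\<^sub>k v\<^sub>k\<^sub>i\<^sup>2 = c\<^sub>a (z\<^sup>2 + c\<^sub>i\<^sup>2 (1 - z\<^sup>2))\<close>. For \<open>z = 1\<close> and \<open>z = \<i>\<close> these values differ when \<open>c\<^sub>a \<noteq> 0\<close>
  and \<open>c\<^sub>i\<^sup>2 \<noteq> 1\<close>, and indices of both kinds exist because \<open>N \<ge> 2\<close>.

  The rest of the theory provides homomorphisms. The algebras \<open>\<O>(G)\<close> and the tensor products are
  quotients of monoid algebras, and the maps out of them are linear extensions of multiplicative maps on the monoid, so they are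
  well defined and multiplicative by one universal property (\<open>lin_ext_star_quot\<close>); two of them are
  equal if they agree on generators.\<close>

section \<open>Homomorphisms and subalgebras of *-algebras\<close>

lemma ring_cong_ops:
  assumes "ring R" "carrier S = carrier R" "mult S = mult R" "one S = one R"
    "zero S = zero R" "add S = add R"
  shows "ring S"
proof -
  interpret ring R by fact
  show ?thesis
  proof (rule ringI)
    show "abelian_group S"
      by (rule abelian_groupI) (use assms l_neg in \<open>auto simp: a_ac intro: a_inv_closed\<close>)
    show "Group.monoid S"
      by (rule monoidI) (use assms in \<open>auto simp: m_assoc\<close>)
  qed (use assms in \<open>auto simp: l_distr r_distr\<close>)
qed

context star_algebra
begin

lemma smult_zero_l: "x \<in> carrier A \<Longrightarrow> 0 \<odot> x = \<zero>"
proof -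
  assume x: "x \<in> carrier A"
  have "0 \<odot> x \<oplus> 0 \<odot> x = 0 \<odot> x"
    using smult_l_distr[OF x, of 0 0] by simp
  then show ?thesis using smult_closed[OF x] by (metis add.l_cancel_one')
qed

lemma smult_zero_r: "c \<odot> \<zero> = \<zero>"
  using smult_assoc[OF zero_closed, of c 0] smult_zero_l[OF zero_closed] by simp

lemma smult_minus_one: "x \<in> carrier A \<Longrightarrow> (-1) \<odot> x = \<ominus> x"
proof -
  assume x: "x \<in> carrier A"
  have "(-1) \<odot> x \<oplus> x = \<zero>"
    using smult_l_distr[OF x, of "-1" 1] smult_one[OF x] smult_zero_l[OF x] by simp
  then show ?thesis using x smult_closed[OF x] by (metis minus_equality)
qed

lemma star_zero: "star A \<zero> = \<zero>"
  using star_smult[OF zero_closed, of 0] smult_zero_l star_closed by auto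

lemma star_one: "star A \<one> = \<one>"
proof -
  have "star A \<one> = star A (star A \<one> \<otimes> \<one>)"
    using star_mult[of "star A \<one>" \<one>] star_star star_closed by auto
  then show ?thesis using star_star star_closed by simp
qed

lemma smult_finsum:
  "f \<in> I \<rightarrow> carrier A \<Longrightarrow> c \<odot> (\<Oplus>i\<in>I. f i) = (\<Oplus>i\<in>I. c \<odot> f i)"
proof (induction I rule: infinite_finite_induct)
  case (insert i I)
  moreover have "(\<lambda>i. c \<odot> f i) \<in> I \<rightarrow> carrier A" using insert.prems smult_closed by auto
  ultimately show ?case using smult_closed[of "f i" c]
    by (simp add: smult_r_distr Pi_iff)
qed (auto simp: smult_zero_r finsum_infinite)

lemma ideal_smult_closed:
  assumes "ideal I A" "x \<in> I"
  shows "c \<odot> x \<in> I"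
proof -
  interpret ideal I A by fact
  have "c \<odot> x = (c \<odot> \<one>) \<otimes> x" using assms(2) by (simp add: smult_mult_l)
  then show ?thesis using I_l_closed assms(2) smult_closed by simp
qed

lemma star_subalgebra_star_algebra:
  assumes "star_subalgebra A S"
  shows "star_algebra (A\<lparr>carrier := S\<rparr>)"
proof -
  note S = assms[unfolded star_subalgebra_def]
  have neg: "\<ominus> x \<in> S" if "x \<in> S" for x
    using S that smult_minus_one[of x] by (metis subsetD)
  have "\<zero> \<in> S" using S smult_zero_l[OF one_closed] by metis
  have "ring (A\<lparr>carrier := S\<rparr>)"
  proof (rule ringI)
    show "abelian_group (A\<lparr>carrier := S\<rparr>)"
    proof (rule abelian_groupI)
      fix x assume "x \<in> carrier (A\<lparr>carrier := S\<rparr>)"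
      then show "\<exists>y\<in>carrier (A\<lparr>carrier := S\<rparr>). y \<oplus>\<^bsub>A\<lparr>carrier := S\<rparr>\<^esub> x = \<zero>\<^bsub>A\<lparr>carrier := S\<rparr>\<^esub>"
        using neg S l_neg by auto
    qed (use S \<open>\<zero> \<in> S\<close> in \<open>auto simp: a_ac subset_iff\<close>)
    show "Group.monoid (A\<lparr>carrier := S\<rparr>)"
      by (rule monoidI) (use S in \<open>auto simp: m_assoc subset_iff\<close>)
  qed (use S in \<open>auto simp: l_distr r_distr subset_iff\<close>)
  then show ?thesis
    by (rule star_algebra.intro, unfold_locales)
      (use S in \<open>auto simp: subset_iff smult_l_distr smult_r_distr smult_assoc smult_one
         smult_mult_l smult_mult_r star_star star_add star_smult star_mult\<close>)
qed

lemma star_generated_star_subalgebra: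
  assumes "X \<subseteq> carrier A"
  shows "star_subalgebra A (star_generated A X)"
proof -
  have "star_subalgebra A (carrier A)"
    by (auto simp: star_subalgebra_def smult_closed star_closed)
  then have *: "star_generated A X \<subseteq> carrier A" using assms by (auto simp: star_generated_def)
  then show ?thesis
    unfolding star_subalgebra_def
    by (intro conjI) (auto simp: star_generated_def star_subalgebra_def)
qed

lemma star_generated_incl: "X \<subseteq> star_generated A X"
  by (auto simp: star_generated_def)

end

lemma star_homD:
  assumes "f \<in> star_hom A B"
  shows "x \<in> carrier A \<Longrightarrow> f x \<in> carrier B"
    "x \<in> carrier A \<Longrightarrow> y \<in> carrier A \<Longrightarrow> f (x \<oplus>\<^bsub>A\<^esub> y) = f x \<oplus>\<^bsub>B\<^esub> f y"
    "x \<in> carrier A \<Longrightarrow> y \<in> carrier A \<Longrightarrow> f (x \<otimes>\<^bsub>A\<^esub> y) = f x \<otimes>\<^bsub>B\<^esub> f y"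
    "f \<one>\<^bsub>A\<^esub> = \<one>\<^bsub>B\<^esub>"
    "x \<in> carrier A \<Longrightarrow> f (c \<odot>\<^bsub>A\<^esub> x) = c \<odot>\<^bsub>B\<^esub> f x"
    "x \<in> carrier A \<Longrightarrow> f (star A x) = star B (f x)"
  using assms unfolding star_hom_def ring_hom_def by auto

lemma star_homI:
  assumes "\<And>x. x \<in> carrier A \<Longrightarrow> f x \<in> carrier B"
    "\<And>x y. x \<in> carrier A \<Longrightarrow> y \<in> carrier A \<Longrightarrow> f (x \<oplus>\<^bsub>A\<^esub> y) = f x \<oplus>\<^bsub>B\<^esub> f y"
    "\<And>x y. x \<in> carrier A \<Longrightarrow> y \<in> carrier A \<Longrightarrow> f (x \<otimes>\<^bsub>A\<^esub> y) = f x \<otimes>\<^bsub>B\<^esub> f y"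
    "f \<one>\<^bsub>A\<^esub> = \<one>\<^bsub>B\<^esub>"
    "\<And>c x. x \<in> carrier A \<Longrightarrow> f (c \<odot>\<^bsub>A\<^esub> x) = c \<odot>\<^bsub>B\<^esub> f x"
    "\<And>x. x \<in> carrier A \<Longrightarrow> f (star A x) = star B (f x)"
  shows "f \<in> star_hom A B"
  using assms unfolding star_hom_def ring_hom_def by auto

lemma star_hom_comp:
  "f \<in> star_hom A B \<Longrightarrow> g \<in> star_hom B C \<Longrightarrow> (\<lambda>x. g (f x)) \<in> star_hom A C"
  by (rule star_homI) (simp_all add: star_homD)

lemma star_hom_id: "id \<in> star_hom A A"
  by (rule star_homI) auto

lemma star_hom_zero:
  assumes "star_algebra A" "star_algebra B" "f \<in> star_hom A B"
  shows "f \<zero>\<^bsub>A\<^esub> = \<zero>\<^bsub>B\<^esub>"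
proof -
  interpret A: star_algebra A by fact
  interpret B: star_algebra B by fact
  have "f (0 \<odot>\<^bsub>A\<^esub> \<one>\<^bsub>A\<^esub>) = 0 \<odot>\<^bsub>B\<^esub> \<one>\<^bsub>B\<^esub>"
    using star_homD[OF assms(3)] A.one_closed by simp
  then show ?thesis by (simp add: A.smult_zero_l B.smult_zero_l)
qed

lemma star_hom_minus:
  assumes "star_algebra A" "star_algebra B" "f \<in> star_hom A B" "x \<in> carrier A" "y \<in> carrier A"
  shows "f (x \<ominus>\<^bsub>A\<^esub> y) = f x \<ominus>\<^bsub>B\<^esub> f y"
proof -
  interpret A: star_algebra A by fact
  interpret B: star_algebra B by fact
  note f = star_homD[OF assms(3)]
  have "f (x \<oplus>\<^bsub>A\<^esub> ((-1) \<odot>\<^bsub>A\<^esub> y)) = f x \<oplus>\<^bsub>B\<^esub> ((-1) \<odot>\<^bsub>B\<^esub> f y)"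
    using f assms A.smult_closed by simp
  then show ?thesis
    using assms(4,5) f by (simp add: A.smult_minus_one B.smult_minus_one a_minus_def)
qed

lemma star_hom_finsum:
  assumes "star_algebra A" "star_algebra B" "f \<in> star_hom A B"
  shows "g \<in> I \<rightarrow> carrier A \<Longrightarrow> f (\<Oplus>\<^bsub>A\<^esub>i\<in>I. g i) = (\<Oplus>\<^bsub>B\<^esub>i\<in>I. f (g i))"
proof -
  interpret A: star_algebra A by fact
  interpret B: star_algebra B by fact
  note f = star_homD[OF assms(3)]
  show "g \<in> I \<rightarrow> carrier A \<Longrightarrow> ?thesis"
  proof (induction I rule: infinite_finite_induct)
    case (insert i I)
    then have *: "g j \<in> carrier A" if "j \<in> insert i I" for j using that by blast
    then have "(\<lambda>i. f (g i)) \<in> I \<rightarrow> carrier B" "g \<in> I \<rightarrow> carrier A" "g i \<in> carrier A"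
      using f(1) by blast+
    with insert show ?case using f(1,2) by (simp add: A.finsum_closed)
  qed (auto simp: star_hom_zero[OF assms] A.finsum_infinite B.finsum_infinite)
qed

text \<open>The equaliser of two homomorphisms is a *-subalgebra, so it is everything as soon as it
  contains the generators. This replaces any description of the elements of the sphere by words.\<close>

lemma star_hom_eq_on_star_generated:
  assumes "star_algebra A" "X \<subseteq> carrier A"
    and f: "f \<in> star_hom (A\<lparr>carrier := star_generated A X\<rparr>) B"
    and g: "g \<in> star_hom (A\<lparr>carrier := star_generated A X\<rparr>) B"
    and eq: "\<And>x. x \<in> X \<Longrightarrow> f x = g x"
    and x: "x \<in> star_generated A X"
  shows "f x = g x"
proof -
  interpret A: star_algebra A by fact
  let ?S = "star_generated A X"
  have S: "star_subalgebra A ?S" by (rule A.star_generated_star_subalgebra) fact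
  note f = star_homD[OF f, simplified] and g = star_homD[OF g, simplified]
  have "star_subalgebra A {x \<in> ?S. f x = g x}"
    using S f g unfolding star_subalgebra_def by auto
  moreover have "X \<subseteq> {x \<in> ?S. f x = g x}"
    using eq A.star_generated_incl by auto
  ultimately have "?S \<subseteq> {x \<in> ?S. f x = g x}"
    unfolding star_generated_def by blast
  with x show ?thesis by blast
qed

section \<open>The algebra of a monoid with involution\<close>

locale involutive_monoid = Group.monoid M for M :: "('m, 'z) monoid_scheme" (structure) +
  fixes \<sigma> :: "'m \<Rightarrow> 'm"
  assumes inv_closed: "x \<in> carrier M \<Longrightarrow> \<sigma> x \<in> carrier M"
    and inv_inv: "x \<in> carrier M \<Longrightarrow> \<sigma> (\<sigma> x) = x"
    and inv_mult: "x \<in> carrier M \<Longrightarrow> y \<in> carrier M \<Longrightarrow> \<sigma> (x \<otimes> y) = \<sigma> y \<otimes> \<sigma> x"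
begin

abbreviation "MA \<equiv> monoid_alg M \<sigma>"

lemma MA_carrier: "f \<in> carrier MA \<longleftrightarrow> finite {m. f m \<noteq> 0} \<and> {m. f m \<noteq> 0} \<subseteq> carrier M"
  by (simp add: monoid_alg_def)

lemma MA_simps:
  "\<one>\<^bsub>MA\<^esub> = basis_vec \<one>" "\<zero>\<^bsub>MA\<^esub> = (\<lambda>m. 0)"
  "f \<oplus>\<^bsub>MA\<^esub> g = (\<lambda>m. f m + g m)" "c \<odot>\<^bsub>MA\<^esub> f = (\<lambda>m. c * f m)"
  by (simp_all add: monoid_alg_def basis_vec_def)

lemma MA_star: "star MA f = (\<lambda>m. if m \<in> carrier M then cnj (f (\<sigma> m)) else 0)"
  by (simp add: monoid_alg_def)

lemma supp_basis_vec: "{m. basis_vec p m \<noteq> (0::complex)} = {p}"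
  by (auto simp: basis_vec_def)

lemma MA_mult_superset:
  assumes "finite P" "finite Q" "{p. f p \<noteq> 0} \<subseteq> P" "{q. g q \<noteq> 0} \<subseteq> Q"
  shows "(f \<otimes>\<^bsub>MA\<^esub> g) m = (\<Sum>p\<in>P. \<Sum>q\<in>Q. if p \<otimes> q = m then f p * g q else 0)"
proof -
  have "(\<Sum>q\<in>{q. g q \<noteq> 0}. if p \<otimes> q = m then f p * g q else 0) =
      (\<Sum>q\<in>Q. if p \<otimes> q = m then f p * g q else 0)" for p
    by (rule sum.mono_neutral_left) (use assms in auto)
  then have "(f \<otimes>\<^bsub>MA\<^esub> g) m = (\<Sum>p\<in>{p. f p \<noteq> 0}. \<Sum>q\<in>Q. if p \<otimes> q = m then f p * g q else 0)"
    by (simp add: monoid_alg_def)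
  also have "\<dots> = (\<Sum>p\<in>P. \<Sum>q\<in>Q. if p \<otimes> q = m then f p * g q else 0)"
    by (rule sum.mono_neutral_left) (use assms in \<open>auto intro!: sum.neutral split: if_splits\<close>)
  finally show ?thesis .
qed

lemma MA_add_closed: "f \<in> carrier MA \<Longrightarrow> g \<in> carrier MA \<Longrightarrow> f \<oplus>\<^bsub>MA\<^esub> g \<in> carrier MA"
  unfolding MA_carrier MA_simps subset_iff
  by (auto intro: finite_subset[of _ "{m. f m \<noteq> 0} \<union> {m. g m \<noteq> 0}"]) (metis add_0)

lemma MA_smult_closed: "f \<in> carrier MA \<Longrightarrow> c \<odot>\<^bsub>MA\<^esub> f \<in> carrier MA"
  unfolding MA_carrier MA_simps by (auto intro: finite_subset[of _ "{m. f m \<noteq> 0}"])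

lemma MA_basis_closed: "p \<in> carrier M \<Longrightarrow> basis_vec p \<in> carrier MA"
  unfolding MA_carrier supp_basis_vec by simp

lemma MA_mult_closed:
  assumes "f \<in> carrier MA" "g \<in> carrier MA"
  shows "f \<otimes>\<^bsub>MA\<^esub> g \<in> carrier MA"
proof -
  let ?P = "(\<lambda>(p, q). p \<otimes> q) ` ({p. f p \<noteq> 0} \<times> {q. g q \<noteq> 0})"
  have "(f \<otimes>\<^bsub>MA\<^esub> g) m = 0" if "m \<notin> ?P" for m
  proof -
    have "p \<otimes> q \<noteq> m" if "f p \<noteq> 0" "g q \<noteq> 0" for p q using that \<open>m \<notin> ?P\<close> by blast
    then show ?thesis by (simp add: monoid_alg_def sum.neutral)
  qed
  then have "{m. (f \<otimes>\<^bsub>MA\<^esub> g) m \<noteq> 0} \<subseteq> ?P" by blast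
  moreover have "finite ?P" "?P \<subseteq> carrier M" using assms unfolding MA_carrier by auto
  ultimately show ?thesis unfolding MA_carrier by (meson finite_subset subset_trans)
qed

lemma MA_star_closed:
  assumes "f \<in> carrier MA" shows "star MA f \<in> carrier MA"
proof -
  have "{m. star MA f m \<noteq> 0} \<subseteq> \<sigma> ` {m. f m \<noteq> 0}"
    by (auto simp: MA_star image_iff split: if_splits) (metis inv_inv)
  with assms show ?thesis
    unfolding MA_carrier by (auto simp: MA_star intro: finite_subset split: if_splits)
qed

lemma MA_l_distr:
  assumes "f \<in> carrier MA" "g \<in> carrier MA" "h \<in> carrier MA"
  shows "(f \<oplus>\<^bsub>MA\<^esub> g) \<otimes>\<^bsub>MA\<^esub> h = f \<otimes>\<^bsub>MA\<^esub> h \<oplus>\<^bsub>MA\<^esub> g \<otimes>\<^bsub>MA\<^esub> h"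
proof
  fix m
  let ?P = "{p. f p \<noteq> 0} \<union> {p. g p \<noteq> 0}" and ?Q = "{q. h q \<noteq> 0}"
  have fin: "finite ?P" "finite ?Q" using assms by (auto simp: MA_carrier)
  have "((f \<oplus>\<^bsub>MA\<^esub> g) \<otimes>\<^bsub>MA\<^esub> h) m =
      (\<Sum>p\<in>?P. \<Sum>q\<in>?Q. if p \<otimes> q = m then (f \<oplus>\<^bsub>MA\<^esub> g) p * h q else 0)"
    by (rule MA_mult_superset) (use fin in \<open>auto simp: MA_simps\<close>)
  also have "\<dots> = (\<Sum>p\<in>?P. \<Sum>q\<in>?Q. if p \<otimes> q = m then f p * h q else 0) +
      (\<Sum>p\<in>?P. \<Sum>q\<in>?Q. if p \<otimes> q = m then g p * h q else 0)"
    unfolding sum.distrib[symmetric] by (intro sum.cong refl) (auto simp: MA_simps algebra_simps)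
  also have "\<dots> = (f \<otimes>\<^bsub>MA\<^esub> h) m + (g \<otimes>\<^bsub>MA\<^esub> h) m"
    using MA_mult_superset[of ?P ?Q f h m] MA_mult_superset[of ?P ?Q g h m] fin by auto
  finally show "((f \<oplus>\<^bsub>MA\<^esub> g) \<otimes>\<^bsub>MA\<^esub> h) m = (f \<otimes>\<^bsub>MA\<^esub> h \<oplus>\<^bsub>MA\<^esub> g \<otimes>\<^bsub>MA\<^esub> h) m"
    by (simp add: MA_simps)
qed

lemma MA_r_distr:
  assumes "f \<in> carrier MA" "g \<in> carrier MA" "h \<in> carrier MA"
  shows "h \<otimes>\<^bsub>MA\<^esub> (f \<oplus>\<^bsub>MA\<^esub> g) = h \<otimes>\<^bsub>MA\<^esub> f \<oplus>\<^bsub>MA\<^esub> h \<otimes>\<^bsub>MA\<^esub> g"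
proof
  fix m
  let ?Q = "{p. f p \<noteq> 0} \<union> {p. g p \<noteq> 0}" and ?P = "{q. h q \<noteq> 0}"
  have fin: "finite ?P" "finite ?Q" using assms by (auto simp: MA_carrier)
  have "(h \<otimes>\<^bsub>MA\<^esub> (f \<oplus>\<^bsub>MA\<^esub> g)) m =
      (\<Sum>p\<in>?P. \<Sum>q\<in>?Q. if p \<otimes> q = m then h p * (f \<oplus>\<^bsub>MA\<^esub> g) q else 0)"
    by (rule MA_mult_superset) (use fin in \<open>auto simp: MA_simps\<close>)
  also have "\<dots> = (\<Sum>p\<in>?P. \<Sum>q\<in>?Q. if p \<otimes> q = m then h p * f q else 0) +
      (\<Sum>p\<in>?P. \<Sum>q\<in>?Q. if p \<otimes> q = m then h p * g q else 0)"
    unfolding sum.distrib[symmetric] by (intro sum.cong refl) (auto simp: MA_simps algebra_simps)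
  also have "\<dots> = (h \<otimes>\<^bsub>MA\<^esub> f) m + (h \<otimes>\<^bsub>MA\<^esub> g) m"
    using MA_mult_superset[of ?P ?Q h f m] MA_mult_superset[of ?P ?Q h g m] fin by auto
  finally show "(h \<otimes>\<^bsub>MA\<^esub> (f \<oplus>\<^bsub>MA\<^esub> g)) m = (h \<otimes>\<^bsub>MA\<^esub> f \<oplus>\<^bsub>MA\<^esub> h \<otimes>\<^bsub>MA\<^esub> g) m"
    by (simp add: MA_simps)
qed

lemma MA_smult_mult:
  assumes "f \<in> carrier MA" "g \<in> carrier MA"
  shows "(c \<odot>\<^bsub>MA\<^esub> f) \<otimes>\<^bsub>MA\<^esub> g = c \<odot>\<^bsub>MA\<^esub> (f \<otimes>\<^bsub>MA\<^esub> g)"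
    "f \<otimes>\<^bsub>MA\<^esub> (c \<odot>\<^bsub>MA\<^esub> g) = c \<odot>\<^bsub>MA\<^esub> (f \<otimes>\<^bsub>MA\<^esub> g)"
proof -
  have fin: "finite {p. f p \<noteq> 0}" "finite {q. g q \<noteq> 0}" using assms by (auto simp: MA_carrier)
  note * = MA_mult_superset[OF fin]
  have "((\<lambda>m. c * f m) \<otimes>\<^bsub>MA\<^esub> g) m = c * (f \<otimes>\<^bsub>MA\<^esub> g) m"
    "(f \<otimes>\<^bsub>MA\<^esub> (\<lambda>m. c * g m)) m = c * (f \<otimes>\<^bsub>MA\<^esub> g) m" for m
    by (subst *, force, force, subst *, force, force,
        force simp: sum_distrib_left mult_ac intro!: sum.cong)+
  then show "(c \<odot>\<^bsub>MA\<^esub> f) \<otimes>\<^bsub>MA\<^esub> g = c \<odot>\<^bsub>MA\<^esub> (f \<otimes>\<^bsub>MA\<^esub> g)"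
    "f \<otimes>\<^bsub>MA\<^esub> (c \<odot>\<^bsub>MA\<^esub> g) = c \<odot>\<^bsub>MA\<^esub> (f \<otimes>\<^bsub>MA\<^esub> g)" by (auto simp: MA_simps)
qed

lemma MA_mult_basis: "basis_vec p \<otimes>\<^bsub>MA\<^esub> basis_vec q = basis_vec (p \<otimes> q)"
  by (rule ext) (simp add: MA_mult_superset[where P = "{p}" and Q = "{q}"] supp_basis_vec,
      simp add: basis_vec_def)

lemma MA_star_basis: "p \<in> carrier M \<Longrightarrow> star MA (basis_vec p) = basis_vec (\<sigma> p)"
  by (rule ext) (auto simp: MA_star basis_vec_def inv_inv inv_closed)

text \<open>All multilinear identities in a monoid algebra (associativity, multiplicativity of linear
  extensions, compatibility with the adjoint) are reduced by this rule to basis vectors, where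
  they are identities in the monoid.\<close>

lemma MA_induct [consumes 1, case_names basis add]:
  assumes f: "f \<in> carrier MA"
    and basis: "\<And>c m. m \<in> carrier M \<Longrightarrow> P (c \<odot>\<^bsub>MA\<^esub> basis_vec m)"
    and add: "\<And>f g. f \<in> carrier MA \<Longrightarrow> g \<in> carrier MA \<Longrightarrow> P f \<Longrightarrow> P g \<Longrightarrow> P (f \<oplus>\<^bsub>MA\<^esub> g)"
  shows "P f"
proof -
  have "P f" if "finite S" "S \<subseteq> carrier M" "{m. f m \<noteq> 0} \<subseteq> S" for S f
    using that
  proof (induction S arbitrary: f)
    case empty
    then have "f = 0 \<odot>\<^bsub>MA\<^esub> basis_vec \<one>" by (auto simp: MA_simps)
    then show ?case using basis[OF one_closed] by metis
  next
    case (insert s S)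
    let ?g = "f(s := 0)"
    have g: "{m. ?g m \<noteq> 0} \<subseteq> S" using insert.prems by auto
    have "P (f s \<odot>\<^bsub>MA\<^esub> basis_vec s \<oplus>\<^bsub>MA\<^esub> ?g)"
    proof (rule add)
      show "f s \<odot>\<^bsub>MA\<^esub> basis_vec s \<in> carrier MA"
        using insert.prems by (auto intro!: MA_smult_closed MA_basis_closed)
      show "?g \<in> carrier MA"
        using g insert unfolding MA_carrier by (meson finite_subset insert_subset subset_trans)
      show "P ?g" by (rule insert.IH) (use g insert.prems in auto)
    qed (use basis insert.prems in auto)
    moreover have "f s \<odot>\<^bsub>MA\<^esub> basis_vec s \<oplus>\<^bsub>MA\<^esub> ?g = f"
      by (rule ext) (auto simp: MA_simps basis_vec_def)
    ultimately show ?case by simp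
  qed
  then show ?thesis using f unfolding MA_carrier by blast
qed

lemma MA_assoc:
  assumes f: "f \<in> carrier MA" and g: "g \<in> carrier MA" and h: "h \<in> carrier MA"
  shows "(f \<otimes>\<^bsub>MA\<^esub> g) \<otimes>\<^bsub>MA\<^esub> h = f \<otimes>\<^bsub>MA\<^esub> (g \<otimes>\<^bsub>MA\<^esub> h)"
  using f
proof (induction f rule: MA_induct)
  case (basis c m)
  note m = basis
  show ?case using g
  proof (induction g rule: MA_induct)
    case (basis d n)
    note n = basis
    show ?case using h
      by (induction h rule: MA_induct)
        (use m n in \<open>auto simp: MA_smult_mult MA_smult_closed MA_basis_closed MA_mult_basis m_assoc
            MA_r_distr MA_mult_closed MA_add_closed\<close>)
  qed (use m h in \<open>simp add: MA_r_distr MA_l_distr MA_smult_closed MA_basis_closed MA_mult_closed\<close>)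
qed (use g h in \<open>simp add: MA_l_distr MA_mult_closed\<close>)

lemma MA_star_add: "star MA (f \<oplus>\<^bsub>MA\<^esub> g) = star MA f \<oplus>\<^bsub>MA\<^esub> star MA g"
  by (rule ext) (simp add: MA_star MA_simps)

lemma MA_star_smult: "star MA (c \<odot>\<^bsub>MA\<^esub> f) = cnj c \<odot>\<^bsub>MA\<^esub> star MA f"
  by (rule ext) (simp add: MA_star MA_simps)

lemma MA_star_mult:
  assumes f: "f \<in> carrier MA" and g: "g \<in> carrier MA"
  shows "star MA (f \<otimes>\<^bsub>MA\<^esub> g) = star MA g \<otimes>\<^bsub>MA\<^esub> star MA f"
  using f
proof (induction f rule: MA_induct)
  case (basis c m)
  note m = basis
  show ?case using g
    by (induction g rule: MA_induct)
      (use m in \<open>auto simp: MA_smult_mult MA_smult_closed MA_basis_closed MA_mult_basis MA_star_smult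
          MA_star_basis inv_closed inv_mult MA_r_distr MA_l_distr MA_star_add MA_star_closed\<close>,
       simp add: MA_simps mult.left_commute)
qed (use g in \<open>simp add: MA_l_distr MA_r_distr MA_star_add MA_star_closed\<close>)

lemma star_algebra_MA: "star_algebra MA"
proof -
  have one: "\<one>\<^bsub>MA\<^esub> \<in> carrier MA" by (simp add: MA_simps MA_basis_closed)
  have zero: "\<zero>\<^bsub>MA\<^esub> \<in> carrier MA" by (simp add: MA_simps MA_carrier)
  have "\<one>\<^bsub>MA\<^esub> \<otimes>\<^bsub>MA\<^esub> f = f" "f \<otimes>\<^bsub>MA\<^esub> \<one>\<^bsub>MA\<^esub> = f" if "f \<in> carrier MA" for f
    unfolding MA_simps(1) using that
    by (induction f rule: MA_induct)
      (auto simp: MA_smult_mult MA_basis_closed MA_mult_basis MA_r_distr MA_l_distr)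
  then have "Group.monoid MA"
    by (intro monoidI) (auto simp: MA_mult_closed MA_assoc one)
  moreover have "abelian_group MA"
  proof (rule abelian_groupI)
    fix f assume "f \<in> carrier MA"
    then show "\<exists>g\<in>carrier MA. g \<oplus>\<^bsub>MA\<^esub> f = \<zero>\<^bsub>MA\<^esub>"
      by (intro bexI[of _ "(-1) \<odot>\<^bsub>MA\<^esub> f"]) (simp add: MA_simps, simp add: MA_smult_closed)
  next
    show "\<zero>\<^bsub>MA\<^esub> \<in> carrier MA" by (rule zero)
  qed (simp_all add: MA_add_closed, simp_all add: MA_simps add_ac)
  ultimately have "ring MA" by (intro ringI) (simp_all add: MA_l_distr MA_r_distr)
  then show ?thesis
  proof (rule star_algebra.intro, unfold_locales)
    fix f assume "f \<in> carrier MA"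
    then show "star MA (star MA f) = f"
      by (intro ext) (auto simp: MA_star MA_carrier inv_inv inv_closed)
  qed (simp_all add: MA_smult_closed MA_smult_mult MA_star_closed MA_star_add MA_star_smult
      MA_star_mult, simp_all add: MA_simps algebra_simps)
qed

end

definition lin_sum :: "('b, 'z) star_alg_scheme \<Rightarrow> ('m \<Rightarrow> 'b) \<Rightarrow> ('m \<Rightarrow> complex) \<Rightarrow> 'b" where
  "lin_sum B h f = (\<Oplus>\<^bsub>B\<^esub>m\<in>{m. f m \<noteq> 0}. f m \<odot>\<^bsub>B\<^esub> h m)"

text \<open>A unital multiplicative *-map \<open>h\<close> from the monoid to a *-algebra extends linearly to a
  *-homomorphism of the monoid algebra. Both the maps out of \<open>\<O>(G)\<close> and the maps out of a tensor
  product that occur below are of this kind, so one construction serves both.\<close>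

locale monoid_rep = involutive_monoid M \<sigma> + B: star_algebra B
  for M :: "('m, 'y) monoid_scheme" (structure) and \<sigma> :: "'m \<Rightarrow> 'm"
    and B :: "('b, 'z) star_alg_scheme" +
  fixes h :: "'m \<Rightarrow> 'b"
  assumes h_closed: "m \<in> carrier M \<Longrightarrow> h m \<in> carrier B"
    and h_one: "h \<one> = \<one>\<^bsub>B\<^esub>"
    and h_mult: "m \<in> carrier M \<Longrightarrow> n \<in> carrier M \<Longrightarrow> h (m \<otimes> n) = h m \<otimes>\<^bsub>B\<^esub> h n"
    and h_star: "m \<in> carrier M \<Longrightarrow> h (\<sigma> m) = star B (h m)"
begin

lemma lin_sum_superset:
  assumes "finite P" "{p. f p \<noteq> 0} \<subseteq> P" "P \<subseteq> carrier M"
  shows "lin_sum B h f = (\<Oplus>\<^bsub>B\<^esub>m\<in>P. f m \<odot>\<^bsub>B\<^esub> h m)"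
  unfolding lin_sum_def
  by (rule B.add.finprod_mono_neutral_cong_left)
    (use assms in \<open>auto simp: h_closed B.smult_closed B.smult_zero_l subset_iff\<close>)

lemma lin_sum_closed: "f \<in> carrier MA \<Longrightarrow> lin_sum B h f \<in> carrier B"
  unfolding lin_sum_def MA_carrier
  by (rule B.finsum_closed) (auto intro!: B.smult_closed h_closed)

lemma lin_sum_add:
  assumes "f \<in> carrier MA" "g \<in> carrier MA"
  shows "lin_sum B h (f \<oplus>\<^bsub>MA\<^esub> g) = lin_sum B h f \<oplus>\<^bsub>B\<^esub> lin_sum B h g"
proof -
  let ?P = "{p. f p \<noteq> 0} \<union> {p. g p \<noteq> 0}"
  have P: "finite ?P" "?P \<subseteq> carrier M" using assms by (auto simp: MA_carrier)
  have cl: "c \<odot>\<^bsub>B\<^esub> h m \<in> carrier B" if "m \<in> ?P" for c m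
    using that P by (auto intro!: B.smult_closed h_closed)
  have "lin_sum B h (f \<oplus>\<^bsub>MA\<^esub> g) = (\<Oplus>\<^bsub>B\<^esub>m\<in>?P. (f \<oplus>\<^bsub>MA\<^esub> g) m \<odot>\<^bsub>B\<^esub> h m)"
    by (rule lin_sum_superset) (use P in \<open>auto simp: MA_simps\<close>)
  also have "\<dots> = (\<Oplus>\<^bsub>B\<^esub>m\<in>?P. f m \<odot>\<^bsub>B\<^esub> h m \<oplus>\<^bsub>B\<^esub> g m \<odot>\<^bsub>B\<^esub> h m)"
    by (rule B.add.finprod_cong') (use P cl in \<open>auto simp: MA_simps B.smult_l_distr h_closed subset_iff\<close>)
  also have "\<dots> = (\<Oplus>\<^bsub>B\<^esub>m\<in>?P. f m \<odot>\<^bsub>B\<^esub> h m) \<oplus>\<^bsub>B\<^esub> (\<Oplus>\<^bsub>B\<^esub>m\<in>?P. g m \<odot>\<^bsub>B\<^esub> h m)"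
    by (rule B.finsum_addf) (use cl in auto)
  also have "\<dots> = lin_sum B h f \<oplus>\<^bsub>B\<^esub> lin_sum B h g"
    using lin_sum_superset[of ?P f] lin_sum_superset[of ?P g] P by auto
  finally show ?thesis .
qed

lemma lin_sum_smult:
  assumes "f \<in> carrier MA"
  shows "lin_sum B h (c \<odot>\<^bsub>MA\<^esub> f) = c \<odot>\<^bsub>B\<^esub> lin_sum B h f"
proof -
  let ?P = "{p. f p \<noteq> 0}"
  have P: "finite ?P" "?P \<subseteq> carrier M" using assms by (auto simp: MA_carrier)
  have cl: "c \<odot>\<^bsub>B\<^esub> h m \<in> carrier B" if "m \<in> ?P" for c m
    using that P by (auto intro!: B.smult_closed h_closed)
  have "lin_sum B h (c \<odot>\<^bsub>MA\<^esub> f) = (\<Oplus>\<^bsub>B\<^esub>m\<in>?P. (c \<odot>\<^bsub>MA\<^esub> f) m \<odot>\<^bsub>B\<^esub> h m)"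
    by (rule lin_sum_superset) (use P in \<open>auto simp: MA_simps\<close>)
  also have "\<dots> = (\<Oplus>\<^bsub>B\<^esub>m\<in>?P. c \<odot>\<^bsub>B\<^esub> (f m \<odot>\<^bsub>B\<^esub> h m))"
    by (rule B.add.finprod_cong')
      (use P cl in \<open>auto simp: MA_simps B.smult_assoc h_closed B.smult_closed subset_iff\<close>)
  also have "\<dots> = c \<odot>\<^bsub>B\<^esub> lin_sum B h f"
    unfolding lin_sum_def by (rule B.smult_finsum[symmetric]) (use cl in auto)
  finally show ?thesis .
qed

lemma lin_sum_basis: "m \<in> carrier M \<Longrightarrow> lin_sum B h (basis_vec m) = h m"
  unfolding lin_sum_def supp_basis_vec
  by (simp add: h_closed B.smult_closed B.smult_one basis_vec_def)

lemma lin_sum_mult: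
  assumes f: "f \<in> carrier MA" and g: "g \<in> carrier MA"
  shows "lin_sum B h (f \<otimes>\<^bsub>MA\<^esub> g) = lin_sum B h f \<otimes>\<^bsub>B\<^esub> lin_sum B h g"
  using f
proof (induction f rule: MA_induct)
  case (basis c m)
  note m = basis
  show ?case using g
    by (induction g rule: MA_induct)
      (use m in \<open>simp_all add: MA_smult_mult MA_smult_closed MA_basis_closed MA_mult_basis lin_sum_smult
          lin_sum_basis h_mult h_closed B.smult_mult_l B.smult_mult_r B.smult_closed
          MA_r_distr MA_mult_closed lin_sum_add B.r_distr lin_sum_closed\<close>)
qed (use g in \<open>simp add: MA_l_distr MA_mult_closed lin_sum_add B.l_distr lin_sum_closed\<close>)

lemma lin_sum_star:
  assumes f: "f \<in> carrier MA"
  shows "lin_sum B h (star MA f) = star B (lin_sum B h f)"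
  using f
  by (induction f rule: MA_induct)
    (simp_all add: MA_star_smult MA_star_basis MA_smult_closed MA_basis_closed lin_sum_smult
      lin_sum_basis h_star h_closed inv_closed B.star_smult B.star_add MA_star_add MA_star_closed
      lin_sum_add lin_sum_closed)

lemma lin_sum_star_hom: "lin_sum B h \<in> star_hom MA B"
  by (rule star_homI) (simp_all add: lin_sum_closed lin_sum_add lin_sum_mult lin_sum_smult
      lin_sum_star MA_simps(1) lin_sum_basis h_one)

end

section \<open>Quotients by *-ideals\<close>

locale star_ideal_algebra = star_algebra A + ideal I A
  for A :: "('a, 'z) star_alg_scheme" (structure) and I :: "'a set" +
  assumes star_ideal_closed: "x \<in> I \<Longrightarrow> star A x \<in> I"
begin

lemma quot_carrier: "carrier (star_quot A I) = {I +> x | x. x \<in> carrier A}"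
  by (auto simp: star_quot_def FactRing_def A_RCOSETS_def' )

lemma quot_ops:
  assumes "x \<in> carrier A" "y \<in> carrier A"
  shows "(I +> x) \<otimes>\<^bsub>star_quot A I\<^esub> (I +> y) = I +> (x \<otimes> y)"
    "(I +> x) \<oplus>\<^bsub>star_quot A I\<^esub> (I +> y) = I +> (x \<oplus> y)"
  using assms by (simp_all add: star_quot_def FactRing_def rcoset_mult_add a_rcos_sum)

lemma quot_one: "\<one>\<^bsub>star_quot A I\<^esub> = I +> \<one>"
  by (simp add: star_quot_def FactRing_def)

text \<open>The scalar multiplication and the adjoint of a quotient are unions over all representatives
  of a coset; an additive map that preserves the ideal sends all of them to one coset.\<close>

lemma coset_UN_eq:
  assumes "x \<in> carrier A"
    and closed: "\<And>y. y \<in> carrier A \<Longrightarrow> f y \<in> carrier A"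
    and add: "\<And>y z. y \<in> carrier A \<Longrightarrow> z \<in> carrier A \<Longrightarrow> f (y \<oplus> z) = f y \<oplus> f z"
    and ideal: "\<And>y. y \<in> I \<Longrightarrow> f y \<in> I"
  shows "(\<Union>y\<in>I +> x. I +> f y) = I +> f x"
proof -
  have "I +> f y = I +> f x" if y: "y \<in> I +> x" for y
  proof -
    obtain i where i: "i \<in> I" "y = i \<oplus> x" using y by (auto simp: a_r_coset_def')
    then have "f y = f i \<oplus> f x" using assms by simp
    moreover have "f i \<in> I" using i ideal by simp
    ultimately have "f y \<in> I +> f x" by (auto simp: a_r_coset_def')
    then show ?thesis using a_repr_independence' closed assms(1) by metis
  qed
  moreover have "x \<in> I +> x" using assms(1) by (rule a_rcos_self)
  ultimately show ?thesis by blast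
qed

lemma quot_smult: "x \<in> carrier A \<Longrightarrow> c \<odot>\<^bsub>star_quot A I\<^esub> (I +> x) = I +> (c \<odot> x)"
  unfolding star_quot_def
  by (simp, rule coset_UN_eq) (auto simp: smult_closed smult_r_distr ideal_smult_closed is_ideal)

lemma quot_star: "x \<in> carrier A \<Longrightarrow> star (star_quot A I) (I +> x) = I +> star A x"
  unfolding star_quot_def
  by (simp, rule coset_UN_eq) (auto simp: star_closed star_add star_ideal_closed)

lemma star_algebra_star_quot: "star_algebra (star_quot A I)"
proof -
  have "ring (star_quot A I)"
    by (rule ring_cong_ops[OF quotient_is_ring]) (simp_all add: star_quot_def)
  then show ?thesis
    by (rule star_algebra.intro, unfold_locales)
      (auto simp: quot_carrier quot_ops quot_smult quot_star smult_closed smult_l_distr smult_r_distr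
        smult_assoc smult_one smult_mult_l smult_mult_r star_closed star_star star_add star_smult
        star_mult)
qed

lemma coset_star_hom: "(+>) I \<in> star_hom A (star_quot A I)"
  by (rule star_homI) (auto simp: quot_carrier quot_ops quot_one quot_smult quot_star)

end

text \<open>The adjoint reverses products, so the elements whose adjoint lies in the ideal again form a
  two-sided ideal; it contains the generators because these are closed under the adjoint.\<close>

lemma (in star_algebra) star_ideal_algebra_star_ideal:
  assumes "R \<subseteq> carrier A"
  shows "star_ideal_algebra A (star_ideal A R)"
proof -
  let ?I = "star_ideal A R"
  have carr: "R \<union> star A ` R \<subseteq> carrier A" using assms star_closed by auto
  then interpret ideal ?I A unfolding star_ideal_def by (rule genideal_ideal)
  have incl: "R \<union> star A ` R \<subseteq> ?I" unfolding star_ideal_def using carr by (rule genideal_self)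
  let ?J = "{x \<in> carrier A. star A x \<in> ?I}"
  have "ideal ?J A"
  proof (rule idealI)
    show "ring A" by (rule ring_axioms)
    show "subgroup ?J (add_monoid A)"
      by (rule add.subgroupI)
        (use star_zero star_add star_smult[of _ "-1"] in
          \<open>auto simp: star_closed smult_minus_one[symmetric] ideal_smult_closed is_ideal smult_closed\<close>)
  qed (auto simp: star_mult star_closed I_l_closed I_r_closed)
  moreover have "R \<union> star A ` R \<subseteq> ?J" using incl assms star_closed star_star by auto
  ultimately have "?I \<subseteq> ?J" unfolding star_ideal_def by (rule genideal_minimal)
  then show ?thesis
    by (intro star_ideal_algebra.intro star_algebra_axioms is_ideal
        star_ideal_algebra_axioms.intro) auto
qed

lemma star_hom_ring_hom_ring:
  "star_algebra A \<Longrightarrow> star_algebra B \<Longrightarrow> f \<in> star_hom A B \<Longrightarrow> ring_hom_ring A B f"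
  by (intro ring_hom_ringI2) (auto simp: star_algebra_def star_hom_def)

lemma star_hom_vanishes_on_star_ideal:
  assumes "star_algebra A" "star_algebra B" "f \<in> star_hom A B" "R \<subseteq> carrier A"
    and R: "\<And>r. r \<in> R \<Longrightarrow> f r = \<zero>\<^bsub>B\<^esub>" and x: "x \<in> star_ideal A R"
  shows "f x = \<zero>\<^bsub>B\<^esub>"
proof -
  interpret A: star_algebra A by fact
  interpret B: star_algebra B by fact
  interpret ring_hom_ring A B f by (rule star_hom_ring_hom_ring) fact+
  have "star A r \<in> a_kernel A B f" if "r \<in> R" for r
    unfolding a_kernel_def'
    using star_homD(6)[OF assms(3), of r] R[OF that] that assms(4) A.star_closed B.star_zero by auto
  moreover have "R \<subseteq> a_kernel A B f" unfolding a_kernel_def' using assms(4) R by blast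
  ultimately have "R \<union> star A ` R \<subseteq> a_kernel A B f" by blast
  then have "star_ideal A R \<subseteq> a_kernel A B f"
    unfolding star_ideal_def by (rule A.genideal_minimal[OF kernel_is_ideal])
  with x show ?thesis unfolding a_kernel_def' by blast
qed

context monoid_rep
begin

text \<open>The choice of a representative in \<^const>\<open>lin_ext\<close> is harmless once the linear extension
  vanishes on the relations: its kernel is a two-sided *-ideal, hence contains the ideal
  that they generate.\<close>

lemma lin_ext_star_quot:
  assumes R: "R \<subseteq> carrier MA" "\<And>r. r \<in> R \<Longrightarrow> lin_sum B h r = \<zero>\<^bsub>B\<^esub>"
  shows "f \<in> carrier MA \<Longrightarrow>
      lin_ext B h (star_ideal MA R +>\<^bsub>MA\<^esub> f) = lin_sum B h f" (is "_ \<Longrightarrow> ?eq f")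
    and "lin_ext B h \<in> star_hom (star_quot MA (star_ideal MA R)) B"
proof -
  interpret MA: star_algebra MA by (rule star_algebra_MA)
  interpret Q: star_ideal_algebra MA "star_ideal MA R"
    by (rule MA.star_ideal_algebra_star_ideal) fact
  have eq: "?eq f" if f: "f \<in> carrier MA" for f
  proof -
    let ?X = "star_ideal MA R +>\<^bsub>MA\<^esub> f"
    have "f \<in> ?X" using f by (rule Q.a_rcos_self)
    then have "(SOME g. g \<in> ?X) \<in> ?X" by (rule someI[of "\<lambda>g. g \<in> ?X"])
    then obtain i where i: "i \<in> star_ideal MA R" "(SOME g. g \<in> ?X) = i \<oplus>\<^bsub>MA\<^esub> f"
      unfolding a_r_coset_def' by auto
    have "lin_ext B h ?X = lin_sum B h (i \<oplus>\<^bsub>MA\<^esub> f)"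
      unfolding lin_ext_def Let_def lin_sum_def i(2) ..
    also have "\<dots> = lin_sum B h i \<oplus>\<^bsub>B\<^esub> lin_sum B h f"
      using i(1) f by (intro lin_sum_add) auto
    also have "lin_sum B h i = \<zero>\<^bsub>B\<^esub>"
      by (rule star_hom_vanishes_on_star_ideal[OF MA.star_algebra_axioms B.star_algebra_axioms
            lin_sum_star_hom R i(1)])
    finally show ?thesis using lin_sum_closed[OF f] by simp
  qed
  then show "f \<in> carrier MA \<Longrightarrow> ?eq f" .
  note L = star_homD[OF lin_sum_star_hom]
  show "lin_ext B h \<in> star_hom (star_quot MA (star_ideal MA R)) B"
    by (rule star_homI)
      (auto simp: Q.quot_carrier Q.quot_ops Q.quot_one Q.quot_smult Q.quot_star eq L
        MA.smult_closed MA.star_closed)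
qed

end

lemma (in involutive_monoid) star_hom_quot_eqI:
  assumes R: "R \<subseteq> carrier MA"
    and f: "f \<in> star_hom (star_quot MA (star_ideal MA R)) B"
    and g: "g \<in> star_hom (star_quot MA (star_ideal MA R)) B"
    and eq: "\<And>m. m \<in> carrier M \<Longrightarrow> f (star_ideal MA R +>\<^bsub>MA\<^esub> basis_vec m) =
      g (star_ideal MA R +>\<^bsub>MA\<^esub> basis_vec m)"
    and x: "x \<in> carrier (star_quot MA (star_ideal MA R))"
  shows "f x = g x"
proof -
  interpret MA: star_algebra MA by (rule star_algebra_MA)
  interpret Q: star_ideal_algebra MA "star_ideal MA R"
    by (rule MA.star_ideal_algebra_star_ideal) fact
  let ?c = "\<lambda>k. star_ideal MA R +>\<^bsub>MA\<^esub> k"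
  have c: "?c k \<in> carrier (star_quot MA (star_ideal MA R))" if "k \<in> carrier MA" for k
    using that by (auto simp: Q.quot_carrier)
  obtain k where k: "k \<in> carrier MA" "x = ?c k" using x by (auto simp: Q.quot_carrier)
  note f = star_homD[OF f] and g = star_homD[OF g]
  have "f (?c k) = g (?c k)" using k(1)
  proof (induction k rule: MA_induct)
    case (basis a m)
    then show ?case
      using f(5)[OF c[OF MA_basis_closed[OF basis]], of a]
        g(5)[OF c[OF MA_basis_closed[OF basis]], of a] eq
      by (simp add: Q.quot_smult MA_basis_closed)
  next
    case (add k l)
    then show ?case using f(2)[OF c c, of k l] g(2)[OF c c, of k l] by (simp add: Q.quot_ops)
  qed
  with k show ?thesis by simp
qed

section \<open>Tensor products\<close>

locale star_algebra_pair = A: star_algebra A + B: star_algebra B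
  for A :: "('a, 'y) star_alg_scheme" and B :: "('b, 'z) star_alg_scheme"
begin

sublocale P: involutive_monoid "A \<times>\<times> B" "\<lambda>(a, b). (star A a, star B b)"
  by (intro involutive_monoid.intro DirProd_monoid A.monoid_axioms B.monoid_axioms
      involutive_monoid_axioms.intro)
    (auto simp: A.star_closed B.star_closed A.star_star B.star_star A.star_mult B.star_mult)

lemma pair_alg: "pair_alg A B = P.MA" by (simp add: pair_alg_def)

sublocale PA: star_algebra "pair_alg A B"
  unfolding pair_alg by (rule P.star_algebra_MA)

lemma basis_closed: "a \<in> carrier A \<Longrightarrow> b \<in> carrier B \<Longrightarrow> basis_vec (a, b) \<in> carrier (pair_alg A B)"
  unfolding pair_alg by (rule P.MA_basis_closed) simp

lemma bilin_rels_closed: "bilin_rels A B \<subseteq> carrier (pair_alg A B)"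
  unfolding bilin_rels_def Let_def
  by (auto intro!: PA.minus_closed PA.smult_closed PA.add.m_closed basis_closed
      A.smult_closed B.smult_closed)

sublocale TI: star_ideal_algebra "pair_alg A B" "tensor_ideal A B"
  unfolding tensor_ideal_def
  by (rule PA.star_ideal_algebra_star_ideal[OF bilin_rels_closed])

sublocale T: star_algebra "tensor_alg A B"
  unfolding tensor_alg_def by (rule TI.star_algebra_star_quot)

lemma tens_closed: "a \<in> carrier A \<Longrightarrow> b \<in> carrier B \<Longrightarrow> tens A B a b \<in> carrier (tensor_alg A B)"
  unfolding tens_def tensor_alg_def by (auto simp: TI.quot_carrier basis_closed)

lemma coset_eqI:
  assumes "x \<in> carrier (pair_alg A B)" "y \<in> carrier (pair_alg A B)"
    "x \<ominus>\<^bsub>pair_alg A B\<^esub> y \<in> bilin_rels A B"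
  shows "tensor_ideal A B +>\<^bsub>pair_alg A B\<^esub> x = tensor_ideal A B +>\<^bsub>pair_alg A B\<^esub> y"
proof -
  have "bilin_rels A B \<subseteq> tensor_ideal A B"
    unfolding tensor_ideal_def star_ideal_def
    using PA.genideal_self[of "bilin_rels A B \<union> star (pair_alg A B) ` bilin_rels A B"]
      bilin_rels_closed PA.star_closed by auto
  with assms show ?thesis
    using PA.quotient_eq_iff_same_a_r_cos[OF TI.is_ideal] by auto
qed

lemma tens_add_l:
  assumes "a \<in> carrier A" "a' \<in> carrier A" "b \<in> carrier B"
  shows "tens A B (a \<oplus>\<^bsub>A\<^esub> a') b = tens A B a b \<oplus>\<^bsub>tensor_alg A B\<^esub> tens A B a' b"
  unfolding tens_def tensor_alg_def
  by (subst TI.quot_ops, (rule basis_closed assms)+, rule coset_eqI,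
      (intro basis_closed PA.add.m_closed A.add.m_closed assms)+)
    (unfold bilin_rels_def Let_def, use assms in blast)

lemma tens_add_r:
  assumes "a \<in> carrier A" "b \<in> carrier B" "b' \<in> carrier B"
  shows "tens A B a (b \<oplus>\<^bsub>B\<^esub> b') = tens A B a b \<oplus>\<^bsub>tensor_alg A B\<^esub> tens A B a b'"
  unfolding tens_def tensor_alg_def
  by (subst TI.quot_ops, (rule basis_closed assms)+, rule coset_eqI,
      (intro basis_closed PA.add.m_closed B.add.m_closed assms)+)
    (unfold bilin_rels_def Let_def, use assms in blast)

lemma tens_smult_l:
  assumes "a \<in> carrier A" "b \<in> carrier B"
  shows "tens A B (c \<odot>\<^bsub>A\<^esub> a) b = c \<odot>\<^bsub>tensor_alg A B\<^esub> tens A B a b"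
  unfolding tens_def tensor_alg_def
  by (subst TI.quot_smult, (rule basis_closed assms)+, rule coset_eqI,
      (intro basis_closed PA.smult_closed A.smult_closed assms)+)
    (unfold bilin_rels_def Let_def, use assms in blast)

lemma tens_smult_r:
  assumes "a \<in> carrier A" "b \<in> carrier B"
  shows "tens A B a (c \<odot>\<^bsub>B\<^esub> b) = c \<odot>\<^bsub>tensor_alg A B\<^esub> tens A B a b"
  unfolding tens_def tensor_alg_def
  by (subst TI.quot_smult, (rule basis_closed assms)+, rule coset_eqI,
      (intro basis_closed PA.smult_closed B.smult_closed assms)+)
    (unfold bilin_rels_def Let_def, use assms in blast)

lemma tens_mult:
  assumes "a \<in> carrier A" "a' \<in> carrier A" "b \<in> carrier B" "b' \<in> carrier B"
  shows "tens A B a b \<otimes>\<^bsub>tensor_alg A B\<^esub> tens A B a' b' = tens A B (a \<otimes>\<^bsub>A\<^esub> a') (b \<otimes>\<^bsub>B\<^esub> b')"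
  unfolding tens_def tensor_alg_def
  by (subst TI.quot_ops, (rule basis_closed assms)+) (simp add: pair_alg P.MA_mult_basis)

lemma tens_star:
  assumes "a \<in> carrier A" "b \<in> carrier B"
  shows "star (tensor_alg A B) (tens A B a b) = tens A B (star A a) (star B b)"
  unfolding tens_def tensor_alg_def
  by (subst TI.quot_star, (rule basis_closed assms)+) (simp add: pair_alg P.MA_star_basis assms)

lemma tens_one: "\<one>\<^bsub>tensor_alg A B\<^esub> = tens A B \<one>\<^bsub>A\<^esub> \<one>\<^bsub>B\<^esub>"
  unfolding tens_def tensor_alg_def TI.quot_one by (simp add: pair_alg P.MA_simps(1))

lemma star_hom_tensor_eqI:
  assumes "f \<in> star_hom (tensor_alg A B) C" "g \<in> star_hom (tensor_alg A B) C"
    and "\<And>a b. a \<in> carrier A \<Longrightarrow> b \<in> carrier B \<Longrightarrow> f (tens A B a b) = g (tens A B a b)"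
    and "x \<in> carrier (tensor_alg A B)"
  shows "f x = g x"
proof (rule P.star_hom_quot_eqI)
  note unf = tensor_alg_def tensor_ideal_def pair_alg tens_def
  show "bilin_rels A B \<subseteq> carrier P.MA" using bilin_rels_closed by (simp add: pair_alg)
  show "f \<in> star_hom (star_quot P.MA (star_ideal P.MA (bilin_rels A B))) C"
    "g \<in> star_hom (star_quot P.MA (star_ideal P.MA (bilin_rels A B))) C"
    "x \<in> carrier (star_quot P.MA (star_ideal P.MA (bilin_rels A B)))"
    using assms by (simp_all add: unf)
  fix m assume "m \<in> carrier (A \<times>\<times> B)"
  then show "f (star_ideal P.MA (bilin_rels A B) +>\<^bsub>P.MA\<^esub> basis_vec m) =
    g (star_ideal P.MA (bilin_rels A B) +>\<^bsub>P.MA\<^esub> basis_vec m)"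
    using assms(3)[of "fst m" "snd m"] by (auto simp: unf)
qed

text \<open>The bilinear maps of interest are also multiplicative and *-preserving, so that the
  linear extension is a homomorphism on the algebra of pairs. It is then enough to test the
  bilinearity relations themselves, not the ideal they generate.\<close>

lemma tensor_lift_star_hom:
  assumes C: "star_algebra C"
    and closed: "\<And>a b. a \<in> carrier A \<Longrightarrow> b \<in> carrier B \<Longrightarrow> \<beta> a b \<in> carrier C"
    and add_l: "\<And>a a' b. a \<in> carrier A \<Longrightarrow> a' \<in> carrier A \<Longrightarrow> b \<in> carrier B \<Longrightarrow>
      \<beta> (a \<oplus>\<^bsub>A\<^esub> a') b = \<beta> a b \<oplus>\<^bsub>C\<^esub> \<beta> a' b"
    and add_r: "\<And>a b b'. a \<in> carrier A \<Longrightarrow> b \<in> carrier B \<Longrightarrow> b' \<in> carrier B \<Longrightarrow>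
      \<beta> a (b \<oplus>\<^bsub>B\<^esub> b') = \<beta> a b \<oplus>\<^bsub>C\<^esub> \<beta> a b'"
    and smult_l: "\<And>c a b. a \<in> carrier A \<Longrightarrow> b \<in> carrier B \<Longrightarrow> \<beta> (c \<odot>\<^bsub>A\<^esub> a) b = c \<odot>\<^bsub>C\<^esub> \<beta> a b"
    and smult_r: "\<And>c a b. a \<in> carrier A \<Longrightarrow> b \<in> carrier B \<Longrightarrow> \<beta> a (c \<odot>\<^bsub>B\<^esub> b) = c \<odot>\<^bsub>C\<^esub> \<beta> a b"
    and mult: "\<And>a a' b b'. a \<in> carrier A \<Longrightarrow> a' \<in> carrier A \<Longrightarrow> b \<in> carrier B \<Longrightarrow> b' \<in> carrier B \<Longrightarrow>
      \<beta> (a \<otimes>\<^bsub>A\<^esub> a') (b \<otimes>\<^bsub>B\<^esub> b') = \<beta> a b \<otimes>\<^bsub>C\<^esub> \<beta> a' b'"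
    and one: "\<beta> \<one>\<^bsub>A\<^esub> \<one>\<^bsub>B\<^esub> = \<one>\<^bsub>C\<^esub>"
    and star: "\<And>a b. a \<in> carrier A \<Longrightarrow> b \<in> carrier B \<Longrightarrow> \<beta> (star A a) (star B b) = star C (\<beta> a b)"
  shows "tensor_lift C \<beta> \<in> star_hom (tensor_alg A B) C"
    and "a \<in> carrier A \<Longrightarrow> b \<in> carrier B \<Longrightarrow> tensor_lift C \<beta> (tens A B a b) = \<beta> a b"
proof -
  interpret C: star_algebra C by fact
  interpret H: monoid_rep "A \<times>\<times> B" "\<lambda>(a, b). (star A a, star B b)" C "\<lambda>(a, b). \<beta> a b"
    by unfold_locales (auto simp: closed mult one star)
  let ?L = "lin_sum C (\<lambda>(a, b). \<beta> a b)"
  note L = star_homD[OF H.lin_sum_star_hom, folded pair_alg]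
  have basis: "?L (basis_vec (a, b)) = \<beta> a b" if "a \<in> carrier A" "b \<in> carrier B" for a b
    using H.lin_sum_basis[of "(a, b)"] that by simp
  have minus: "?L (x \<ominus>\<^bsub>pair_alg A B\<^esub> y) = \<zero>\<^bsub>C\<^esub>"
    if "?L x = ?L y" "x \<in> carrier (pair_alg A B)" "y \<in> carrier (pair_alg A B)" for x y
    using star_hom_minus[OF PA.star_algebra_axioms C H.lin_sum_star_hom[folded pair_alg] that(2,3)]
      that(1) L(1)[OF that(3)] by (simp add: C.minus_eq C.r_neg)
  have vanish: "?L r = \<zero>\<^bsub>C\<^esub>" if "r \<in> bilin_rels A B" for r
    using that unfolding bilin_rels_def Let_def
    by (elim UnE CollectE exE conjE; hypsubst)
      (rule minus, simp add: basis L basis_closed closed add_l add_r smult_l smult_r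
        A.smult_closed B.smult_closed PA.smult_closed,
       (intro basis_closed PA.smult_closed PA.add.m_closed A.smult_closed B.smult_closed
         A.add.m_closed B.add.m_closed; assumption)+)+
  note ext = H.lin_ext_star_quot[OF bilin_rels_closed[unfolded pair_alg] vanish]
  show "tensor_lift C \<beta> \<in> star_hom (tensor_alg A B) C"
    unfolding tensor_lift_def tensor_alg_def tensor_ideal_def pair_alg by (rule ext(2))
  assume ab: "a \<in> carrier A" "b \<in> carrier B"
  show "tensor_lift C \<beta> (tens A B a b) = \<beta> a b"
    using ext(1)[OF _ basis_closed[OF ab, unfolded pair_alg]] basis[OF ab]
    unfolding tensor_lift_def tens_def tensor_ideal_def pair_alg by simp
qed

end

lemma tensor_map_star_hom:
  assumes "star_algebra A" "star_algebra B" "star_algebra C" "star_algebra D"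
    and f: "f \<in> star_hom A C" and g: "g \<in> star_hom B D"
  shows "tensor_map C D f g \<in> star_hom (tensor_alg A B) (tensor_alg C D)"
    and "a \<in> carrier A \<Longrightarrow> b \<in> carrier B \<Longrightarrow>
      tensor_map C D f g (tens A B a b) = tens C D (f a) (g b)"
proof -
  interpret AB: star_algebra_pair A B using assms by (simp add: star_algebra_pair_def)
  interpret CD: star_algebra_pair C D using assms by (simp add: star_algebra_pair_def)
  note f = star_homD[OF f] and g = star_homD[OF g]
  show "tensor_map C D f g \<in> star_hom (tensor_alg A B) (tensor_alg C D)"
    unfolding tensor_map_def
    by (rule AB.tensor_lift_star_hom(1)[OF CD.T.star_algebra_axioms])
      (simp_all add: f g CD.tens_closed CD.tens_add_l CD.tens_add_r CD.tens_smult_l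
        CD.tens_smult_r CD.tens_mult CD.tens_one CD.tens_star)
  assume "a \<in> carrier A" "b \<in> carrier B"
  then show "tensor_map C D f g (tens A B a b) = tens C D (f a) (g b)"
    unfolding tensor_map_def
    by (intro AB.tensor_lift_star_hom(2)[OF CD.T.star_algebra_axioms])
      (simp_all add: f g CD.tens_closed CD.tens_add_l CD.tens_add_r CD.tens_smult_l
        CD.tens_smult_r CD.tens_mult CD.tens_one CD.tens_star)
qed

section \<open>Finite sums in rings and tensor products\<close>

context ring
begin

lemma finsum_swap:
  assumes "finite I" "finite J" "\<And>i j. i \<in> I \<Longrightarrow> j \<in> J \<Longrightarrow> f i j \<in> carrier R"
  shows "(\<Oplus>i\<in>I. \<Oplus>j\<in>J. f i j) = (\<Oplus>j\<in>J. \<Oplus>i\<in>I. f i j)"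
  using assms(1,3)
proof (induction I rule: finite_induct)
  case (insert i I)
  have cl: "(\<lambda>j. f i j) \<in> J \<rightarrow> carrier R" "\<And>j. j \<in> J \<Longrightarrow> (\<lambda>i. f i j) \<in> I \<rightarrow> carrier R"
    using insert.prems by auto
  have cl': "(\<lambda>i. \<Oplus>j\<in>J. f i j) \<in> I \<rightarrow> carrier R" "(\<lambda>j. \<Oplus>i\<in>I. f i j) \<in> J \<rightarrow> carrier R"
    using insert.prems by (auto intro!: finsum_closed)
  have "(\<Oplus>i\<in>insert i I. \<Oplus>j\<in>J. f i j) = (\<Oplus>j\<in>J. f i j) \<oplus> (\<Oplus>j\<in>J. \<Oplus>i\<in>I. f i j)"
    using insert cl cl' by (simp add: finsum_closed)
  also have "\<dots> = (\<Oplus>j\<in>J. f i j \<oplus> (\<Oplus>i\<in>I. f i j))"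
    by (rule finsum_addf[symmetric]) (rule cl cl')+
  also have "\<dots> = (\<Oplus>j\<in>J. \<Oplus>i\<in>insert i I. f i j)"
    by (rule finsum_cong') (use insert cl in \<open>auto intro!: finsum_closed\<close>)
  finally show ?case .
qed (simp add: finsum_zero)

text \<open>The half-commutation \<open>abc = cba\<close> is additive in the outer and in the middle factor, which
  propagates it from the summands of three sums to the sums.\<close>

lemma finsum_mult_commute3:
  assumes "finite I" "f \<in> I \<rightarrow> carrier R" "y \<in> carrier R" "z \<in> carrier R"
  shows "(\<And>i. i \<in> I \<Longrightarrow> f i \<otimes> y \<otimes> z = z \<otimes> y \<otimes> f i) \<Longrightarrow> finsum R f I \<otimes> y \<otimes> z = z \<otimes> y \<otimes> finsum R f I"
    and "(\<And>i. i \<in> I \<Longrightarrow> y \<otimes> f i \<otimes> z = z \<otimes> f i \<otimes> y) \<Longrightarrow> y \<otimes> finsum R f I \<otimes> z = z \<otimes> finsum R f I \<otimes> y"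
proof -
  have cl: "f i \<in> carrier R" if "i \<in> I" for i using assms(2) that by auto
  have F: "(\<lambda>i. f i \<otimes> y) \<in> I \<rightarrow> carrier R" "(\<lambda>i. z \<otimes> f i) \<in> I \<rightarrow> carrier R"
    "(\<lambda>i. y \<otimes> f i) \<in> I \<rightarrow> carrier R"
    using cl assms by auto
  show "(\<And>i. i \<in> I \<Longrightarrow> f i \<otimes> y \<otimes> z = z \<otimes> y \<otimes> f i) \<Longrightarrow> finsum R f I \<otimes> y \<otimes> z = z \<otimes> y \<otimes> finsum R f I"
    using assms F by (simp add: finsum_ldistr finsum_rdistr cl cong: finsum_cong)
  show "(\<And>i. i \<in> I \<Longrightarrow> y \<otimes> f i \<otimes> z = z \<otimes> f i \<otimes> y) \<Longrightarrow> y \<otimes> finsum R f I \<otimes> z = z \<otimes> finsum R f I \<otimes> y"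
    using assms F by (simp add: finsum_ldistr finsum_rdistr cl cong: finsum_cong)
qed

text \<open>If \<open>P\<^sup>tQ = 1\<close>, the inner indices of \<open>P\<close> and \<open>Q\<close> contract as soon as \<open>Q\<close> can be moved past \<open>L\<close>
  and \<open>Y\<close>. With \<open>P\<close>, \<open>Q\<close> in one leg of a tensor product and \<open>L\<close>, \<open>Y\<close>, \<open>M\<close> in the other this gives
  the row and column relations for the comultiplication (with \<open>Y = 1\<close>), and also the stability of
  a quotient under \<open>y \<mapsto> \<Sum>\<^sub>k u\<^sub>k\<^sub>i y u\<^sub>k\<^sub>j\<close>.\<close>

lemma finsum_contract:
  assumes fin: "finite I" and Y: "Y \<in> carrier R"
    and cl: "\<And>k l. k \<in> I \<Longrightarrow> l \<in> I \<Longrightarrow> P k l \<in> carrier R" "\<And>k l. k \<in> I \<Longrightarrow> l \<in> I \<Longrightarrow> Q k l \<in> carrier R"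
      "\<And>l. l \<in> I \<Longrightarrow> L l \<in> carrier R" "\<And>l. l \<in> I \<Longrightarrow> M l \<in> carrier R"
    and orth: "\<And>l m. l \<in> I \<Longrightarrow> m \<in> I \<Longrightarrow> (\<Oplus>k\<in>I. P k l \<otimes> Q k m) = (if l = m then \<one> else \<zero>)"
    and comm: "\<And>k l m. k \<in> I \<Longrightarrow> l \<in> I \<Longrightarrow> m \<in> I \<Longrightarrow> Q k m \<otimes> (L l \<otimes> Y) = (L l \<otimes> Y) \<otimes> Q k m"
  shows "(\<Oplus>k\<in>I. (\<Oplus>l\<in>I. P k l \<otimes> L l) \<otimes> Y \<otimes> (\<Oplus>m\<in>I. Q k m \<otimes> M m)) = (\<Oplus>l\<in>I. L l \<otimes> Y \<otimes> M l)"
proof -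
  let ?X = "\<lambda>l m. L l \<otimes> Y \<otimes> M m"
  have X: "?X l m \<in> carrier R" if "l \<in> I" "m \<in> I" for l m using that cl Y by simp
  have trm: "(P k l \<otimes> L l) \<otimes> Y \<otimes> (Q k m \<otimes> M m) = (P k l \<otimes> Q k m) \<otimes> ?X l m"
    if "k \<in> I" "l \<in> I" "m \<in> I" for k l m
  proof -
    have "(P k l \<otimes> L l) \<otimes> Y \<otimes> (Q k m \<otimes> M m) = P k l \<otimes> ((L l \<otimes> Y) \<otimes> Q k m) \<otimes> M m"
      using that cl Y by (simp add: m_assoc)
    also have "\<dots> = P k l \<otimes> (Q k m \<otimes> (L l \<otimes> Y)) \<otimes> M m" using comm[OF that] by simp
    also have "\<dots> = (P k l \<otimes> Q k m) \<otimes> ?X l m" using that cl Y by (simp add: m_assoc)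
    finally show ?thesis .
  qed
  have "(\<Oplus>k\<in>I. (\<Oplus>l\<in>I. P k l \<otimes> L l) \<otimes> Y \<otimes> (\<Oplus>m\<in>I. Q k m \<otimes> M m)) =
      (\<Oplus>k\<in>I. \<Oplus>l\<in>I. \<Oplus>m\<in>I. (P k l \<otimes> Q k m) \<otimes> ?X l m)"
  proof (rule finsum_cong')
    fix k assume k: "k \<in> I"
    let ?S = "\<Oplus>m\<in>I. Q k m \<otimes> M m"
    have S: "?S \<in> carrier R" using k cl by (auto intro!: finsum_closed)
    have "(\<Oplus>l\<in>I. P k l \<otimes> L l) \<otimes> Y \<otimes> ?S = (\<Oplus>l\<in>I. (P k l \<otimes> L l) \<otimes> Y) \<otimes> ?S"
      by (subst finsum_ldistr) (use fin Y k cl in auto)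
    also have "\<dots> = (\<Oplus>l\<in>I. (P k l \<otimes> L l) \<otimes> Y \<otimes> ?S)"
      by (subst finsum_ldistr) (use fin Y k cl S in auto)
    also have "\<dots> = (\<Oplus>l\<in>I. \<Oplus>m\<in>I. (P k l \<otimes> Q k m) \<otimes> ?X l m)"
    proof (rule finsum_cong')
      fix l assume l: "l \<in> I"
      have "(P k l \<otimes> L l) \<otimes> Y \<otimes> ?S = (\<Oplus>m\<in>I. (P k l \<otimes> L l) \<otimes> Y \<otimes> (Q k m \<otimes> M m))"
        by (rule finsum_rdistr) (use fin Y k l cl in auto)
      also have "\<dots> = (\<Oplus>m\<in>I. (P k l \<otimes> Q k m) \<otimes> ?X l m)"
        by (rule finsum_cong') (use k l trm cl X in auto)
      finally show "(P k l \<otimes> L l) \<otimes> Y \<otimes> ?S = (\<Oplus>m\<in>I. (P k l \<otimes> Q k m) \<otimes> ?X l m)" .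
    qed (use k cl X in \<open>auto intro!: finsum_closed\<close>)
    finally show "(\<Oplus>l\<in>I. P k l \<otimes> L l) \<otimes> Y \<otimes> ?S = (\<Oplus>l\<in>I. \<Oplus>m\<in>I. (P k l \<otimes> Q k m) \<otimes> ?X l m)" .
  qed (use cl X in \<open>auto intro!: finsum_closed\<close>)
  also have "\<dots> = (\<Oplus>l\<in>I. \<Oplus>k\<in>I. \<Oplus>m\<in>I. (P k l \<otimes> Q k m) \<otimes> ?X l m)"
    by (rule finsum_swap) (use fin cl X in \<open>auto intro!: finsum_closed\<close>)
  also have "\<dots> = (\<Oplus>l\<in>I. ?X l l)"
  proof (rule finsum_cong')
    fix l assume l: "l \<in> I"
    have "(\<Oplus>k\<in>I. \<Oplus>m\<in>I. (P k l \<otimes> Q k m) \<otimes> ?X l m) = (\<Oplus>m\<in>I. \<Oplus>k\<in>I. (P k l \<otimes> Q k m) \<otimes> ?X l m)"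
      by (rule finsum_swap) (use fin cl X l in auto)
    also have "\<dots> = (\<Oplus>m\<in>I. if l = m then ?X l m else \<zero>)"
    proof (rule finsum_cong')
      fix m assume m: "m \<in> I"
      have "(\<Oplus>k\<in>I. (P k l \<otimes> Q k m) \<otimes> ?X l m) = (\<Oplus>k\<in>I. P k l \<otimes> Q k m) \<otimes> ?X l m"
        by (rule finsum_ldistr[symmetric]) (use fin cl X l m in auto)
      then show "(\<Oplus>k\<in>I. (P k l \<otimes> Q k m) \<otimes> ?X l m) = (if l = m then ?X l m else \<zero>)"
        using orth[OF l m] X[OF l m] by (cases "l = m") simp_all
    qed (use l X in auto)
    also have "\<dots> = ?X l l" by (rule add.finprod_singleton) (use l fin X in auto)
    finally show "(\<Oplus>k\<in>I. \<Oplus>m\<in>I. (P k l \<otimes> Q k m) \<otimes> ?X l m) = ?X l l" .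
  qed (use X in auto)
  finally show ?thesis .
qed

end

lemma (in star_algebra_pair) tens_finsum_l:
  assumes "finite I" "f \<in> I \<rightarrow> carrier A" "b \<in> carrier B"
  shows "(\<Oplus>\<^bsub>tensor_alg A B\<^esub>i\<in>I. tens A B (f i) b) = tens A B (finsum A f I) b"
  using assms
proof (induction I rule: finite_induct)
  case empty
  then show ?case using tens_smult_l[OF A.zero_closed, of b 0]
    by (simp add: A.smult_zero_r T.smult_zero_l tens_closed)
next
  case (insert i I)
  moreover have "(\<lambda>i. tens A B (f i) b) \<in> I \<rightarrow> carrier (tensor_alg A B)"
    using insert.prems tens_closed by auto
  ultimately show ?case
    using tens_closed[of "f i" b] by (simp add: Pi_iff tens_add_l A.finsum_closed)
qed

lemma (in star_algebra_pair) tens_finsum_r: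
  assumes "finite I" "a \<in> carrier A" "f \<in> I \<rightarrow> carrier B"
  shows "(\<Oplus>\<^bsub>tensor_alg A B\<^esub>i\<in>I. tens A B a (f i)) = tens A B a (finsum B f I)"
  using assms
proof (induction I rule: finite_induct)
  case empty
  then show ?case using tens_smult_r[OF _ B.zero_closed, of a 0]
    by (simp add: B.smult_zero_r T.smult_zero_l tens_closed)
next
  case (insert i I)
  moreover have "(\<lambda>i. tens A B a (f i)) \<in> I \<rightarrow> carrier (tensor_alg A B)"
    using insert.prems tens_closed by auto
  ultimately show ?case
    using tens_closed[of a "f i"] by (simp add: Pi_iff tens_add_r B.finsum_closed)
qed

lemma (in star_algebra) star_finsum:
  "f \<in> I \<rightarrow> carrier A \<Longrightarrow> star A (\<Oplus>i\<in>I. f i) = (\<Oplus>i\<in>I. star A (f i))"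
proof (induction I rule: infinite_finite_induct)
  case (insert i I)
  moreover have "(\<lambda>i. star A (f i)) \<in> I \<rightarrow> carrier A" using insert.prems star_closed by auto
  ultimately show ?case using star_closed[of "f i"] by (simp add: Pi_iff star_add finsum_closed)
qed (auto simp: star_zero finsum_infinite)

section \<open>The universal property of the orthogonal quantum groups\<close>

text \<open>The defining relations, imposed on an arbitrary matrix over a *-algebra. Indices are paired
  because the generators are words over pairs.\<close>

definition orth_relations ::
  "orthogonal_kind \<Rightarrow> nat \<Rightarrow> ('b, 'z) star_alg_scheme \<Rightarrow> (nat \<times> nat \<Rightarrow> 'b) \<Rightarrow> bool" where
  "orth_relations t N B b \<longleftrightarrow>
    (\<forall>i\<in>{1..N}. \<forall>j\<in>{1..N}.
      (\<Oplus>\<^bsub>B\<^esub>k\<in>{1..N}. b (i, k) \<otimes>\<^bsub>B\<^esub> b (j, k)) = (if i = j then \<one>\<^bsub>B\<^esub> else \<zero>\<^bsub>B\<^esub>)) \<and>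
    (\<forall>i\<in>{1..N}. \<forall>j\<in>{1..N}.
      (\<Oplus>\<^bsub>B\<^esub>k\<in>{1..N}. b (k, i) \<otimes>\<^bsub>B\<^esub> b (k, j)) = (if i = j then \<one>\<^bsub>B\<^esub> else \<zero>\<^bsub>B\<^esub>)) \<and>
    (t = Half_Liberated \<longrightarrow> (\<forall>p\<in>{1..N} \<times> {1..N}. \<forall>q\<in>{1..N} \<times> {1..N}. \<forall>r\<in>{1..N} \<times> {1..N}.
      b p \<otimes>\<^bsub>B\<^esub> b q \<otimes>\<^bsub>B\<^esub> b r = b r \<otimes>\<^bsub>B\<^esub> b q \<otimes>\<^bsub>B\<^esub> b p))"

lemma involutive_free_monoid: "involutive_monoid (free_monoid X) rev"
  by (intro involutive_monoid.intro monoidI involutive_monoid_axioms.intro)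
    (auto simp: free_monoid_def lists_eq_set)

lemma star_algebra_orth_free_alg: "star_algebra (orth_free_alg N)"
  unfolding orth_free_alg_def
  by (rule involutive_monoid.star_algebra_MA[OF involutive_free_monoid])

lemma orth_free_gen_closed:
  "p \<in> {1..N} \<times> {1..N} \<Longrightarrow> basis_vec [p] \<in> carrier (orth_free_alg N)"
  unfolding orth_free_alg_def
  by (rule involutive_monoid.MA_basis_closed[OF involutive_free_monoid]) (simp add: free_monoid_def)

lemma orth_rels_closed: "orth_rels t N \<subseteq> carrier (orth_free_alg N)"
proof -
  interpret F: star_algebra "orth_free_alg N" by (rule star_algebra_orth_free_alg)
  note g = orth_free_gen_closed
  have "orthogonality_rels N \<subseteq> carrier (orth_free_alg N)"
    unfolding orthogonality_rels_def Let_def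
    by (auto intro!: F.minus_closed F.finsum_closed F.m_closed g)
  moreover have "half_commutation_rels N \<subseteq> carrier (orth_free_alg N)"
    unfolding half_commutation_rels_def Let_def
    by (auto intro!: F.minus_closed F.m_closed g)
  ultimately show ?thesis by (cases t) auto
qed

text \<open>Read from right to left this gives the homomorphisms out of \<open>\<O>(G)\<close>; read from left to right,
  for the quotient map, it gives the relations in \<open>\<O>(G)\<close> itself.\<close>

lemma orth_rels_vanish_iff:
  assumes B: "star_algebra B" and f: "f \<in> star_hom (orth_free_alg N) B"
  shows "(\<forall>r\<in>orth_rels t N. f r = \<zero>\<^bsub>B\<^esub>) \<longleftrightarrow> orth_relations t N B (\<lambda>p. f (basis_vec [p]))"
proof -
  interpret F: star_algebra "orth_free_alg N" by (rule star_algebra_orth_free_alg)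
  interpret B: star_algebra B by fact
  let ?F = "orth_free_alg N" and ?X = "{1..N} \<times> {1..N}"
  note g = orth_free_gen_closed
  note fD = star_homD[OF f]
  note f0 = star_hom_zero[OF F.star_algebra_axioms B f]
  have minus: "f (x \<ominus>\<^bsub>?F\<^esub> y) = \<zero>\<^bsub>B\<^esub> \<longleftrightarrow> f x = f y" if "x \<in> carrier ?F" "y \<in> carrier ?F" for x y
    using star_hom_minus[OF F.star_algebra_axioms B f that] fD(1)[OF that(1)] fD(1)[OF that(2)]
    by (metis B.a_inv_closed B.minus_eq B.minus_equality B.minus_minus B.r_neg)
  have delta: "f (if i = j then \<one>\<^bsub>?F\<^esub> else \<zero>\<^bsub>?F\<^esub>) = (if i = j then \<one>\<^bsub>B\<^esub> else \<zero>\<^bsub>B\<^esub>)" for i j :: nat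
    by (simp add: fD(4) f0)
  have sum: "f ((\<Oplus>\<^bsub>?F\<^esub>k\<in>{1..N}. basis_vec [p k] \<otimes>\<^bsub>?F\<^esub> basis_vec [q k]) \<ominus>\<^bsub>?F\<^esub>
        (if i = j then \<one>\<^bsub>?F\<^esub> else \<zero>\<^bsub>?F\<^esub>)) = \<zero>\<^bsub>B\<^esub> \<longleftrightarrow>
      (\<Oplus>\<^bsub>B\<^esub>k\<in>{1..N}. f (basis_vec [p k]) \<otimes>\<^bsub>B\<^esub> f (basis_vec [q k])) =
        (if i = j then \<one>\<^bsub>B\<^esub> else \<zero>\<^bsub>B\<^esub>)"
    if pq: "\<And>k. k \<in> {1..N} \<Longrightarrow> p k \<in> ?X" "\<And>k. k \<in> {1..N} \<Longrightarrow> q k \<in> ?X" for p q and i j :: nat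
  proof -
    have "(\<lambda>k. basis_vec [p k] \<otimes>\<^bsub>?F\<^esub> basis_vec [q k]) \<in> {1..N} \<rightarrow> carrier ?F"
      using g pq by blast
    then have "f (\<Oplus>\<^bsub>?F\<^esub>k\<in>{1..N}. basis_vec [p k] \<otimes>\<^bsub>?F\<^esub> basis_vec [q k]) =
        (\<Oplus>\<^bsub>B\<^esub>k\<in>{1..N}. f (basis_vec [p k] \<otimes>\<^bsub>?F\<^esub> basis_vec [q k]))"
      "(\<Oplus>\<^bsub>?F\<^esub>k\<in>{1..N}. basis_vec [p k] \<otimes>\<^bsub>?F\<^esub> basis_vec [q k]) \<in> carrier ?F"
      by (auto intro: star_hom_finsum[OF F.star_algebra_axioms B f] F.finsum_closed)
    moreover have "(\<Oplus>\<^bsub>B\<^esub>k\<in>{1..N}. f (basis_vec [p k] \<otimes>\<^bsub>?F\<^esub> basis_vec [q k])) =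
        (\<Oplus>\<^bsub>B\<^esub>k\<in>{1..N}. f (basis_vec [p k]) \<otimes>\<^bsub>B\<^esub> f (basis_vec [q k]))"
      by (rule B.finsum_cong') (use pq g fD(1,3) in auto)
    ultimately show ?thesis using minus delta by (simp add: F.one_closed F.zero_closed)
  qed
  have row: "(\<forall>r\<in>orthogonality_rels N. f r = \<zero>\<^bsub>B\<^esub>) \<longleftrightarrow>
     (\<forall>i\<in>{1..N}. \<forall>j\<in>{1..N}. (\<Oplus>\<^bsub>B\<^esub>k\<in>{1..N}. f (basis_vec [(i, k)]) \<otimes>\<^bsub>B\<^esub> f (basis_vec [(j, k)])) =
        (if i = j then \<one>\<^bsub>B\<^esub> else \<zero>\<^bsub>B\<^esub>)) \<and>
     (\<forall>i\<in>{1..N}. \<forall>j\<in>{1..N}. (\<Oplus>\<^bsub>B\<^esub>k\<in>{1..N}. f (basis_vec [(k, i)]) \<otimes>\<^bsub>B\<^esub> f (basis_vec [(k, j)])) =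
        (if i = j then \<one>\<^bsub>B\<^esub> else \<zero>\<^bsub>B\<^esub>))"
    (is "?l \<longleftrightarrow> ?r")
  proof -
    have "?l \<longleftrightarrow>
      (\<forall>i\<in>{1..N}. \<forall>j\<in>{1..N}. f ((\<Oplus>\<^bsub>?F\<^esub>k\<in>{1..N}. basis_vec [(i, k)] \<otimes>\<^bsub>?F\<^esub> basis_vec [(j, k)]) \<ominus>\<^bsub>?F\<^esub>
        (if i = j then \<one>\<^bsub>?F\<^esub> else \<zero>\<^bsub>?F\<^esub>)) = \<zero>\<^bsub>B\<^esub>) \<and>
      (\<forall>i\<in>{1..N}. \<forall>j\<in>{1..N}. f ((\<Oplus>\<^bsub>?F\<^esub>k\<in>{1..N}. basis_vec [(k, i)] \<otimes>\<^bsub>?F\<^esub> basis_vec [(k, j)]) \<ominus>\<^bsub>?F\<^esub>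
        (if i = j then \<one>\<^bsub>?F\<^esub> else \<zero>\<^bsub>?F\<^esub>)) = \<zero>\<^bsub>B\<^esub>)"
      unfolding orthogonality_rels_def Let_def by blast
    also have "\<dots> \<longleftrightarrow> ?r"
      by (intro arg_cong2[where f = "(\<and>)"] ball_cong refl sum) auto
    finally show ?thesis .
  qed
  have half: "(\<forall>r\<in>half_commutation_rels N. f r = \<zero>\<^bsub>B\<^esub>) \<longleftrightarrow>
     (\<forall>p\<in>?X. \<forall>q\<in>?X. \<forall>r\<in>?X. f (basis_vec [p]) \<otimes>\<^bsub>B\<^esub> f (basis_vec [q]) \<otimes>\<^bsub>B\<^esub> f (basis_vec [r]) =
        f (basis_vec [r]) \<otimes>\<^bsub>B\<^esub> f (basis_vec [q]) \<otimes>\<^bsub>B\<^esub> f (basis_vec [p]))"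
    (is "?l \<longleftrightarrow> ?r")
  proof -
    have "?l \<longleftrightarrow> (\<forall>p\<in>?X. \<forall>q\<in>?X. \<forall>r\<in>?X.
      f ((basis_vec [p] \<otimes>\<^bsub>?F\<^esub> basis_vec [q] \<otimes>\<^bsub>?F\<^esub> basis_vec [r]) \<ominus>\<^bsub>?F\<^esub>
        (basis_vec [r] \<otimes>\<^bsub>?F\<^esub> basis_vec [q] \<otimes>\<^bsub>?F\<^esub> basis_vec [p])) = \<zero>\<^bsub>B\<^esub>)"
      unfolding half_commutation_rels_def Let_def insert_subset by blast
    also have "\<dots> \<longleftrightarrow> ?r"
      by (intro ball_cong refl) (simp add: minus g F.m_closed fD(3) del: mem_Times_iff)
    finally show ?thesis .
  qed
  show ?thesis
    unfolding orth_relations_def using row half by (cases t) (auto simp: ball_Un)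
qed

locale orth_matrix = star_algebra B
  for t :: orthogonal_kind and N :: nat and B :: "('b, 'z) star_alg_scheme" (structure) +
  fixes b :: "nat \<times> nat \<Rightarrow> 'b"
  assumes b_closed: "p \<in> {1..N} \<times> {1..N} \<Longrightarrow> b p \<in> carrier B"
    and b_star: "p \<in> {1..N} \<times> {1..N} \<Longrightarrow> star B (b p) = b p"
    and b_relations: "orth_relations t N B b"
begin

abbreviation word :: "(nat \<times> nat) list \<Rightarrow> 'b" where
  "word w \<equiv> foldr (\<lambda>p x. b p \<otimes> x) w \<one>"

lemma word_closed: "set w \<subseteq> {1..N} \<times> {1..N} \<Longrightarrow> word w \<in> carrier B"
  by (induction w) (simp_all add: b_closed del: mem_Times_iff)

lemma word_append:
  "set v \<subseteq> {1..N} \<times> {1..N} \<Longrightarrow> set w \<subseteq> {1..N} \<times> {1..N} \<Longrightarrow> word (v @ w) = word v \<otimes> word w"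
  by (induction v) (simp_all only: append.simps foldr.simps o_def id_apply l_one word_closed m_assoc
      b_closed insert_subset list.set)

lemma word_rev: "set w \<subseteq> {1..N} \<times> {1..N} \<Longrightarrow> word (rev w) = star B (word w)"
proof (induction w)
  case (Cons p w)
  then have p: "p \<in> {1..N} \<times> {1..N}" "set w \<subseteq> {1..N} \<times> {1..N}" by auto
  then have "word (rev (p # w)) = word (rev w) \<otimes> word [p]"
    by (simp only: rev.simps) (rule word_append, auto)
  then show ?case using Cons.IH p
    by (simp add: star_mult b_closed b_star word_closed del: mem_Times_iff)
qed (simp add: star_one)

sublocale W: monoid_rep "free_monoid ({1..N} \<times> {1..N})" rev B word
  by (intro monoid_rep.intro involutive_free_monoid star_algebra_axioms monoid_rep_axioms.intro)
    (simp_all add: free_monoid_def lists_eq_set word_closed word_append word_rev del: mem_Times_iff foldr_append One_nat_def)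

text \<open>The map is written as the very term by which the comultiplication is defined, so that the
  latter is an instance.\<close>

lemma orth_hom:
  shows "lin_ext B word \<in> star_hom (orth_alg t N) B"
    and "p \<in> {1..N} \<times> {1..N} \<Longrightarrow> lin_ext B word (orth_gen t N (fst p) (snd p)) = b p"
proof -
  have gen: "lin_sum B word (basis_vec [p]) = b p" if "p \<in> {1..N} \<times> {1..N}" for p
    using W.lin_sum_basis[of "[p]"] that b_closed[OF that] by (simp add: free_monoid_def)
  have "orth_relations t N B (\<lambda>p. lin_sum B word (basis_vec [p]))"
  proof -
    have *: "(\<Oplus>k\<in>{1..N}. lin_sum B word (basis_vec [(i, k)]) \<otimes> lin_sum B word (basis_vec [(j, k)])) =
        (\<Oplus>k\<in>{1..N}. b (i, k) \<otimes> b (j, k))"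
      "(\<Oplus>k\<in>{1..N}. lin_sum B word (basis_vec [(k, i)]) \<otimes> lin_sum B word (basis_vec [(k, j)])) =
        (\<Oplus>k\<in>{1..N}. b (k, i) \<otimes> b (k, j))"
      if "i \<in> {1..N}" "j \<in> {1..N}" for i j
      by (rule finsum_cong', (use that b_closed gen in auto)[3])+
    show ?thesis
      using b_relations unfolding orth_relations_def by (simp add: * gen del: mem_Times_iff atLeastAtMost_iff One_nat_def)
  qed
  then have vanish: "\<And>r. r \<in> orth_rels t N \<Longrightarrow> lin_sum B word r = \<zero>"
    using orth_rels_vanish_iff[OF star_algebra_axioms
        W.lin_sum_star_hom[folded orth_free_alg_def]] by blast
  note ext = W.lin_ext_star_quot[OF orth_rels_closed[unfolded orth_free_alg_def], OF vanish]
  show "lin_ext B word \<in> star_hom (orth_alg t N) B"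
    unfolding orth_alg_def orth_ideal_def orth_free_alg_def by (rule ext(2))
  assume p: "p \<in> {1..N} \<times> {1..N}"
  have "lin_ext B word (orth_gen t N (fst p) (snd p)) = lin_sum B word (basis_vec [p])"
    unfolding orth_gen_def orth_ideal_def orth_free_alg_def prod.collapse
    by (rule ext(1), assumption) (rule orth_free_gen_closed[OF p, unfolded orth_free_alg_def])
  with gen p show "lin_ext B word (orth_gen t N (fst p) (snd p)) = b p" by simp
qed

end

lemma star_ideal_algebra_orth_ideal: "star_ideal_algebra (orth_free_alg N) (orth_ideal t N)"
  unfolding orth_ideal_def
  by (rule star_algebra.star_ideal_algebra_star_ideal[OF star_algebra_orth_free_alg orth_rels_closed])

lemma star_algebra_orth_alg: "star_algebra (orth_alg t N)"
  unfolding orth_alg_def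
  by (rule star_ideal_algebra.star_algebra_star_quot[OF star_ideal_algebra_orth_ideal])

abbreviation orth_gen_pair :: "orthogonal_kind \<Rightarrow> nat \<Rightarrow> nat \<times> nat \<Rightarrow> orth_elem" where
  "orth_gen_pair t N p \<equiv> orth_gen t N (fst p) (snd p)"

lemma orth_gen_matrix: "orth_matrix t N (orth_alg t N) (orth_gen_pair t N)"
proof -
  interpret F: star_algebra "orth_free_alg N" by (rule star_algebra_orth_free_alg)
  interpret G: star_algebra "orth_alg t N" by (rule star_algebra_orth_alg)
  interpret I: star_ideal_algebra "orth_free_alg N" "orth_ideal t N"
    by (rule star_ideal_algebra_orth_ideal)
  let ?c = "\<lambda>x. orth_ideal t N +>\<^bsub>orth_free_alg N\<^esub> x"
  have c: "?c \<in> star_hom (orth_free_alg N) (orth_alg t N)"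
    using I.coset_star_hom by (simp add: orth_alg_def)
  have "orth_rels t N \<subseteq> orth_ideal t N"
    unfolding orth_ideal_def star_ideal_def
    using F.genideal_self[of "orth_rels t N \<union> star (orth_free_alg N) ` orth_rels t N"]
      orth_rels_closed F.star_closed by (auto simp: subset_iff)
  moreover have "\<zero>\<^bsub>orth_alg t N\<^esub> = orth_ideal t N"
    by (simp add: orth_alg_def star_quot_def FactRing_def)
  ultimately have "\<forall>r\<in>orth_rels t N. ?c r = \<zero>\<^bsub>orth_alg t N\<^esub>"
    using I.a_rcos_const by auto
  then have rel: "orth_relations t N (orth_alg t N) (orth_gen_pair t N)"
    unfolding orth_rels_vanish_iff[OF G.star_algebra_axioms c] by (simp add: orth_gen_def)
  show ?thesis
  proof
    fix p assume p: "p \<in> {1..N} \<times> {1..N}"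
    note pc = orth_free_gen_closed[OF p]
    show "orth_gen_pair t N p \<in> carrier (orth_alg t N)"
      using star_homD(1)[OF c pc] by (simp add: orth_gen_def)
    have "star (orth_free_alg N) (basis_vec [p]) = basis_vec (rev [p])"
      unfolding orth_free_alg_def
      by (rule involutive_monoid.MA_star_basis[OF involutive_free_monoid])
        (use p in \<open>simp add: free_monoid_def\<close>)
    then show "star (orth_alg t N) (orth_gen_pair t N p) = orth_gen_pair t N p"
      using star_homD(6)[OF c pc] by (simp add: orth_gen_def)
  qed (rule rel)
qed

lemma star_hom_orth_alg_eqI:
  assumes f: "f \<in> star_hom (orth_alg t N) B" and g: "g \<in> star_hom (orth_alg t N) B"
    and eq: "\<And>i j. i \<in> {1..N} \<Longrightarrow> j \<in> {1..N} \<Longrightarrow> f (orth_gen t N i j) = g (orth_gen t N i j)"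
    and x: "x \<in> carrier (orth_alg t N)"
  shows "f x = g x"
proof -
  interpret M: involutive_monoid "free_monoid ({1..N} \<times> {1..N})" rev
    by (rule involutive_free_monoid)
  interpret I: star_ideal_algebra "orth_free_alg N" "orth_ideal t N"
    by (rule star_ideal_algebra_orth_ideal)
  note unf = orth_alg_def orth_ideal_def orth_free_alg_def
  let ?c = "\<lambda>w. orth_ideal t N +>\<^bsub>orth_free_alg N\<^esub> basis_vec w"
  have w: "f (?c w) = g (?c w)" if "set w \<subseteq> {1..N} \<times> {1..N}" for w
    using that
  proof (induction w)
    case Nil
    have "?c [] = \<one>\<^bsub>orth_alg t N\<^esub>"
      unfolding orth_alg_def I.quot_one unfolding orth_free_alg_def M.MA_simps(1) by (simp add: free_monoid_def del: One_nat_def)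
    then show ?case using star_homD(4)[OF f] star_homD(4)[OF g] by simp
  next
    case (Cons p w)
    then have p: "p \<in> {1..N} \<times> {1..N}" "set w \<subseteq> {1..N} \<times> {1..N}" by auto
    have "w \<in> carrier (free_monoid ({1..N} \<times> {1..N}))"
      using p(2) by (auto simp: free_monoid_def)
    then have cl: "basis_vec [p] \<in> carrier (orth_free_alg N)"
      "basis_vec w \<in> carrier (orth_free_alg N)"
      using orth_free_gen_closed[OF p(1)] M.MA_basis_closed unfolding orth_free_alg_def by blast+
    have "basis_vec (p # w) = basis_vec [p] \<otimes>\<^bsub>orth_free_alg N\<^esub> basis_vec w"
      unfolding orth_free_alg_def M.MA_mult_basis by (simp add: free_monoid_def)
    then have "?c (p # w) = ?c [p] \<otimes>\<^bsub>orth_alg t N\<^esub> ?c w"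
      using cl by (simp add: orth_alg_def I.quot_ops)
    moreover have "?c [p] \<in> carrier (orth_alg t N)" "?c w \<in> carrier (orth_alg t N)"
      using cl by (auto simp: orth_alg_def I.quot_carrier)
    moreover have "f (?c [p]) = g (?c [p])"
      using eq[of "fst p" "snd p"] p(1) by (auto simp: orth_gen_def)
    ultimately show ?case
      using Cons.IH[OF p(2)] star_homD(3)[OF f] star_homD(3)[OF g] by simp
  qed
  show ?thesis
  proof (rule M.star_hom_quot_eqI)
    show "orth_rels t N \<subseteq> carrier M.MA" using orth_rels_closed by (simp add: orth_free_alg_def)
    show "f \<in> star_hom (star_quot M.MA (star_ideal M.MA (orth_rels t N))) B"
      "g \<in> star_hom (star_quot M.MA (star_ideal M.MA (orth_rels t N))) B"
      "x \<in> carrier (star_quot M.MA (star_ideal M.MA (orth_rels t N)))"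
      using f g x by (simp_all add: unf)
    fix m :: "(nat \<times> nat) list" assume "m \<in> carrier (free_monoid ({1..N} \<times> {1..N}))"
    then show "f (star_ideal M.MA (orth_rels t N) +>\<^bsub>M.MA\<^esub> basis_vec m) =
        g (star_ideal M.MA (orth_rels t N) +>\<^bsub>M.MA\<^esub> basis_vec m)"
      using w[of m] by (simp add: unf free_monoid_def lists_eq_set del: mem_Times_iff)
  qed
qed

text \<open>The matrix \<open>d\<^sub>i\<^sub>j = \<Sum>\<^sub>k a\<^sub>i\<^sub>k \<otimes> b\<^sub>k\<^sub>j\<close> is a product of two matrices whose entries commute with
  each other, so that orthogonality of \<open>a\<close> and \<open>b\<close> passes to \<open>d\<close>, and half-commutation holds
  summand by summand.\<close>

lemma orth_matrix_tensor:
  assumes "orth_matrix t N A a" "orth_matrix t N B b"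
  shows "orth_matrix t N (tensor_alg A B)
    (\<lambda>(i, j). \<Oplus>\<^bsub>tensor_alg A B\<^esub>k\<in>{1..N}. tens A B (a (i, k)) (b (k, j)))"
proof -
  interpret a: orth_matrix t N A a by fact
  interpret b: orth_matrix t N B b by fact
  interpret P: star_algebra_pair A B
    by (intro star_algebra_pair.intro a.star_algebra_axioms b.star_algebra_axioms)
  let ?T = "tensor_alg A B" and ?I = "{1..N}"
  let ?d = "\<lambda>(i, j). \<Oplus>\<^bsub>?T\<^esub>k\<in>?I. tens A B (a (i, k)) (b (k, j))"
  have acl: "a (i, j) \<in> carrier A" and bcl: "b (i, j) \<in> carrier B" if "i \<in> ?I" "j \<in> ?I" for i j
    using that a.b_closed b.b_closed by auto
  have tcl: "tens A B (a (i, k)) (b (k', j)) \<in> carrier ?T"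
    if "i \<in> ?I" "j \<in> ?I" "k \<in> ?I" "k' \<in> ?I" for i j k k'
    using that acl bcl P.tens_closed by blast
  let ?l = "\<lambda>x. tens A B x \<one>\<^bsub>B\<^esub>" and ?r = "\<lambda>x. tens A B \<one>\<^bsub>A\<^esub> x"
  have lcl: "?l x \<in> carrier ?T" if "x \<in> carrier A" for x using that P.tens_closed by simp
  have rcl: "?r x \<in> carrier ?T" if "x \<in> carrier B" for x using that P.tens_closed by simp
  have lr: "tens A B x y = ?l x \<otimes>\<^bsub>?T\<^esub> ?r y" "tens A B x y = ?r y \<otimes>\<^bsub>?T\<^esub> ?l x"
    if "x \<in> carrier A" "y \<in> carrier B" for x y
    using that by (simp_all add: P.tens_mult)
  have zero: "?l \<zero>\<^bsub>A\<^esub> = \<zero>\<^bsub>?T\<^esub>" "?r \<zero>\<^bsub>B\<^esub> = \<zero>\<^bsub>?T\<^esub>"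
    using P.tens_finsum_l[of "{}" undefined "\<one>\<^bsub>B\<^esub>"] P.tens_finsum_r[of "{}" "\<one>\<^bsub>A\<^esub>" undefined] by auto
  have row: "(\<Oplus>\<^bsub>?T\<^esub>k\<in>?I. ?d (i, k) \<otimes>\<^bsub>?T\<^esub> ?d (j, k)) = (if i = j then \<one>\<^bsub>?T\<^esub> else \<zero>\<^bsub>?T\<^esub>)"
    if ij: "i \<in> ?I" "j \<in> ?I" for i j
  proof -
    have d: "?d (i, k) = (\<Oplus>\<^bsub>?T\<^esub>l\<in>?I. ?r (b (l, k)) \<otimes>\<^bsub>?T\<^esub> ?l (a (i, l)))"
      "?d (i, k) \<in> carrier ?T"
      if "i \<in> ?I" "k \<in> ?I" for i k
    proof -
      show "?d (i, k) = (\<Oplus>\<^bsub>?T\<^esub>l\<in>?I. ?r (b (l, k)) \<otimes>\<^bsub>?T\<^esub> ?l (a (i, l)))"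
        unfolding prod.case
        by (rule P.T.finsum_cong') (use that acl bcl lcl rcl in \<open>auto intro!: lr(2)\<close>)
      show "?d (i, k) \<in> carrier ?T" using that tcl by (auto intro!: P.T.finsum_closed)
    qed
    have "(\<Oplus>\<^bsub>?T\<^esub>k\<in>?I. ?d (i, k) \<otimes>\<^bsub>?T\<^esub> ?d (j, k)) =
      (\<Oplus>\<^bsub>?T\<^esub>k\<in>?I. (\<Oplus>\<^bsub>?T\<^esub>l\<in>?I. ?r (b (l, k)) \<otimes>\<^bsub>?T\<^esub> ?l (a (i, l))) \<otimes>\<^bsub>?T\<^esub> \<one>\<^bsub>?T\<^esub> \<otimes>\<^bsub>?T\<^esub>
         (\<Oplus>\<^bsub>?T\<^esub>m\<in>?I. ?r (b (m, k)) \<otimes>\<^bsub>?T\<^esub> ?l (a (j, m))))"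
    proof (rule P.T.finsum_cong')
      fix k assume k: "k \<in> ?I"
      show "?d (i, k) \<otimes>\<^bsub>?T\<^esub> ?d (j, k) =
        (\<Oplus>\<^bsub>?T\<^esub>l\<in>?I. ?r (b (l, k)) \<otimes>\<^bsub>?T\<^esub> ?l (a (i, l))) \<otimes>\<^bsub>?T\<^esub> \<one>\<^bsub>?T\<^esub> \<otimes>\<^bsub>?T\<^esub>
         (\<Oplus>\<^bsub>?T\<^esub>m\<in>?I. ?r (b (m, k)) \<otimes>\<^bsub>?T\<^esub> ?l (a (j, m)))"
        using d(2)[OF ij(1) k] unfolding d(1)[OF ij(1) k] d(1)[OF ij(2) k] by simp
    qed (use ij acl bcl lcl rcl in \<open>auto intro!: P.T.finsum_closed\<close>)
    also have "\<dots> = (\<Oplus>\<^bsub>?T\<^esub>l\<in>?I. ?l (a (i, l)) \<otimes>\<^bsub>?T\<^esub> \<one>\<^bsub>?T\<^esub> \<otimes>\<^bsub>?T\<^esub> ?l (a (j, l)))"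
    proof (rule P.T.finsum_contract)
      fix l m assume lm: "l \<in> ?I" "m \<in> ?I"
      have "(\<Oplus>\<^bsub>?T\<^esub>k\<in>?I. ?r (b (l, k)) \<otimes>\<^bsub>?T\<^esub> ?r (b (m, k))) =
          (\<Oplus>\<^bsub>?T\<^esub>k\<in>?I. ?r (b (l, k) \<otimes>\<^bsub>B\<^esub> b (m, k)))"
        by (rule P.T.finsum_cong') (use lm bcl rcl in \<open>auto simp: P.tens_mult\<close>)
      also have "\<dots> = ?r (\<Oplus>\<^bsub>B\<^esub>k\<in>?I. b (l, k) \<otimes>\<^bsub>B\<^esub> b (m, k))"
        by (rule P.tens_finsum_r) (use lm bcl in auto)
      also have "\<dots> = (if l = m then \<one>\<^bsub>?T\<^esub> else \<zero>\<^bsub>?T\<^esub>)"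
        using b.b_relations lm zero P.tens_one unfolding orth_relations_def by simp
      finally show "(\<Oplus>\<^bsub>?T\<^esub>k\<in>?I. ?r (b (l, k)) \<otimes>\<^bsub>?T\<^esub> ?r (b (m, k))) =
        (if l = m then \<one>\<^bsub>?T\<^esub> else \<zero>\<^bsub>?T\<^esub>)" .
    next
      fix k l m assume "k \<in> ?I" "l \<in> ?I" "m \<in> ?I"
      then show "?r (b (m, k)) \<otimes>\<^bsub>?T\<^esub> (?l (a (i, l)) \<otimes>\<^bsub>?T\<^esub> \<one>\<^bsub>?T\<^esub>) =
          ?l (a (i, l)) \<otimes>\<^bsub>?T\<^esub> \<one>\<^bsub>?T\<^esub> \<otimes>\<^bsub>?T\<^esub> ?r (b (m, k))"
        using ij acl bcl lcl by (simp add: P.tens_mult)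
    qed (use ij acl bcl lcl rcl in auto)
    also have "\<dots> = (\<Oplus>\<^bsub>?T\<^esub>l\<in>?I. ?l (a (i, l) \<otimes>\<^bsub>A\<^esub> a (j, l)))"
      by (rule P.T.finsum_cong') (use ij acl lcl in \<open>auto simp: P.tens_mult\<close>)
    also have "\<dots> = ?l (\<Oplus>\<^bsub>A\<^esub>l\<in>?I. a (i, l) \<otimes>\<^bsub>A\<^esub> a (j, l))"
      by (rule P.tens_finsum_l) (use ij acl in auto)
    also have "\<dots> = (if i = j then \<one>\<^bsub>?T\<^esub> else \<zero>\<^bsub>?T\<^esub>)"
      using a.b_relations ij zero P.tens_one unfolding orth_relations_def by simp
    finally show ?thesis .
  qed
  have col: "(\<Oplus>\<^bsub>?T\<^esub>k\<in>?I. ?d (k, i) \<otimes>\<^bsub>?T\<^esub> ?d (k, j)) = (if i = j then \<one>\<^bsub>?T\<^esub> else \<zero>\<^bsub>?T\<^esub>)"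
    if ij: "i \<in> ?I" "j \<in> ?I" for i j
  proof -
    have d: "?d (k, i) = (\<Oplus>\<^bsub>?T\<^esub>l\<in>?I. ?l (a (k, l)) \<otimes>\<^bsub>?T\<^esub> ?r (b (l, i)))"
      "?d (k, i) \<in> carrier ?T"
      if "i \<in> ?I" "k \<in> ?I" for i k
    proof -
      show "?d (k, i) = (\<Oplus>\<^bsub>?T\<^esub>l\<in>?I. ?l (a (k, l)) \<otimes>\<^bsub>?T\<^esub> ?r (b (l, i)))"
        unfolding prod.case
        by (rule P.T.finsum_cong') (use that acl bcl lcl rcl in \<open>auto intro!: lr(1)\<close>)
      show "?d (k, i) \<in> carrier ?T" using that tcl by (auto intro!: P.T.finsum_closed)
    qed
    have "(\<Oplus>\<^bsub>?T\<^esub>k\<in>?I. ?d (k, i) \<otimes>\<^bsub>?T\<^esub> ?d (k, j)) =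
      (\<Oplus>\<^bsub>?T\<^esub>k\<in>?I. (\<Oplus>\<^bsub>?T\<^esub>l\<in>?I. ?l (a (k, l)) \<otimes>\<^bsub>?T\<^esub> ?r (b (l, i))) \<otimes>\<^bsub>?T\<^esub> \<one>\<^bsub>?T\<^esub> \<otimes>\<^bsub>?T\<^esub>
         (\<Oplus>\<^bsub>?T\<^esub>m\<in>?I. ?l (a (k, m)) \<otimes>\<^bsub>?T\<^esub> ?r (b (m, j))))"
    proof (rule P.T.finsum_cong')
      fix k assume k: "k \<in> ?I"
      show "?d (k, i) \<otimes>\<^bsub>?T\<^esub> ?d (k, j) =
        (\<Oplus>\<^bsub>?T\<^esub>l\<in>?I. ?l (a (k, l)) \<otimes>\<^bsub>?T\<^esub> ?r (b (l, i))) \<otimes>\<^bsub>?T\<^esub> \<one>\<^bsub>?T\<^esub> \<otimes>\<^bsub>?T\<^esub>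
         (\<Oplus>\<^bsub>?T\<^esub>m\<in>?I. ?l (a (k, m)) \<otimes>\<^bsub>?T\<^esub> ?r (b (m, j)))"
        using d(2)[OF ij(1) k] unfolding d(1)[OF ij(1) k] d(1)[OF ij(2) k] by simp
    qed (use ij acl bcl lcl rcl in \<open>auto intro!: P.T.finsum_closed\<close>)
    also have "\<dots> = (\<Oplus>\<^bsub>?T\<^esub>l\<in>?I. ?r (b (l, i)) \<otimes>\<^bsub>?T\<^esub> \<one>\<^bsub>?T\<^esub> \<otimes>\<^bsub>?T\<^esub> ?r (b (l, j)))"
    proof (rule P.T.finsum_contract)
      fix l m assume lm: "l \<in> ?I" "m \<in> ?I"
      have "(\<Oplus>\<^bsub>?T\<^esub>k\<in>?I. ?l (a (k, l)) \<otimes>\<^bsub>?T\<^esub> ?l (a (k, m))) =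
          (\<Oplus>\<^bsub>?T\<^esub>k\<in>?I. ?l (a (k, l) \<otimes>\<^bsub>A\<^esub> a (k, m)))"
        by (rule P.T.finsum_cong') (use lm acl lcl in \<open>auto simp: P.tens_mult\<close>)
      also have "\<dots> = ?l (\<Oplus>\<^bsub>A\<^esub>k\<in>?I. a (k, l) \<otimes>\<^bsub>A\<^esub> a (k, m))"
        by (rule P.tens_finsum_l) (use lm acl in auto)
      also have "\<dots> = (if l = m then \<one>\<^bsub>?T\<^esub> else \<zero>\<^bsub>?T\<^esub>)"
        using a.b_relations lm zero P.tens_one unfolding orth_relations_def by simp
      finally show "(\<Oplus>\<^bsub>?T\<^esub>k\<in>?I. ?l (a (k, l)) \<otimes>\<^bsub>?T\<^esub> ?l (a (k, m))) =
        (if l = m then \<one>\<^bsub>?T\<^esub> else \<zero>\<^bsub>?T\<^esub>)" .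
    next
      fix k l m assume "k \<in> ?I" "l \<in> ?I" "m \<in> ?I"
      then show "?l (a (k, m)) \<otimes>\<^bsub>?T\<^esub> (?r (b (l, i)) \<otimes>\<^bsub>?T\<^esub> \<one>\<^bsub>?T\<^esub>) =
          ?r (b (l, i)) \<otimes>\<^bsub>?T\<^esub> \<one>\<^bsub>?T\<^esub> \<otimes>\<^bsub>?T\<^esub> ?l (a (k, m))"
        using ij acl bcl rcl by (simp add: P.tens_mult)
    qed (use ij acl bcl lcl rcl in auto)
    also have "\<dots> = (\<Oplus>\<^bsub>?T\<^esub>l\<in>?I. ?r (b (l, i) \<otimes>\<^bsub>B\<^esub> b (l, j)))"
      by (rule P.T.finsum_cong') (use ij bcl rcl in \<open>auto simp: P.tens_mult\<close>)
    also have "\<dots> = ?r (\<Oplus>\<^bsub>B\<^esub>l\<in>?I. b (l, i) \<otimes>\<^bsub>B\<^esub> b (l, j))"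
      by (rule P.tens_finsum_r) (use ij bcl in auto)
    also have "\<dots> = (if i = j then \<one>\<^bsub>?T\<^esub> else \<zero>\<^bsub>?T\<^esub>)"
      using b.b_relations ij zero P.tens_one unfolding orth_relations_def by simp
    finally show ?thesis .
  qed
  have dcl: "?d p \<in> carrier ?T" if "p \<in> ?I \<times> ?I" for p
    using that tcl by (auto intro!: P.T.finsum_closed)
  have half: "?d p \<otimes>\<^bsub>?T\<^esub> ?d q \<otimes>\<^bsub>?T\<^esub> ?d r = ?d r \<otimes>\<^bsub>?T\<^esub> ?d q \<otimes>\<^bsub>?T\<^esub> ?d p"
    if pqr: "p \<in> ?I \<times> ?I" "q \<in> ?I \<times> ?I" "r \<in> ?I \<times> ?I" and t: "t = Half_Liberated" for p q r
  proof -
    define s where "s = (\<lambda>p k. tens A B (a (fst p, k)) (b (k, snd p)))"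
    have scl: "s p k \<in> carrier ?T" if "p \<in> ?I \<times> ?I" "k \<in> ?I" for p k
      using that tcl unfolding s_def by auto
    have d: "?d p = finsum ?T (s p) ?I" for p by (simp add: s_def case_prod_beta)
    have base: "s p k \<otimes>\<^bsub>?T\<^esub> s q l \<otimes>\<^bsub>?T\<^esub> s r m = s r m \<otimes>\<^bsub>?T\<^esub> s q l \<otimes>\<^bsub>?T\<^esub> s p k"
      if k: "k \<in> ?I" "l \<in> ?I" "m \<in> ?I" for k l m
    proof -
      have "(fst p, k) \<in> ?I \<times> ?I" "(fst q, l) \<in> ?I \<times> ?I" "(fst r, m) \<in> ?I \<times> ?I"
        "(k, snd p) \<in> ?I \<times> ?I" "(l, snd q) \<in> ?I \<times> ?I" "(m, snd r) \<in> ?I \<times> ?I"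
        using pqr k by auto
      then show ?thesis
        using a.b_relations b.b_relations t unfolding s_def orth_relations_def
        by (simp add: P.tens_mult a.b_closed b.b_closed del: mem_Times_iff)
    qed
    have S: "s p \<in> ?I \<rightarrow> carrier ?T" "s q \<in> ?I \<rightarrow> carrier ?T" "s r \<in> ?I \<rightarrow> carrier ?T"
      using scl pqr by blast+
    have cl: "finsum ?T (s p) ?I \<in> carrier ?T" "finsum ?T (s q) ?I \<in> carrier ?T"
      using S by (auto intro: P.T.finsum_closed)
    note comm = P.T.finsum_mult_commute3[OF finite_atLeastAtMost]
    have 1: "finsum ?T (s p) ?I \<otimes>\<^bsub>?T\<^esub> s q l \<otimes>\<^bsub>?T\<^esub> s r m =
        s r m \<otimes>\<^bsub>?T\<^esub> s q l \<otimes>\<^bsub>?T\<^esub> finsum ?T (s p) ?I" if "l \<in> ?I" "m \<in> ?I" for l m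
      using that pqr by (intro comm(1)[OF S(1)] scl base)
    have 2: "finsum ?T (s p) ?I \<otimes>\<^bsub>?T\<^esub> finsum ?T (s q) ?I \<otimes>\<^bsub>?T\<^esub> s r m =
        s r m \<otimes>\<^bsub>?T\<^esub> finsum ?T (s q) ?I \<otimes>\<^bsub>?T\<^esub> finsum ?T (s p) ?I" if "m \<in> ?I" for m
      using that pqr by (intro comm(2)[OF S(2)] cl scl 1)
    show ?thesis
      unfolding d by (rule comm(1)[OF S(3) cl(2,1) 2[symmetric], symmetric])
  qed
  show ?thesis
  proof (intro orth_matrix.intro P.T.star_algebra_axioms orth_matrix_axioms.intro)
    fix p assume p: "p \<in> ?I \<times> ?I"
    show "?d p \<in> carrier ?T" using p by (rule dcl)
    obtain i j where ij: "p = (i, j)" "i \<in> ?I" "j \<in> ?I" using p by auto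
    have "star ?T (?d p) = (\<Oplus>\<^bsub>?T\<^esub>k\<in>?I. star ?T (tens A B (a (i, k)) (b (k, j))))"
      unfolding ij prod.case by (rule P.T.star_finsum) (use ij tcl in blast)
    also have "\<dots> = ?d p"
      unfolding ij prod.case
      by (rule P.T.finsum_cong') (use ij tcl acl bcl a.b_star b.b_star in \<open>auto simp: P.tens_star\<close>)
    finally show "star ?T (?d p) = ?d p" .
  next
    show "orth_relations t N ?T ?d"
      unfolding orth_relations_def by (intro conjI ballI impI row col half)
  qed
qed

section \<open>The comultiplication on generators\<close>

locale orth_group =
  fixes t :: orthogonal_kind and N :: nat
begin

abbreviation "G \<equiv> orth_alg t N"
abbreviation "u \<equiv> orth_gen t N"
abbreviation "\<Delta> \<equiv> orth_comult t N"

sublocale G: star_algebra G by (rule star_algebra_orth_alg)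

sublocale GG: star_algebra_pair G G
  by (intro star_algebra_pair.intro G.star_algebra_axioms)

lemma u_closed: "i \<in> {1..N} \<Longrightarrow> j \<in> {1..N} \<Longrightarrow> u i j \<in> carrier G"
  using orth_matrix.b_closed[OF orth_gen_matrix, of "(i, j)"] by simp

lemma u_star: "i \<in> {1..N} \<Longrightarrow> j \<in> {1..N} \<Longrightarrow> star G (u i j) = u i j"
  using orth_matrix.b_star[OF orth_gen_matrix, of "(i, j)"] by simp

lemma u_row:
  "i \<in> {1..N} \<Longrightarrow> j \<in> {1..N} \<Longrightarrow>
    (\<Oplus>\<^bsub>G\<^esub>k\<in>{1..N}. u i k \<otimes>\<^bsub>G\<^esub> u j k) = (if i = j then \<one>\<^bsub>G\<^esub> else \<zero>\<^bsub>G\<^esub>)"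
  using orth_matrix.b_relations[OF orth_gen_matrix] unfolding orth_relations_def by simp

lemma u_col:
  "i \<in> {1..N} \<Longrightarrow> j \<in> {1..N} \<Longrightarrow>
    (\<Oplus>\<^bsub>G\<^esub>k\<in>{1..N}. u k i \<otimes>\<^bsub>G\<^esub> u k j) = (if i = j then \<one>\<^bsub>G\<^esub> else \<zero>\<^bsub>G\<^esub>)"
  using orth_matrix.b_relations[OF orth_gen_matrix] unfolding orth_relations_def by simp

lemma comult:
  shows "\<Delta> \<in> star_hom G (tensor_alg G G)"
    and "i \<in> {1..N} \<Longrightarrow> j \<in> {1..N} \<Longrightarrow> \<Delta> (u i j) = (\<Oplus>\<^bsub>tensor_alg G G\<^esub>k\<in>{1..N}. tens G G (u i k) (u k j))"
proof -
  interpret D: orth_matrix t N "tensor_alg G G"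
    "\<lambda>(i, j). \<Oplus>\<^bsub>tensor_alg G G\<^esub>k\<in>{1..N}. tens G G (u i k) (u k j)"
    using orth_matrix_tensor[OF orth_gen_matrix orth_gen_matrix] by simp
  have eq: "\<Delta> = lin_ext (tensor_alg G G) D.word"
    unfolding orth_comult_def Let_def ..
  show "\<Delta> \<in> star_hom G (tensor_alg G G)" unfolding eq by (rule D.orth_hom)
  show "i \<in> {1..N} \<Longrightarrow> j \<in> {1..N} \<Longrightarrow> \<Delta> (u i j) = (\<Oplus>\<^bsub>tensor_alg G G\<^esub>k\<in>{1..N}. tens G G (u i k) (u k j))"
    unfolding eq using D.orth_hom(2)[of "(i, j)"] by simp
qed

end

text \<open>Slicing with a character (rather than with a linear functional) is multiplicative, because
  scalars are central.\<close>

lemma slice_star_hom: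
  assumes A: "star_algebra A" and B: "star_algebra B" and \<chi>: "\<chi> \<in> star_hom A complex_alg"
  shows "tensor_lift B (\<lambda>a b. \<chi> a \<odot>\<^bsub>B\<^esub> b) \<in> star_hom (tensor_alg A B) B"
    and "a \<in> carrier A \<Longrightarrow> b \<in> carrier B \<Longrightarrow>
      tensor_lift B (\<lambda>a b. \<chi> a \<odot>\<^bsub>B\<^esub> b) (tens A B a b) = \<chi> a \<odot>\<^bsub>B\<^esub> b"
proof -
  interpret P: star_algebra_pair A B using A B by (simp add: star_algebra_pair_def)
  note \<chi> = star_homD[OF \<chi>, unfolded complex_alg_def, simplified]
  note c = P.B.smult_closed P.B.smult_l_distr P.B.smult_r_distr P.B.smult_assoc P.B.smult_one
    P.B.smult_mult_l P.B.smult_mult_r P.B.star_smult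
  have swap: "x \<odot>\<^bsub>B\<^esub> (y \<odot>\<^bsub>B\<^esub> b) = y \<odot>\<^bsub>B\<^esub> (x \<odot>\<^bsub>B\<^esub> b)" if "b \<in> carrier B" for x y b
    using P.B.smult_assoc[OF that, of x y] P.B.smult_assoc[OF that, of y x] by (simp add: mult.commute)
  show "tensor_lift B (\<lambda>a b. \<chi> a \<odot>\<^bsub>B\<^esub> b) \<in> star_hom (tensor_alg A B) B"
    by (rule P.tensor_lift_star_hom(1)[OF B]) (auto simp: \<chi> c intro: swap)
  show "a \<in> carrier A \<Longrightarrow> b \<in> carrier B \<Longrightarrow>
      tensor_lift B (\<lambda>a b. \<chi> a \<odot>\<^bsub>B\<^esub> b) (tens A B a b) = \<chi> a \<odot>\<^bsub>B\<^esub> b"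
    by (rule P.tensor_lift_star_hom(2)[OF B]) (auto simp: \<chi> c intro: swap)
qed

section \<open>Scalar and two-by-two matrix representations\<close>

lemma star_algebra_complex: "star_algebra complex_alg"
proof -
  have "ring complex_alg"
    by (intro ringI abelian_groupI monoidI)
      (auto simp: complex_alg_def algebra_simps intro: exI[of _ "- x" for x])
  then show ?thesis
    by (rule star_algebra.intro, unfold_locales) (auto simp: complex_alg_def algebra_simps)
qed

lemma finsum_complex: "finite I \<Longrightarrow> finsum complex_alg f I = sum f I"
proof (induction I rule: finite_induct)
  interpret C: star_algebra complex_alg by (rule star_algebra_complex)
  case empty show ?case by (simp, simp add: complex_alg_def)
next
  interpret C: star_algebra complex_alg by (rule star_algebra_complex)
  case (insert i I)
  have "carrier complex_alg = UNIV" by (simp add: complex_alg_def)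
  then have "finsum complex_alg f (insert i I) = f i \<oplus>\<^bsub>complex_alg\<^esub> finsum complex_alg f I"
    using insert by simp
  then show ?case using insert by (simp add: complex_alg_def)
qed

text \<open>Matrix entries are listed row by row.\<close>

definition mat2_alg :: "(complex \<times> complex \<times> complex \<times> complex) star_alg" where
  "mat2_alg =
    \<lparr>carrier = UNIV,
     mult = (\<lambda>(a, b, c, d) (a', b', c', d').
       (a * a' + b * c', a * b' + b * d', c * a' + d * c', c * b' + d * d')),
     one = (1, 0, 0, 1), zero = (0, 0, 0, 0),
     add = (\<lambda>(a, b, c, d) (a', b', c', d'). (a + a', b + b', c + c', d + d')),
     smult = (\<lambda>x (a, b, c, d). (x * a, x * b, x * c, x * d)),
     star = (\<lambda>(a, b, c, d). (cnj a, cnj c, cnj b, cnj d))\<rparr>"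

lemma star_algebra_mat2: "star_algebra mat2_alg"
proof -
  have "abelian_group mat2_alg"
  proof (rule abelian_groupI)
    fix x assume "x \<in> carrier mat2_alg"
    show "\<exists>y\<in>carrier mat2_alg. y \<oplus>\<^bsub>mat2_alg\<^esub> x = \<zero>\<^bsub>mat2_alg\<^esub>"
      by (rule bexI[of _ "(-1) \<odot>\<^bsub>mat2_alg\<^esub> x"]) (auto simp: mat2_alg_def split: prod.splits)
  qed (auto simp: mat2_alg_def algebra_simps)
  then have "ring mat2_alg"
    by (intro ringI monoidI) (auto simp: mat2_alg_def algebra_simps)
  then show ?thesis
    by (rule star_algebra.intro, unfold_locales) (auto simp: mat2_alg_def algebra_simps)
qed

definition antidiag :: "complex \<Rightarrow> complex \<Rightarrow> complex \<times> complex \<times> complex \<times> complex" where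
  "antidiag b c = (0, b, c, 0)"

definition diag :: "complex \<Rightarrow> complex \<Rightarrow> complex \<times> complex \<times> complex \<times> complex" where
  "diag a d = (a, 0, 0, d)"

lemma mat2_simps:
  "antidiag b c \<otimes>\<^bsub>mat2_alg\<^esub> antidiag b' c' = diag (b * c') (c * b')"
  "diag a d \<otimes>\<^bsub>mat2_alg\<^esub> antidiag b c = antidiag (a * b) (d * c)"
  "antidiag b c \<oplus>\<^bsub>mat2_alg\<^esub> antidiag b' c' = antidiag (b + b') (c + c')"
  "diag a d \<oplus>\<^bsub>mat2_alg\<^esub> diag a' d' = diag (a + a') (d + d')"
  "x \<odot>\<^bsub>mat2_alg\<^esub> antidiag b c = antidiag (x * b) (x * c)"
  "star mat2_alg (antidiag b c) = antidiag (cnj c) (cnj b)"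
  "\<one>\<^bsub>mat2_alg\<^esub> = diag 1 1" "\<zero>\<^bsub>mat2_alg\<^esub> = diag 0 0" "\<zero>\<^bsub>mat2_alg\<^esub> = antidiag 0 0"
  "carrier mat2_alg = UNIV"
  by (simp_all add: mat2_alg_def antidiag_def diag_def)

lemma finsum_mat2:
  assumes "finite I"
  shows "(\<Oplus>\<^bsub>mat2_alg\<^esub>i\<in>I. antidiag (f i) (g i)) = antidiag (sum f I) (sum g I)"
    and "(\<Oplus>\<^bsub>mat2_alg\<^esub>i\<in>I. diag (f i) (g i)) = diag (sum f I) (sum g I)"
proof -
  interpret M: star_algebra mat2_alg by (rule star_algebra_mat2)
  show "(\<Oplus>\<^bsub>mat2_alg\<^esub>i\<in>I. antidiag (f i) (g i)) = antidiag (sum f I) (sum g I)"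
    using assms by (induction I rule: finite_induct) (simp_all add: mat2_simps(3,9,10))
  show "(\<Oplus>\<^bsub>mat2_alg\<^esub>i\<in>I. diag (f i) (g i)) = diag (sum f I) (sum g I)"
    using assms by (induction I rule: finite_induct) (simp_all add: mat2_simps(4,8,10))
qed

text \<open>The matrix \<open>\<alpha> 1 + \<beta> w w\<^sup>t\<close>. It covers the reflection that moves the first unit vector to \<open>c\<close>,
  the rotations by a phase in the orthogonal complement of \<open>c\<close>, and the identity.\<close>

definition rank_one_update :: "complex \<Rightarrow> complex \<Rightarrow> (nat \<Rightarrow> real) \<Rightarrow> nat \<times> nat \<Rightarrow> complex" where
  "rank_one_update \<alpha> \<beta> w = (\<lambda>(i, j). (if i = j then \<alpha> else 0) + \<beta> * complex_of_real (w i * w j))"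

lemma rank_one_update_sym: "rank_one_update \<alpha> \<beta> w (i, j) = rank_one_update \<alpha> \<beta> w (j, i)"
  by (auto simp: rank_one_update_def)

lemma sum_rank_one_update_mult:
  assumes "finite I" "i \<in> I" "j \<in> I" "(\<Sum>k\<in>I. (w k)\<^sup>2) = n"
  shows "(\<Sum>k\<in>I. rank_one_update \<alpha> \<beta> w (i, k) * rank_one_update \<gamma> \<delta> w (j, k)) =
    (if i = j then \<alpha> * \<gamma> else 0) +
    (\<alpha> * \<delta> + \<beta> * \<gamma> + \<beta> * \<delta> * complex_of_real n) * complex_of_real (w i * w j)"
proof -
  have "rank_one_update \<alpha> \<beta> w (i, k) * rank_one_update \<gamma> \<delta> w (j, k) =
      (if i = k then (if j = k then \<alpha> * \<gamma> else 0) + \<alpha> * \<delta> * complex_of_real (w j * w k) else 0) +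
      (if j = k then \<beta> * \<gamma> * complex_of_real (w i * w k) else 0) +
      \<beta> * \<delta> * complex_of_real (w i * w j) * complex_of_real ((w k)\<^sup>2)" for k
    by (auto simp: rank_one_update_def algebra_simps power2_eq_square)
  then show ?thesis
    using assms(1-3) unfolding assms(4)[symmetric]
    by (simp add: sum.distrib sum.delta' sum_distrib_left[symmetric] algebra_simps)
qed

lemma cnj_rank_one_update: "cnj (rank_one_update \<alpha> \<beta> w p) = rank_one_update (cnj \<alpha>) (cnj \<beta>) w p"
  by (cases p) (auto simp: rank_one_update_def)

lemma orth_matrix_complex:
  assumes real: "\<And>p. cnj (g p) = g p"
    and "\<And>i j. i \<in> {1..N} \<Longrightarrow> j \<in> {1..N} \<Longrightarrow> (\<Sum>k=1..N. g (i, k) * g (j, k)) = (if i = j then 1 else 0)"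
    and "\<And>i j. i \<in> {1..N} \<Longrightarrow> j \<in> {1..N} \<Longrightarrow> (\<Sum>k=1..N. g (k, i) * g (k, j)) = (if i = j then 1 else 0)"
  shows "orth_matrix t N complex_alg g"
proof (intro orth_matrix.intro star_algebra_complex orth_matrix_axioms.intro)
  show "orth_relations t N complex_alg g"
    unfolding orth_relations_def using assms(2,3)
    by (simp add: finsum_complex, simp add: complex_alg_def mult_ac)
qed (simp_all add: complex_alg_def real)

text \<open>A unitary matrix \<open>v\<close> turns into an orthogonal matrix of self-adjoint elements when each entry
  is placed, with its conjugate, on the antidiagonal. The product of three antidiagonal matrices
  has the entry \<open>p q\<^sup>* r\<close> and its conjugate, which are symmetric in \<open>p\<close> and \<open>r\<close>: the entries
  half-commute, and the two kinds of quantum group need not be distinguished.\<close>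

lemma orth_matrix_antidiag:
  assumes "\<And>i j. i \<in> {1..N} \<Longrightarrow> j \<in> {1..N} \<Longrightarrow>
      (\<Sum>k=1..N. v (i, k) * cnj (v (j, k))) = (if i = j then 1 else 0)"
    and "\<And>i j. i \<in> {1..N} \<Longrightarrow> j \<in> {1..N} \<Longrightarrow>
      (\<Sum>k=1..N. v (k, i) * cnj (v (k, j))) = (if i = j then 1 else 0)"
  shows "orth_matrix t N mat2_alg (\<lambda>p. antidiag (v p) (cnj (v p)))"
proof (intro orth_matrix.intro star_algebra_mat2 orth_matrix_axioms.intro)
  have conj: "(\<Sum>k=1..N. cnj (f k) * g k) = cnj (\<Sum>k=1..N. f k * cnj (g k))" for f g by simp
  show "orth_relations t N mat2_alg (\<lambda>p. antidiag (v p) (cnj (v p)))"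
    unfolding orth_relations_def using assms
    by (auto simp: mat2_simps(1,2,7) finsum_mat2 conj mult_ac simp del: cnj_sum,
        auto simp: mat2_simps(8))
qed (simp_all add: mat2_simps)

section \<open>The sphere and its quotient realisations\<close>

(* Keeps the ranges {1..N} of the row and column indices in one normal form. *)
declare One_nat_def [simp del]

context orth_group
begin

abbreviation "S \<equiv> sphere_alg t N"

lemma sphere_gens_closed: "N \<ge> 1 \<Longrightarrow> {u 1 i | i. i \<in> {1..N}} \<subseteq> carrier G"
  using u_closed by auto

lemma star_algebra_sphere: "N \<ge> 1 \<Longrightarrow> star_algebra S"
  unfolding sphere_alg_def sphere_set_def
  by (intro G.star_subalgebra_star_algebra G.star_generated_star_subalgebra sphere_gens_closed)

lemma sphere_subset: "N \<ge> 1 \<Longrightarrow> carrier S \<subseteq> carrier G"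
  unfolding sphere_alg_def sphere_set_def
  using G.star_generated_star_subalgebra[OF sphere_gens_closed] by (simp add: star_subalgebra_def)

lemma sphere_gen: "i \<in> {1..N} \<Longrightarrow> u 1 i \<in> carrier S"
  unfolding sphere_alg_def sphere_set_def
  using G.star_generated_incl[of "{u 1 i | i. i \<in> {1..N}}"] by auto

lemma sphere_incl: "N \<ge> 1 \<Longrightarrow> id \<in> star_hom S G"
  using sphere_subset by (intro star_homI) (auto simp: sphere_alg_def)

lemma star_hom_restrict_sphere: "N \<ge> 1 \<Longrightarrow> f \<in> star_hom G B \<Longrightarrow> f \<in> star_hom S B"
  using star_hom_comp[OF sphere_incl, of f B] by simp

lemma star_hom_sphere_eqI:
  assumes "N \<ge> 1" "f \<in> star_hom S B" "g \<in> star_hom S B"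
    and "\<And>i. i \<in> {1..N} \<Longrightarrow> f (u 1 i) = g (u 1 i)" and "x \<in> carrier S"
  shows "f x = g x"
  using star_hom_eq_on_star_generated[OF G.star_algebra_axioms sphere_gens_closed[OF assms(1)],
      of f B g x] assms(2-)
  unfolding sphere_alg_def sphere_set_def by auto

lemma character:
  assumes "\<And>p. cnj (g p) = g p"
    and "\<And>i j. i \<in> {1..N} \<Longrightarrow> j \<in> {1..N} \<Longrightarrow> (\<Sum>k=1..N. g (i, k) * g (j, k)) = (if i = j then 1 else 0)"
    and "\<And>i j. i \<in> {1..N} \<Longrightarrow> j \<in> {1..N} \<Longrightarrow> (\<Sum>k=1..N. g (k, i) * g (k, j)) = (if i = j then 1 else 0)"
  obtains \<chi> where "\<chi> \<in> star_hom G complex_alg"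
    "\<And>i j. i \<in> {1..N} \<Longrightarrow> j \<in> {1..N} \<Longrightarrow> \<chi> (u i j) = g (i, j)"
proof -
  interpret orth_matrix t N complex_alg g by (rule orth_matrix_complex[OF assms])
  show thesis using that[OF orth_hom(1)] orth_hom(2)[of "(i, j)" for i j] by simp
qed

text \<open>The counit is the character of the identity matrix; the counit law holds on generators,
  hence everywhere.\<close>

lemma counit:
  obtains \<epsilon> where "\<epsilon> \<in> star_hom G complex_alg"
    "\<And>i j. i \<in> {1..N} \<Longrightarrow> j \<in> {1..N} \<Longrightarrow> \<epsilon> (u i j) = (if i = j then 1 else 0)"
    "\<And>x. x \<in> carrier G \<Longrightarrow> tensor_lift G (\<lambda>a b. \<epsilon> a \<odot>\<^bsub>G\<^esub> b) (\<Delta> x) = x"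
proof -
  obtain \<epsilon> where \<epsilon>: "\<epsilon> \<in> star_hom G complex_alg"
    and \<epsilon>u: "\<And>i j. i \<in> {1..N} \<Longrightarrow> j \<in> {1..N} \<Longrightarrow> \<epsilon> (u i j) = rank_one_update 1 0 (\<lambda>_. 0) (i, j)"
    by (rule character[of "rank_one_update 1 0 (\<lambda>_. 0)"])
      (auto simp: cnj_rank_one_update sum_rank_one_update_mult[where n = 0] rank_one_update_sym)
  have \<epsilon>u': "\<epsilon> (u i j) = (if i = j then 1 else 0)" if "i \<in> {1..N}" "j \<in> {1..N}" for i j
    using \<epsilon>u[OF that] by (simp add: rank_one_update_def)
  let ?\<Lambda> = "tensor_lift G (\<lambda>a b. \<epsilon> a \<odot>\<^bsub>G\<^esub> b)"
  note \<Lambda> = slice_star_hom[OF G.star_algebra_axioms G.star_algebra_axioms \<epsilon>]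
  have "?\<Lambda> (\<Delta> x) = x" if "x \<in> carrier G" for x
  proof (rule star_hom_orth_alg_eqI[OF star_hom_comp[OF comult(1) \<Lambda>(1)], of id, unfolded id_def])
    show "(\<lambda>x. x) \<in> star_hom G G" using star_hom_id[of G] by (simp add: id_def)
    fix i j assume ij: "i \<in> {1..N}" "j \<in> {1..N}"
    have cl: "(\<lambda>k. tens G G (u i k) (u k j)) \<in> {1..N} \<rightarrow> carrier (tensor_alg G G)"
      using ij u_closed GG.tens_closed by blast
    have "?\<Lambda> (\<Delta> (u i j)) = (\<Oplus>\<^bsub>G\<^esub>k\<in>{1..N}. ?\<Lambda> (tens G G (u i k) (u k j)))"
      unfolding comult(2)[OF ij]
      by (rule star_hom_finsum[OF GG.T.star_algebra_axioms G.star_algebra_axioms \<Lambda>(1) cl])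
    also have "\<dots> = (\<Oplus>\<^bsub>G\<^esub>k\<in>{1..N}. if i = k then u k j else \<zero>\<^bsub>G\<^esub>)"
      by (rule G.finsum_cong')
        (use ij u_closed in \<open>auto simp: \<Lambda>(2) \<epsilon>u' G.smult_one G.smult_zero_l\<close>)
    also have "\<dots> = u i j" by (rule G.add.finprod_singleton) (use ij u_closed in auto)
    finally show "?\<Lambda> (\<Delta> (u i j)) = u i j" .
  qed (rule that)
  then show thesis using that \<epsilon> \<epsilon>u' by blast
qed

text \<open>A real unit vector is the first row of an orthogonal matrix, namely of the reflection
  exchanging it with the first unit vector. Hence every choice of coordinates of a real unit
  vector for \<open>u\<^sub>1\<^sub>1, \<dots>, u\<^sub>1\<^sub>N\<close> extends to a character of \<open>\<O>(G)\<close>.\<close>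

lemma reflection_character:
  fixes c :: "nat \<Rightarrow> real"
  assumes N: "N \<ge> 1" and c: "(\<Sum>k=1..N. (c k)\<^sup>2) = 1"
  obtains \<chi> where "\<chi> \<in> star_hom G complex_alg" "\<And>j. j \<in> {1..N} \<Longrightarrow> \<chi> (u 1 j) = of_real (c j)"
proof -
  define w where "w k = c k - (if k = 1 then 1 else 0)" for k
  \<comment> \<open>If \<open>c\<close> is itself the first unit vector, division by zero makes \<open>\<beta>\<close> vanish and the matrix is
    the identity, as it should be.\<close>
  define \<beta> :: complex where "\<beta> = - of_real (1 / (1 - c 1))"
  let ?g = "rank_one_update 1 \<beta> w"
  have "(w k)\<^sup>2 = (c k)\<^sup>2 + (if k = 1 then 1 - 2 * c 1 else 0)" for k
    by (auto simp: w_def power2_eq_square algebra_simps)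
  then have w: "(\<Sum>k=1..N. (w k)\<^sup>2) = 2 * (1 - c 1)"
    using N c by (simp add: sum.distrib)
  have "\<beta> = 0 \<or> \<beta> * complex_of_real (1 - c 1) = -1"
  proof (cases "c 1 = 1")
    case False
    then have "complex_of_real (1 / (1 - c 1)) * complex_of_real (1 - c 1) = 1"
      unfolding of_real_mult[symmetric] by simp
    then show ?thesis unfolding \<beta>_def by (simp del: of_real_diff of_real_divide)
  qed (simp add: \<beta>_def)
  then have "\<beta> + \<beta> + 2 * \<beta> * (\<beta> * complex_of_real (1 - c 1)) = 0" by auto
  then have "\<beta> + \<beta> + \<beta> * \<beta> * complex_of_real (2 * (1 - c 1)) = 0"
    by (simp add: algebra_simps)
  then have row: "(\<Sum>k=1..N. ?g (i, k) * ?g (j, k)) = (if i = j then 1 else 0)"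
    if "i \<in> {1..N}" "j \<in> {1..N}" for i j
    using sum_rank_one_update_mult[OF finite_atLeastAtMost that w] by simp
  then have col: "(\<Sum>k=1..N. ?g (k, i) * ?g (k, j)) = (if i = j then 1 else 0)"
    if "i \<in> {1..N}" "j \<in> {1..N}" for i j
    using that by (simp only: rank_one_update_sym[where j = i] rank_one_update_sym[where j = j])
  have real: "cnj (?g p) = ?g p" for p by (simp add: cnj_rank_one_update \<beta>_def)
  obtain \<chi> where \<chi>: "\<chi> \<in> star_hom G complex_alg"
    "\<And>i j. i \<in> {1..N} \<Longrightarrow> j \<in> {1..N} \<Longrightarrow> \<chi> (u i j) = ?g (i, j)"
    using character[of ?g, OF real row col] by blast
  have "?g (1, j) = of_real (c j)" if j: "j \<in> {1..N}" for j
  proof (cases "c 1 = 1")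
    case True
    have "(\<Sum>k\<in>{1..N} - {1}. (c k)\<^sup>2) = 0"
      using c N True sum.remove[of "{1..N}" 1 "\<lambda>k. (c k)\<^sup>2"] by simp
    then have "c j = (if j = 1 then 1 else 0)"
      using j True by (auto simp: sum_nonneg_eq_0_iff)
    then show ?thesis using True by (simp add: rank_one_update_def \<beta>_def)
  next
    case False
    then have "?g (1, j) = (if 1 = j then 1 else 0) + of_real (w j)"
      by (simp add: rank_one_update_def \<beta>_def w_def divide_simps) (simp add: algebra_simps)
    then show ?thesis by (simp add: w_def)
  qed
  with \<chi> N show thesis by (intro that) auto
qed

text \<open>The matrix \<open>z 1 + (1 - z) c c\<^sup>t\<close> multiplies the complement of \<open>c\<close> by the phase \<open>z\<close> and fixes
  \<open>c\<close>. The second property makes the representation blind to \<open>z\<close> on the elements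
  \<open>\<Sum>\<^sub>k c\<^sub>k u\<^sub>k\<^sub>i\<close>.\<close>

lemma twisted_rotation_rep:
  fixes c :: "nat \<Rightarrow> real"
  assumes c: "(\<Sum>k=1..N. (c k)\<^sup>2) = 1" and z: "z * cnj z = 1"
  obtains \<pi> where "\<pi> \<in> star_hom G mat2_alg"
    "\<forall>i\<in>{1..N}. \<forall>j\<in>{1..N}. \<pi> (u i j) =
      antidiag (rank_one_update z (1 - z) c (i, j)) (cnj (rank_one_update z (1 - z) c (i, j)))"
proof -
  let ?v = "rank_one_update z (1 - z) c"
  have "z * (1 - cnj z) + (1 - z) * cnj z + (1 - z) * (1 - cnj z) = 0"
    using z by (simp add: algebra_simps)
  then have row: "(\<Sum>k=1..N. ?v (i, k) * cnj (?v (j, k))) = (if i = j then 1 else 0)"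
    if "i \<in> {1..N}" "j \<in> {1..N}" for i j
    using z sum_rank_one_update_mult[OF finite_atLeastAtMost that c]
    by (simp add: cnj_rank_one_update)
  then have col: "(\<Sum>k=1..N. ?v (k, i) * cnj (?v (k, j))) = (if i = j then 1 else 0)"
    if "i \<in> {1..N}" "j \<in> {1..N}" for i j
    using that by (simp only: rank_one_update_sym[where j = i] rank_one_update_sym[where j = j])
  interpret orth_matrix t N mat2_alg "\<lambda>p. antidiag (?v p) (cnj (?v p))"
    by (rule orth_matrix_antidiag[OF row col])
  show thesis using that[OF orth_hom(1)] orth_hom(2)[of "(i, j)" for i j] by simp
qed

text \<open>Under \<open>(\<theta> \<otimes> id)\<Delta>\<close> the element acquires the coefficients \<open>\<Sum>\<^sub>k \<theta>(u\<^sub>k\<^sub>l) \<theta>(u\<^sub>k\<^sub>m) = \<delta>\<^sub>l\<^sub>m\<close>, since \<open>y\<close>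
  contributes only a unit in the first leg. So a quotient contains more than a subalgebra
  generated by some \<open>y\<close> would: it is also stable under \<open>y \<mapsto> \<Sum>\<^sub>k u\<^sub>k\<^sub>i y u\<^sub>k\<^sub>j\<close>.\<close>

lemma quotient_coideal_sandwich:
  assumes K: "star_algebra K" and \<theta>: "\<theta> \<in> star_hom G K"
    and y: "y \<in> quotient_coideal G \<Delta> K \<theta>" and ij: "i \<in> {1..N}" "j \<in> {1..N}"
  shows "(\<Oplus>\<^bsub>G\<^esub>k\<in>{1..N}. u k i \<otimes>\<^bsub>G\<^esub> y \<otimes>\<^bsub>G\<^esub> u k j) \<in> quotient_coideal G \<Delta> K \<theta>"
proof -
  interpret K: star_algebra K by fact
  interpret KG: star_algebra_pair K G
    by (intro star_algebra_pair.intro K G.star_algebra_axioms)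
  let ?T = "tensor_alg K G" and ?I = "{1..N}"
  note tm = tensor_map_star_hom[OF G.star_algebra_axioms G.star_algebra_axioms K G.star_algebra_axioms
      \<theta> star_hom_id]
  define \<Psi> where "\<Psi> = (\<lambda>x. tensor_map K G \<theta> id (\<Delta> x))"
  have \<Psi>: "\<Psi> \<in> star_hom G ?T" using star_hom_comp[OF comult(1) tm(1)] by (simp add: \<Psi>_def)
  note \<Psi>D = star_homD[OF \<Psi>]
  note \<theta>D = star_homD[OF \<theta>]
  have yG: "y \<in> carrier G" and \<Psi>y: "\<Psi> y = tens K G \<one>\<^bsub>K\<^esub> y"
    using y by (auto simp: quotient_coideal_def \<Psi>_def)
  let ?l = "\<lambda>x. tens K G x \<one>\<^bsub>G\<^esub>" and ?r = "\<lambda>x. tens K G \<one>\<^bsub>K\<^esub> x"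
  have lcl: "?l x \<in> carrier ?T" if "x \<in> carrier K" for x using that KG.tens_closed by simp
  have rcl: "?r x \<in> carrier ?T" if "x \<in> carrier G" for x using that KG.tens_closed by simp
  have \<theta>u: "\<theta> (u k l) \<in> carrier K" if "k \<in> ?I" "l \<in> ?I" for k l
    using that u_closed \<theta>D(1) by blast
  have \<Psi>u: "\<Psi> (u k i) = (\<Oplus>\<^bsub>?T\<^esub>l\<in>?I. ?l (\<theta> (u k l)) \<otimes>\<^bsub>?T\<^esub> ?r (u l i))"
    if "k \<in> ?I" "i \<in> ?I" for k i
  proof -
    have "(\<lambda>l. tens G G (u k l) (u l i)) \<in> ?I \<rightarrow> carrier (tensor_alg G G)"
      using that u_closed GG.tens_closed by blast
    then have "\<Psi> (u k i) = (\<Oplus>\<^bsub>?T\<^esub>l\<in>?I. tensor_map K G \<theta> id (tens G G (u k l) (u l i)))"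
      unfolding \<Psi>_def comult(2)[OF that]
      by (rule star_hom_finsum[OF GG.T.star_algebra_axioms KG.T.star_algebra_axioms tm(1)])
    also have "\<dots> = (\<Oplus>\<^bsub>?T\<^esub>l\<in>?I. ?l (\<theta> (u k l)) \<otimes>\<^bsub>?T\<^esub> ?r (u l i))"
      by (rule KG.T.finsum_cong')
        (use that u_closed \<theta>u lcl rcl in \<open>auto simp: tm(2) KG.tens_mult\<close>)
    finally show ?thesis .
  qed
  let ?E = "\<Oplus>\<^bsub>G\<^esub>k\<in>?I. u k i \<otimes>\<^bsub>G\<^esub> y \<otimes>\<^bsub>G\<^esub> u k j"
  have Ecl: "(\<lambda>k. u k i \<otimes>\<^bsub>G\<^esub> y \<otimes>\<^bsub>G\<^esub> u k j) \<in> ?I \<rightarrow> carrier G"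
    using ij yG u_closed by auto
  have "\<Psi> ?E = (\<Oplus>\<^bsub>?T\<^esub>k\<in>?I. \<Psi> (u k i \<otimes>\<^bsub>G\<^esub> y \<otimes>\<^bsub>G\<^esub> u k j))"
    by (rule star_hom_finsum[OF G.star_algebra_axioms KG.T.star_algebra_axioms \<Psi> Ecl])
  also have "\<dots> = (\<Oplus>\<^bsub>?T\<^esub>k\<in>?I. (\<Oplus>\<^bsub>?T\<^esub>l\<in>?I. ?l (\<theta> (u k l)) \<otimes>\<^bsub>?T\<^esub> ?r (u l i)) \<otimes>\<^bsub>?T\<^esub> ?r y \<otimes>\<^bsub>?T\<^esub>
      (\<Oplus>\<^bsub>?T\<^esub>m\<in>?I. ?l (\<theta> (u k m)) \<otimes>\<^bsub>?T\<^esub> ?r (u m j)))"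
  proof (rule KG.T.finsum_cong')
    fix k assume k: "k \<in> ?I"
    show "\<Psi> (u k i \<otimes>\<^bsub>G\<^esub> y \<otimes>\<^bsub>G\<^esub> u k j) =
      (\<Oplus>\<^bsub>?T\<^esub>l\<in>?I. ?l (\<theta> (u k l)) \<otimes>\<^bsub>?T\<^esub> ?r (u l i)) \<otimes>\<^bsub>?T\<^esub> ?r y \<otimes>\<^bsub>?T\<^esub>
      (\<Oplus>\<^bsub>?T\<^esub>m\<in>?I. ?l (\<theta> (u k m)) \<otimes>\<^bsub>?T\<^esub> ?r (u m j))"
      using k ij yG u_closed by (simp add: \<Psi>D(3) \<Psi>u[symmetric] \<Psi>y)
  qed (use ij yG u_closed \<theta>u lcl rcl in \<open>auto intro!: KG.T.finsum_closed\<close>)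
  also have "\<dots> = (\<Oplus>\<^bsub>?T\<^esub>l\<in>?I. ?r (u l i) \<otimes>\<^bsub>?T\<^esub> ?r y \<otimes>\<^bsub>?T\<^esub> ?r (u l j))"
  proof (rule KG.T.finsum_contract)
    fix l m assume lm: "l \<in> ?I" "m \<in> ?I"
    have "(\<Oplus>\<^bsub>?T\<^esub>k\<in>?I. ?l (\<theta> (u k l)) \<otimes>\<^bsub>?T\<^esub> ?l (\<theta> (u k m))) =
        (\<Oplus>\<^bsub>?T\<^esub>k\<in>?I. ?l (\<theta> (u k l \<otimes>\<^bsub>G\<^esub> u k m)))"
      by (rule KG.T.finsum_cong') (use lm u_closed \<theta>u \<theta>D(1) lcl in \<open>auto simp: KG.tens_mult \<theta>D(3)\<close>)
    also have "\<dots> = ?l (\<Oplus>\<^bsub>K\<^esub>k\<in>?I. \<theta> (u k l \<otimes>\<^bsub>G\<^esub> u k m))"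
      by (rule KG.tens_finsum_l) (use lm u_closed \<theta>D(1) in auto)
    also have "(\<Oplus>\<^bsub>K\<^esub>k\<in>?I. \<theta> (u k l \<otimes>\<^bsub>G\<^esub> u k m)) = \<theta> (\<Oplus>\<^bsub>G\<^esub>k\<in>?I. u k l \<otimes>\<^bsub>G\<^esub> u k m)"
      by (rule star_hom_finsum[OF G.star_algebra_axioms K \<theta>, symmetric]) (use lm u_closed in auto)
    also have "\<dots> = (if l = m then \<one>\<^bsub>K\<^esub> else \<zero>\<^bsub>K\<^esub>)"
      unfolding u_col[OF lm] using \<theta>D(4) star_hom_zero[OF G.star_algebra_axioms K \<theta>] by simp
    also have "?l (if l = m then \<one>\<^bsub>K\<^esub> else \<zero>\<^bsub>K\<^esub>) = (if l = m then \<one>\<^bsub>?T\<^esub> else \<zero>\<^bsub>?T\<^esub>)"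
      using KG.tens_one KG.tens_finsum_l[of "{}" undefined "\<one>\<^bsub>G\<^esub>"] by auto
    finally show "(\<Oplus>\<^bsub>?T\<^esub>k\<in>?I. ?l (\<theta> (u k l)) \<otimes>\<^bsub>?T\<^esub> ?l (\<theta> (u k m))) =
      (if l = m then \<one>\<^bsub>?T\<^esub> else \<zero>\<^bsub>?T\<^esub>)" .
  next
    fix k l m assume "k \<in> ?I" "l \<in> ?I" "m \<in> ?I"
    then show "?l (\<theta> (u k m)) \<otimes>\<^bsub>?T\<^esub> (?r (u l i) \<otimes>\<^bsub>?T\<^esub> ?r y) =
        ?r (u l i) \<otimes>\<^bsub>?T\<^esub> ?r y \<otimes>\<^bsub>?T\<^esub> ?l (\<theta> (u k m))"
      using ij u_closed \<theta>u yG by (simp add: KG.tens_mult)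
  qed (use ij u_closed \<theta>u yG lcl rcl in auto)
  also have "\<dots> = (\<Oplus>\<^bsub>?T\<^esub>l\<in>?I. ?r (u l i \<otimes>\<^bsub>G\<^esub> y \<otimes>\<^bsub>G\<^esub> u l j))"
    by (rule KG.T.finsum_cong') (use ij u_closed yG rcl in \<open>auto simp: KG.tens_mult\<close>)
  also have "\<dots> = ?r ?E" by (rule KG.tens_finsum_r) (use Ecl in auto)
  finally show ?thesis using Ecl by (auto simp: quotient_coideal_def \<Psi>_def intro: G.finsum_closed)
qed

text \<open>The first leg of the identity between \<open>\<Delta> \<circ> \<phi>\<close> and the coaction is evaluated with the counit.
  This applies the character \<open>\<epsilon> \<circ> \<phi>\<close> to the first leg of the coaction, which lies in the sphere
  algebra. The values \<open>c\<^sub>k\<close> of that character on the generators form a real unit vector, so it is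
  the restriction of a character \<open>\<chi>\<close> of \<open>\<O>(G)\<close>. Thus the coaction may be replaced by \<open>\<Delta>\<close>, whatever
  preimage under \<open>\<O>(S) \<otimes> \<O>(G) \<rightarrow> \<O>(G) \<otimes> \<O>(G)\<close> it is.\<close>

lemma coidalgebra_iso_gen:
  assumes N: "N \<ge> 1" and iso: "sphere_coidalgebra_iso t N Q \<phi>" and Q: "Q \<subseteq> carrier G"
  obtains c :: "nat \<Rightarrow> real"
    where "(\<Sum>k=1..N. (c k)\<^sup>2) = 1"
      "\<And>i. i \<in> {1..N} \<Longrightarrow> \<phi> (u 1 i) = (\<Oplus>\<^bsub>G\<^esub>k\<in>{1..N}. of_real (c k) \<odot>\<^bsub>G\<^esub> u k i)"
proof -
  interpret S: star_algebra S by (rule star_algebra_sphere[OF N])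
  interpret SG: star_algebra_pair S G
    by (intro star_algebra_pair.intro S.star_algebra_axioms G.star_algebra_axioms)
  interpret C: star_algebra complex_alg by (rule star_algebra_complex)
  have \<phi>Q: "\<phi> \<in> star_hom S (G\<lparr>carrier := Q\<rparr>)"
    and equiv: "\<And>x. x \<in> carrier S \<Longrightarrow> \<Delta> (\<phi> x) = tensor_map G G \<phi> id (sphere_coaction t N x)"
    using iso by (auto simp: sphere_coidalgebra_iso_def Let_def)
  have \<phi>: "\<phi> \<in> star_hom S G"
    using star_homD[OF \<phi>Q] Q by (intro star_homI) auto
  obtain \<epsilon> where \<epsilon>: "\<epsilon> \<in> star_hom G complex_alg"
    and counit: "\<And>x. x \<in> carrier G \<Longrightarrow> tensor_lift G (\<lambda>a b. \<epsilon> a \<odot>\<^bsub>G\<^esub> b) (\<Delta> x) = x"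
    using counit by metis
  define \<omega> where "\<omega> = (\<lambda>x. \<epsilon> (\<phi> x))"
  have \<omega>: "\<omega> \<in> star_hom S complex_alg" using star_hom_comp[OF \<phi> \<epsilon>] by (simp add: \<omega>_def)
  note \<omega>D = star_homD[OF \<omega>]
  define c where "c k = Re (\<omega> (u 1 k))" for k
  have c: "\<omega> (u 1 k) = of_real (c k)" if k: "k \<in> {1..N}" for k
  proof -
    have "star S (u 1 k) = u 1 k" using u_star[of 1 k] k N by (simp add: sphere_alg_def)
    then have "cnj (\<omega> (u 1 k)) = \<omega> (u 1 k)"
      using \<omega>D(6)[OF sphere_gen[OF k]] by (simp add: complex_alg_def)
    then show ?thesis by (simp add: c_def complex_eq_iff)
  qed
  have gen: "(\<lambda>k. u 1 k \<otimes>\<^bsub>S\<^esub> u 1 k) \<in> {1..N} \<rightarrow> carrier S" using sphere_gen by auto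
  have "(\<Oplus>\<^bsub>S\<^esub>k\<in>{1..N}. u 1 k \<otimes>\<^bsub>S\<^esub> u 1 k) = (\<Oplus>\<^bsub>G\<^esub>k\<in>{1..N}. u 1 k \<otimes>\<^bsub>S\<^esub> u 1 k)"
    using star_hom_finsum[OF S.star_algebra_axioms G.star_algebra_axioms sphere_incl[OF N] gen] by simp
  also have "\<dots> = \<one>\<^bsub>S\<^esub>" using u_row[of 1 1] N by (simp add: sphere_alg_def)
  finally have "\<omega> (\<Oplus>\<^bsub>S\<^esub>k\<in>{1..N}. u 1 k \<otimes>\<^bsub>S\<^esub> u 1 k) = 1"
    using \<omega>D(4) by (simp add: complex_alg_def)
  moreover have "\<omega> (\<Oplus>\<^bsub>S\<^esub>k\<in>{1..N}. u 1 k \<otimes>\<^bsub>S\<^esub> u 1 k) = (\<Sum>k=1..N. \<omega> (u 1 k \<otimes>\<^bsub>S\<^esub> u 1 k))"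
    using star_hom_finsum[OF S.star_algebra_axioms C.star_algebra_axioms \<omega> gen]
    by (simp add: finsum_complex)
  moreover have "\<dots> = (\<Sum>k=1..N. of_real ((c k)\<^sup>2))"
    by (rule sum.cong) (use \<omega>D(3) sphere_gen c in \<open>auto simp: complex_alg_def power2_eq_square\<close>)
  ultimately have "complex_of_real (\<Sum>k=1..N. (c k)\<^sup>2) = 1" by simp
  then have c1: "(\<Sum>k=1..N. (c k)\<^sup>2) = 1" using of_real_eq_1_iff by blast
  obtain \<chi> where \<chi>: "\<chi> \<in> star_hom G complex_alg"
    and \<chi>u: "\<And>j. j \<in> {1..N} \<Longrightarrow> \<chi> (u 1 j) = of_real (c j)"
    using reflection_character[OF N c1] by blast
  have \<chi>\<omega>: "\<chi> x = \<omega> x" if "x \<in> carrier S" for x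
    by (rule star_hom_sphere_eqI[OF N star_hom_restrict_sphere[OF N \<chi>] \<omega> _ that]) (simp add: \<chi>u c)
  have "\<phi> (u 1 i) = (\<Oplus>\<^bsub>G\<^esub>k\<in>{1..N}. of_real (c k) \<odot>\<^bsub>G\<^esub> u k i)" if i: "i \<in> {1..N}" for i
  proof -
    let ?x = "u 1 i" and ?T = "tensor_alg G G" and ?ST = "tensor_alg S G"
    let ?\<Lambda> = "\<lambda>\<chi>. tensor_lift G (\<lambda>a b. \<chi> a \<odot>\<^bsub>G\<^esub> b)"
    have 1: "1 \<in> {1..N}" using N by simp
    note incl = tensor_map_star_hom[OF S.star_algebra_axioms G.star_algebra_axioms
        G.star_algebra_axioms G.star_algebra_axioms sphere_incl[OF N] star_hom_id]
    note \<phi>t = tensor_map_star_hom[OF S.star_algebra_axioms G.star_algebra_axioms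
        G.star_algebra_axioms G.star_algebra_axioms \<phi> star_hom_id]
    note \<Lambda>\<epsilon> = slice_star_hom[OF G.star_algebra_axioms G.star_algebra_axioms \<epsilon>]
    note \<Lambda>\<chi> = slice_star_hom[OF G.star_algebra_axioms G.star_algebra_axioms \<chi>]
    have cl: "(\<lambda>k. tens S G (u 1 k) (u k i)) \<in> {1..N} \<rightarrow> carrier ?ST"
      using i u_closed sphere_gen SG.tens_closed by blast
    have "tensor_map G G id id (\<Oplus>\<^bsub>?ST\<^esub>k\<in>{1..N}. tens S G (u 1 k) (u k i)) =
        (\<Oplus>\<^bsub>?T\<^esub>k\<in>{1..N}. tensor_map G G id id (tens S G (u 1 k) (u k i)))"
      by (rule star_hom_finsum[OF SG.T.star_algebra_axioms GG.T.star_algebra_axioms incl(1) cl])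
    also have "\<dots> = (\<Oplus>\<^bsub>?T\<^esub>k\<in>{1..N}. tens G G (u 1 k) (u k i))"
      by (rule GG.T.finsum_cong')
        (use i 1 u_closed sphere_gen GG.tens_closed in \<open>auto simp: incl(2)\<close>)
    also have "\<dots> = \<Delta> ?x" by (rule comult(2)[OF 1 i, symmetric])
    finally have "\<Delta> ?x = tensor_map G G id id (\<Oplus>\<^bsub>?ST\<^esub>k\<in>{1..N}. tens S G (u 1 k) (u k i))"
      by (rule sym)
    then have img: "\<Delta> ?x \<in> tensor_map G G id id ` carrier ?ST"
      using SG.T.finsum_closed[OF cl] by (rule image_eqI)
    define s where "s = sphere_coaction t N ?x"
    have s: "s \<in> carrier ?ST" and s\<Delta>: "tensor_map G G id id s = \<Delta> ?x"
      using inv_into_into[OF img] f_inv_into_f[OF img]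
      by (auto simp: s_def sphere_coaction_def Let_def)
    have "?\<Lambda> \<epsilon> (tensor_map G G \<phi> id s) = ?\<Lambda> \<chi> (tensor_map G G id id s)"
    proof (rule SG.star_hom_tensor_eqI[OF star_hom_comp[OF \<phi>t(1) \<Lambda>\<epsilon>(1)]
            star_hom_comp[OF incl(1) \<Lambda>\<chi>(1)] _ s])
      fix a b assume ab: "a \<in> carrier S" "b \<in> carrier G"
      then show "?\<Lambda> \<epsilon> (tensor_map G G \<phi> id (tens S G a b)) =
          ?\<Lambda> \<chi> (tensor_map G G id id (tens S G a b))"
        using sphere_subset[OF N] star_homD(1)[OF \<phi>] \<chi>\<omega>[OF ab(1)]
        by (auto simp: \<phi>t(2) incl(2) \<Lambda>\<epsilon>(2) \<Lambda>\<chi>(2) \<omega>_def)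
    qed
    moreover have "?\<Lambda> \<epsilon> (tensor_map G G \<phi> id s) = \<phi> ?x"
      unfolding s_def equiv[OF sphere_gen[OF i], symmetric]
      by (rule counit) (rule star_homD(1)[OF \<phi> sphere_gen[OF i]])
    moreover have "?\<Lambda> \<chi> (\<Delta> ?x) = (\<Oplus>\<^bsub>G\<^esub>k\<in>{1..N}. ?\<Lambda> \<chi> (tens G G (u 1 k) (u k i)))"
      unfolding comult(2)[OF 1 i]
      by (rule star_hom_finsum[OF GG.T.star_algebra_axioms G.star_algebra_axioms \<Lambda>\<chi>(1)])
        (use i 1 u_closed GG.tens_closed in blast)
    moreover have "\<dots> = (\<Oplus>\<^bsub>G\<^esub>k\<in>{1..N}. of_real (c k) \<odot>\<^bsub>G\<^esub> u k i)"
      by (rule G.finsum_cong') (use i 1 u_closed G.smult_closed \<chi>u in \<open>auto simp: \<Lambda>\<chi>(2)\<close>)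
    ultimately show ?thesis using s\<Delta> by simp
  qed
  with c1 show thesis by (rule that)
qed

text \<open>The element \<open>E = \<Sum>\<^sub>k u\<^sub>k\<^sub>i \<phi>(x\<^sub>a) u\<^sub>k\<^sub>i\<close> belongs to the quotient but not to the image of \<open>\<phi>\<close>: the
  representations for the phases \<open>1\<close> and \<open>\<i>\<close> agree on all \<open>\<phi>(x\<^sub>j)\<close> and differ on \<open>E\<close>.\<close>

lemma no_coidalgebra_iso:
  assumes N: "N \<ge> 2" and K: "star_algebra K" and \<theta>: "\<theta> \<in> star_hom G K"
    and iso: "sphere_coidalgebra_iso t N (quotient_coideal G \<Delta> K \<theta>) \<phi>"
  shows False
proof -
  let ?Q = "quotient_coideal G \<Delta> K \<theta>"
  have N1: "N \<ge> 1" using N by simp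
  have Q: "?Q \<subseteq> carrier G" by (auto simp: quotient_coideal_def)
  interpret M: star_algebra mat2_alg by (rule star_algebra_mat2)
  obtain c :: "nat \<Rightarrow> real" where c: "(\<Sum>k=1..N. (c k)\<^sup>2) = 1"
    and \<phi>u: "\<And>i. i \<in> {1..N} \<Longrightarrow> \<phi> (u 1 i) = (\<Oplus>\<^bsub>G\<^esub>k\<in>{1..N}. of_real (c k) \<odot>\<^bsub>G\<^esub> u k i)"
    using coidalgebra_iso_gen[OF N1 iso Q] by blast
  have \<phi>Q: "\<phi> \<in> star_hom S (G\<lparr>carrier := ?Q\<rparr>)" and bij: "bij_betw \<phi> (carrier S) ?Q"
    using iso by (auto simp: sphere_coidalgebra_iso_def Let_def)
  have \<phi>: "\<phi> \<in> star_hom S G"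
    using star_homD[OF \<phi>Q] Q by (intro star_homI) auto
  \<comment> \<open>The two representations differ on \<open>E\<close> exactly if \<open>c\<^sub>a \<noteq> 0\<close> and \<open>c\<^sub>i\<^sup>2 \<noteq> 1\<close>. A unit vector has at
    most one coordinate of square 1, so \<open>N \<ge> 2\<close> leaves room for \<open>i\<close>.\<close>
  obtain a where a: "a \<in> {1..N}" "c a \<noteq> 0"
    using c by (metis (no_types, lifting) power_zero_numeral sum.neutral zero_neq_one)
  obtain i where i: "i \<in> {1..N}" "(c i)\<^sup>2 \<noteq> 1"
  proof (cases "(c 1)\<^sup>2 = 1")
    case True
    have "(\<Sum>k\<in>{1..N} - {1}. (c k)\<^sup>2) = 0"
      using c N True sum.remove[of "{1..N}" 1 "\<lambda>k. (c k)\<^sup>2"] by simp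
    then have "(c 2)\<^sup>2 = 0" using N by (auto simp: sum_nonneg_eq_0_iff)
    then show ?thesis using that[of 2] N by simp
  qed (use that[of 1] N in auto)
  let ?y = "\<phi> (u 1 a)"
  let ?E = "\<Oplus>\<^bsub>G\<^esub>k\<in>{1..N}. u k i \<otimes>\<^bsub>G\<^esub> ?y \<otimes>\<^bsub>G\<^esub> u k i"
  have y: "?y \<in> ?Q" using star_homD(1)[OF \<phi>Q sphere_gen[OF a(1)]] by simp
  have "?E \<in> ?Q" by (rule quotient_coideal_sandwich[OF K \<theta> y i(1) i(1)])
  then obtain x where x: "x \<in> carrier S" "?E = \<phi> x"
    using bij unfolding bij_betw_def by blast
  have rep: "\<pi> (\<phi> (u 1 j)) = antidiag (of_real (c j)) (of_real (c j))"
    "\<pi> ?E = antidiag (of_real (c a) * (z\<^sup>2 + of_real ((c i)\<^sup>2) * (1 - z\<^sup>2)))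
       (cnj (of_real (c a) * (z\<^sup>2 + of_real ((c i)\<^sup>2) * (1 - z\<^sup>2))))"
    if \<pi>: "\<pi> \<in> star_hom G mat2_alg" and j: "j \<in> {1..N}"
      and v: "\<forall>i\<in>{1..N}. \<forall>j\<in>{1..N}. \<pi> (u i j) =
        antidiag (rank_one_update z (1 - z) c (i, j)) (cnj (rank_one_update z (1 - z) c (i, j)))"
    for \<pi> z j
  proof -
    let ?v = "rank_one_update z (1 - z) c"
    note \<pi>D = star_homD[OF \<pi>]
    have gen: "\<pi> (\<phi> (u 1 j)) = antidiag (of_real (c j)) (of_real (c j))" if j: "j \<in> {1..N}" for j
    proof -
      have "\<pi> (\<phi> (u 1 j)) = (\<Oplus>\<^bsub>mat2_alg\<^esub>k\<in>{1..N}. \<pi> (of_real (c k) \<odot>\<^bsub>G\<^esub> u k j))"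
        unfolding \<phi>u[OF j]
        by (rule star_hom_finsum[OF G.star_algebra_axioms M.star_algebra_axioms \<pi>])
          (use j u_closed G.smult_closed in blast)
      also have "\<dots> = (\<Oplus>\<^bsub>mat2_alg\<^esub>k\<in>{1..N}.
          antidiag (of_real (c k) * ?v (k, j)) (of_real (c k) * cnj (?v (k, j))))"
        by (rule M.finsum_cong') (use j u_closed in \<open>auto simp: \<pi>D(5) v mat2_simps\<close>)
      also have "\<dots> = antidiag (\<Sum>k=1..N. of_real (c k) * ?v (k, j))
          (\<Sum>k=1..N. of_real (c k) * cnj (?v (k, j)))"
        by (rule finsum_mat2) simp
      also have "(\<Sum>k=1..N. of_real (c k) * ?v (k, j)) = of_real (c j)"
      proof -
        have "of_real (c k) * ?v (k, j) =
            (if k = j then z * of_real (c j) else 0) + (1 - z) * of_real (c j) * of_real ((c k)\<^sup>2)" for k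
          by (auto simp: rank_one_update_def power2_eq_square algebra_simps)
        then have "(\<Sum>k=1..N. of_real (c k) * ?v (k, j)) =
            z * of_real (c j) + (1 - z) * of_real (c j) * of_real (\<Sum>k=1..N. (c k)\<^sup>2)"
          using j by (simp add: sum.distrib sum_distrib_left[symmetric])
        then show ?thesis unfolding c by (simp add: algebra_simps)
      qed
      also have "(\<Sum>k=1..N. of_real (c k) * cnj (?v (k, j))) = cnj (\<Sum>k=1..N. of_real (c k) * ?v (k, j))"
        by simp
      also have "(\<Sum>k=1..N. of_real (c k) * ?v (k, j)) = of_real (c j)" by fact
      finally show ?thesis by simp
    qed
    then show "\<pi> (\<phi> (u 1 j)) = antidiag (of_real (c j)) (of_real (c j))" using j .
    have yG: "?y \<in> carrier G" using y Q by blast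
    have "\<pi> ?E = (\<Oplus>\<^bsub>mat2_alg\<^esub>k\<in>{1..N}. \<pi> (u k i \<otimes>\<^bsub>G\<^esub> ?y \<otimes>\<^bsub>G\<^esub> u k i))"
      by (rule star_hom_finsum[OF G.star_algebra_axioms M.star_algebra_axioms \<pi>])
        (use i u_closed yG in auto)
    also have "\<dots> = (\<Oplus>\<^bsub>mat2_alg\<^esub>k\<in>{1..N}.
        antidiag (of_real (c a) * (?v (i, k) * ?v (i, k))) (cnj (of_real (c a) * (?v (i, k) * ?v (i, k)))))"
      by (rule M.finsum_cong')
        (use i a u_closed yG gen in \<open>auto simp: \<pi>D(3) v mat2_simps rank_one_update_sym[of _ _ _ _ i] mult_ac\<close>)
    also have "\<dots> = antidiag (of_real (c a) * (\<Sum>k=1..N. ?v (i, k) * ?v (i, k)))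
        (cnj (of_real (c a) * (\<Sum>k=1..N. ?v (i, k) * ?v (i, k))))"
      by (simp add: finsum_mat2 sum_distrib_left)
    also have "(\<Sum>k=1..N. ?v (i, k) * ?v (i, k)) = z\<^sup>2 + of_real ((c i)\<^sup>2) * (1 - z\<^sup>2)"
      using sum_rank_one_update_mult[OF finite_atLeastAtMost i(1) i(1) c]
      by (simp add: power2_eq_square algebra_simps)
    finally show "\<pi> ?E = antidiag (of_real (c a) * (z\<^sup>2 + of_real ((c i)\<^sup>2) * (1 - z\<^sup>2)))
       (cnj (of_real (c a) * (z\<^sup>2 + of_real ((c i)\<^sup>2) * (1 - z\<^sup>2))))" .
  qed
  obtain \<pi> where \<pi>: "\<pi> \<in> star_hom G mat2_alg"
    and v: "\<forall>i\<in>{1..N}. \<forall>j\<in>{1..N}. \<pi> (u i j) =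
      antidiag (rank_one_update 1 (1 - 1) c (i, j)) (cnj (rank_one_update 1 (1 - 1) c (i, j)))"
    by (rule twisted_rotation_rep[OF c, of 1]) simp_all
  obtain \<pi>' where \<pi>': "\<pi>' \<in> star_hom G mat2_alg"
    and v': "\<forall>i\<in>{1..N}. \<forall>j\<in>{1..N}. \<pi>' (u i j) =
      antidiag (rank_one_update \<i> (1 - \<i>) c (i, j)) (cnj (rank_one_update \<i> (1 - \<i>) c (i, j)))"
    by (rule twisted_rotation_rep[OF c, of \<i>]) simp_all
  have "\<pi> (\<phi> x) = \<pi>' (\<phi> x)"
    by (rule star_hom_sphere_eqI[OF N1 star_hom_comp[OF \<phi> \<pi>] star_hom_comp[OF \<phi> \<pi>'] _ x(1)])
      (simp add: rep(1)[OF \<pi> _ v] rep(1)[OF \<pi>' _ v'])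
  then have "complex_of_real (c a) = of_real (c a) * (-1 + of_real ((c i)\<^sup>2) * 2)"
    unfolding x(2)[symmetric] rep(2)[OF \<pi> i(1) v] rep(2)[OF \<pi>' i(1) v'] by (simp add: antidiag_def)
  then have "complex_of_real ((c i)\<^sup>2) = 1" using a(2) by (simp add: algebra_simps)
  then show False using i(2) of_real_eq_1_iff by blast
qed

end

theorem proposition7p1:
  fixes N :: nat and t :: orthogonal_kind
  assumes "N \<ge> 2"
  shows "\<not> (\<exists>(K :: 'k star_alg) \<Delta>K \<theta> \<phi>.
    compact_quantum_subgroup (orth_alg t N) (orth_comult t N) K \<Delta>K \<theta> \<and>
    sphere_coidalgebra_iso t N
      (quotient_coideal (orth_alg t N) (orth_comult t N) K \<theta>) \<phi>)"
proof -
  interpret orth_group t N .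
  show ?thesis
    using no_coidalgebra_iso[OF assms]
    unfolding compact_quantum_subgroup_def compact_quantum_group_def hopf_star_algebra_def by blast
qed

end
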